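(* Let $m,p,d\ge 1$ be integers with $r:=p-m\ge 0$ and $s:=d-p-m\ge 0$. For every integer $n\ge 1$ and every $t>0$, the $n$-th moment $M_n(t)=\mathbb{E}\big(\mathrm{tr}(J_t^n)\big)$ of the $m\times m$ Hermitian Jacobi process $J$ of parameters $(p,d-p)$ is $$M_n(t) = M_n(\infty) + \sum_{\substack{\alpha \text{ hook} \\ |\alpha| = n,\ l(\alpha) \leq m}} (-1)^{n-\alpha_1} \sum_{\substack{\tau \subseteq \alpha \\ \tau \neq \emptyset}} \frac{e^{-\nu_\tau t} \, \tilde{V}_{\alpha_1, \tau_1}^{r,s,m} \, U_{l(\alpha), l(\tau)}^{r,s,m} }{(r+s+\tau_1+2m-l(\tau)) (\tau_1+l(\tau)-1)},$$ where $$\tilde{V}_{\alpha_1, \tau_1}^{r,s,m} = \frac{(r+s+2\tau_1+2m-1)\,\Gamma(\tau_1+2m+r+s)\,\Gamma(\alpha_1+m)\,\Gamma(r+\alpha_1+m)\,\Gamma(\tau_1+m+s)}{(\alpha_1-\tau_1)!\,(\tau_1-1)!\,\Gamma(r+s+\alpha_1+\tau_1+2m)\,\Gamma(r+\tau_1+m)}$$ and $$U_{l(\alpha), l(\tau)}^{r,s,m} = \frac{(2m+r+s+1-2l(\tau))\,\Gamma(r+m-l(\tau)+1)\,\Gamma(r+s+2m-l(\alpha)-l(\tau)+1)}{(l(\alpha)- l(\tau))!\,(l(\tau)-1)!\,\Gamma(m-l(\alpha)+1)\,\Gamma(r+m-l(\alpha)+1)\,\Gamma(m+s-l(\tau)+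1)\,\Gamma(2m+r+s-l(\tau)+1)}.$$
   Context: **Partitions.** A partition $\tau=(\tau_1\ge\tau_2\ge\cdots\ge 0)$ has weight $|\tau|=\sum_i\tau_i$ and length $l(\tau)$, the number of nonzero parts; it is padded by zeros when needed. A hook of weight $n$ is a partition $\alpha=(n-k,1^k)$, $0\le k\le n-1$. $\tau\subseteq\alpha$ means $\tau_i\le\alpha_i$ for all $i$. For a partition $\tau$ with $l(\tau)\le m$, $$\nu_{\tau}=\sum_{i=1}^m\tau_i(\tau_i+r+s+1+2(m-i)).$$ **Hermitian Jacobi process.** Let $Y=(Y_t)_{t\ge 0}$ be the Brownian motion on the unitary group $U(d)$ started at the identity, and let $X_t$ be the upper left $m\times p$ corner of $Y_t$. Then $J_t=X_tX_t^*$ is the Hermitian Jacobi process of size $m\times m$ and parameters $(p,q)$, $q=d-p$. With $r=p-m\ge0$ and $s=d-p-m\ge 0$, the Brownian motion is normalized so that for $t>0$ the eigenvalues of $J_t$, in decreasing order, have (this is a known fact which may be taken as the definition of the law involved) the density on $\{0<y_m<\cdots<y_1<1\}$ $$G_t^{r,s,m}(1^m,y)=\sum_{\tau:\ l(\tau)\le m}e^{-\nu_\tau t}\Big(\prod_{j=1}^m\frac{1}{\|\tilde P^{r,s}_{\tau_j+m-j}\|_2^2}\Big)\tilde P_\tau^{r,s,m}(1^m)\,\tilde P_\tau^{r,s,m}(y)\,W^{r,s,m}(y),$$ an absolutely convergent series. Here $1^m=(1,\dots,1)$ ($m$ times); $$\tilde{P}_k^{r,s}(u)=\frac{(r+1)_k}{k!}\,{}_2F_1(-k,k+r+s+1;r+1;u)$$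 are the Jacobi polynomials orthogonal for the weight $u^r(1-u)^s$ on $[0,1]$, and $\|\cdot\|_2$ is the norm of $L^2([0,1],u^r(1-u)^sdu)$; $$\tilde P_\tau^{r,s,m}(x)=\frac{\det(\tilde P^{r,s}_{\tau_i-i+m}(x_j))_{1\le i,j\le m}}{V(x)},\qquad V(x)=\prod_{1\le i<j\le m}(x_i-x_j)$$ (a symmetric polynomial, extended by continuity to coinciding coordinates); and $$W^{r,s,m}(y)=V(y)^2\prod_{i=1}^my_i^r(1-y_i)^s\,\mathbf 1_{0<y_m<\cdots<y_1<1}.$$ Thus $M_n(t)=\mathbb{E}(\mathrm{tr}(J_t^n))=\int\big(\sum_{i=1}^my_i^n\big)G_t^{r,s,m}(1^m,y)\,dy$. **Stationary moment.** $$M_n(\infty)=\frac{1}{Z^{r,s,m}}\int\Big(\sum_{i=1}^my_i^n\Big)W^{r,s,m}(y)\,dy,\qquad Z^{r,s,m}=\int W^{r,s,m}(y)\,dy.$$ *)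

theory Defs
  imports
    "HOL-Probability.Probability"
    "Jordan_Normal_Form.Schur_Decomposition"
    "Jordan_Normal_Form.Char_Poly"
begin

section \<open>Partitions\<close>

text \<open>A partition is the list of its nonzero parts, so that its length is the length of the list
  and its weight is the sum of the list. Parts are indexed from 1.\<close>

definition partitions :: "nat list set" where
  "partitions = {\<tau>. sorted_wrt (\<ge>) \<tau> \<and> 0 \<notin> set \<tau>}"

definition part :: "nat list \<Rightarrow> nat \<Rightarrow> nat" where
  "part \<tau> i = (if 1 \<le> i \<and> i \<le> length \<tau> then \<tau> ! (i - 1) else 0)"

definition part_le :: "nat list \<Rightarrow> nat list \<Rightarrow> bool" where
  "part_le \<tau> \<alpha> \<longleftrightarrow> (\<forall>i\<ge>1. part \<tau> i \<le> part \<alpha> i)"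

definition hooks :: "nat \<Rightarrow> nat list set" where
  "hooks n = {(n - k) # replicate k 1 | k. k < n}"

definition nu :: "nat \<Rightarrow> nat \<Rightarrow> nat \<Rightarrow> nat list \<Rightarrow> nat" where
  "nu r s m \<tau> = (\<Sum>i=1..m. part \<tau> i * (part \<tau> i + r + s + 1 + 2 * (m - i)))"

text \<open>Both index sets of the double sum over partitions are finite.\<close>

lemma finite_hooks: "finite (hooks n)"
proof -
  have "hooks n = (\<lambda>k. (n - k) # replicate k 1) ` {..<n}"
    unfolding hooks_def by auto
  then show ?thesis by simp
qed

lemma finite_part_le: "finite {\<tau> \<in> partitions. part_le \<tau> \<alpha>}"
proof (rule finite_subset)
  show "{\<tau> \<in> partitions. part_le \<tau> \<alpha>} \<subseteq>
      {\<tau>. set \<tau> \<subseteq> {..sum_list \<alpha>} \<and> length \<tau> \<le> length \<alpha>}"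
  proof (rule subsetI, rule CollectI, rule conjI)
    fix \<tau> assume "\<tau> \<in> {\<tau> \<in> partitions. part_le \<tau> \<alpha>}"
    then have p: "0 \<notin> set \<tau>" and le: "\<And>i. i \<ge> 1 \<Longrightarrow> part \<tau> i \<le> part \<alpha> i"
      unfolding partitions_def part_le_def by auto
    show len: "length \<tau> \<le> length \<alpha>"
    proof (rule ccontr)
      assume a: "\<not> length \<tau> \<le> length \<alpha>"
      then have "\<tau> ! (length \<tau> - 1) = 0"
        using le[of "length \<tau>"] unfolding part_def by auto
      with p a show False
        by (metis One_nat_def diff_less less_Suc_eq_0_disj linorder_not_le not_less_zero nth_mem
            gr0I le0)
    qed
    show "set \<tau> \<subseteq> {..sum_list \<alpha>}"
    proof
      fix x assume "x \<in> set \<tau>"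
      then obtain i where i: "i < length \<tau>" "x = \<tau> ! i" by (metis in_set_conv_nth)
      then have "x \<le> \<alpha> ! i" using le[of "Suc i"] len unfolding part_def by auto
      also have "\<dots> \<le> sum_list \<alpha>" using i len by (intro elem_le_sum_list) auto
      finally show "x \<in> {..sum_list \<alpha>}" by simp
    qed
  qed
  show "finite {\<tau>. set \<tau> \<subseteq> {..sum_list \<alpha>} \<and> length \<tau> \<le> length \<alpha>}"
    by (rule finite_lists_length_le) simp
qed


section \<open>Jacobi polynomials\<close>

definition hyp2F1 :: "real \<Rightarrow> real \<Rightarrow> real \<Rightarrow> real \<Rightarrow> real" where
  "hyp2F1 a b c u = (\<Sum>n. pochhammer a n * pochhammer b n / (pochhammer c n * fact n) * u ^ n)"

definition jacobi_poly :: "nat \<Rightarrow> nat \<Rightarrow> nat \<Rightarrow> real \<Rightarrow> real" where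
  "jacobi_poly r s k u =
     pochhammer (real r + 1) k / fact k *
     hyp2F1 (- real k) (real k + real r + real s + 1) (real r + 1) u"

definition jacobi_L2_norm :: "nat \<Rightarrow> nat \<Rightarrow> (real \<Rightarrow> real) \<Rightarrow> real" where
  "jacobi_L2_norm r s f = sqrt (LINT u:{0..1}|lborel. (f u)\<^sup>2 * (u ^ r * (1 - u) ^ s))"

text \<open>Points of the \<open>m\<close>-dimensional space are functions on \<open>nat\<close>, of which only the
  coordinates \<open>1, \<dots>, m\<close> matter.\<close>

definition vandermonde :: "nat \<Rightarrow> (nat \<Rightarrow> real) \<Rightarrow> real" where
  "vandermonde m x = (\<Prod>j=1..m. \<Prod>i=1..<j. x i - x j)"

text \<open>Rows and columns of matrices are indexed from 0, hence the shifts by one;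
  \<open>part \<tau> (i + 1) + m - (i + 1)\<close> is not truncated because \<open>i < m\<close>.\<close>

definition multi_jacobi_quotient ::
    "nat \<Rightarrow> nat \<Rightarrow> nat \<Rightarrow> nat list \<Rightarrow> (nat \<Rightarrow> real) \<Rightarrow> real" where
  "multi_jacobi_quotient r s m \<tau> x =
     Determinant.det (Matrix.mat m m
       (\<lambda>(i, j). jacobi_poly r s (part \<tau> (i + 1) + m - (i + 1)) (x (j + 1)))) / vandermonde m x"

text \<open>Extension by continuity to coinciding coordinates; the limit is taken in the product
  topology on \<open>nat \<Rightarrow> real\<close>.\<close>

definition multi_jacobi_poly ::
    "nat \<Rightarrow> nat \<Rightarrow> nat \<Rightarrow> nat list \<Rightarrow> (nat \<Rightarrow> real) \<Rightarrow> real" where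
  "multi_jacobi_poly r s m \<tau> x =
     (if inj_on x {1..m} then multi_jacobi_quotient r s m \<tau> x
      else Lim (at x within {z. inj_on z {1..m}}) (multi_jacobi_quotient r s m \<tau>))"

definition chamber :: "nat \<Rightarrow> (nat \<Rightarrow> real) set" where
  "chamber m = {y. (\<forall>i\<in>{1..m}. 0 < y i \<and> y i < 1) \<and>
                   (\<forall>i\<in>{1..m}. \<forall>j\<in>{1..m}. i < j \<longrightarrow> y j < y i)}"

definition jacobi_weight :: "nat \<Rightarrow> nat \<Rightarrow> nat \<Rightarrow> (nat \<Rightarrow> real) \<Rightarrow> real" where
  "jacobi_weight r s m y =
     (vandermonde m y)\<^sup>2 * (\<Prod>i=1..m. y i ^ r * (1 - y i) ^ s) * indicator (chamber m) y"


section \<open>Eigenvalue density and moments\<close>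

definition jacobi_density ::
    "nat \<Rightarrow> nat \<Rightarrow> nat \<Rightarrow> real \<Rightarrow> (nat \<Rightarrow> real) \<Rightarrow> real" where
  "jacobi_density r s m t y =
     (\<Sum>\<^sub>\<infinity>\<tau>\<in>{\<tau> \<in> partitions. length \<tau> \<le> m}.
        exp (- real (nu r s m \<tau>) * t) *
        (\<Prod>j=1..m. 1 / (jacobi_L2_norm r s (jacobi_poly r s (part \<tau> j + m - j)))\<^sup>2) *
        multi_jacobi_poly r s m \<tau> (\<lambda>_. 1) * multi_jacobi_poly r s m \<tau> y *
        jacobi_weight r s m y)"

abbreviation lborel_m :: "nat \<Rightarrow> (nat \<Rightarrow> real) measure" where
  "lborel_m m \<equiv> PiM {1..m} (\<lambda>_. lborel)"

definition jacobi_moment :: "nat \<Rightarrow> nat \<Rightarrow> nat \<Rightarrow> nat \<Rightarrow> real \<Rightarrow> real" where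
  "jacobi_moment r s m n t = (LINT y|lborel_m m. (\<Sum>i=1..m. y i ^ n) * jacobi_density r s m t y)"

definition stationary_moment :: "nat \<Rightarrow> nat \<Rightarrow> nat \<Rightarrow> nat \<Rightarrow> real" where
  "stationary_moment r s m n =
     (LINT y|lborel_m m. (\<Sum>i=1..m. y i ^ n) * jacobi_weight r s m y) /
     (LINT y|lborel_m m. jacobi_weight r s m y)"


section \<open>The Hermitian Jacobi process\<close>

definition mat_trace :: "complex mat \<Rightarrow> complex" where
  "mat_trace A = (\<Sum>i<dim_row A. A $$ (i, i))"

text \<open>Eigenvalues with multiplicity in decreasing order, indexed from 1, of a matrix
  with real spectrum.\<close>

definition ordered_eigenvalues :: "nat \<Rightarrow> complex mat \<Rightarrow> nat \<Rightarrow> real" where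
  "ordered_eigenvalues m A = (\<lambda>i\<in>{1..m}.
     rev (sorted_list_of_multiset (image_mset Re (proots (char_poly A)))) ! (i - 1))"

definition corner :: "nat \<Rightarrow> nat \<Rightarrow> complex mat \<Rightarrow> complex mat" where
  "corner m p Y = Matrix.mat m p (\<lambda>(i, j). Y $$ (i, j))"

definition jacobi_matrix :: "nat \<Rightarrow> nat \<Rightarrow> complex mat \<Rightarrow> complex mat" where
  "jacobi_matrix m p Y = corner m p Y * mat_adjoint (corner m p Y)"

text \<open>The Brownian motion \<open>Y\<close> on \<open>U(d)\<close> enters only through the law of the eigenvalues of
  \<open>jacobi_matrix m p (Y t)\<close>, which is taken as the definition. Nonnegativity of the
  density is stated separately because \<open>ennreal\<close> truncates negative values to 0.\<close>

definition hermitian_jacobi_process ::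
    "'a measure \<Rightarrow> nat \<Rightarrow> nat \<Rightarrow> nat \<Rightarrow> (real \<Rightarrow> 'a \<Rightarrow> complex mat) \<Rightarrow> bool" where
  "hermitian_jacobi_process \<Omega> m p d Y \<longleftrightarrow>
     prob_space \<Omega> \<and>
     (\<forall>t\<ge>0. \<forall>\<omega>\<in>space \<Omega>. Y t \<omega> \<in> carrier_mat d d \<and> mat_adjoint (Y t \<omega>) * Y t \<omega> = 1\<^sub>m d) \<and>
     (\<forall>\<omega>\<in>space \<Omega>. Y 0 \<omega> = 1\<^sub>m d) \<and>
     (\<forall>t>0.
        distributed \<Omega> (lborel_m m) (\<lambda>\<omega>. ordered_eigenvalues m (jacobi_matrix m p (Y t \<omega>)))
          (\<lambda>y. ennreal (jacobi_density (p - m) (d - p - m) m t y)) \<and>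
        (AE y in lborel_m m. 0 \<le> jacobi_density (p - m) (d - p - m) m t y))"


section \<open>Coefficients of the moment expansion\<close>

definition V_coeff :: "nat \<Rightarrow> nat \<Rightarrow> nat \<Rightarrow> nat \<Rightarrow> nat \<Rightarrow> real" where
  "V_coeff r s m a t =
     (real r + real s + 2 * real t + 2 * real m - 1) *
     Gamma (real t + 2 * real m + real r + real s) * Gamma (real a + real m) *
     Gamma (real r + real a + real m) * Gamma (real t + real m + real s) /
     (fact (a - t) * fact (t - 1) *
      Gamma (real r + real s + real a + real t + 2 * real m) * Gamma (real r + real t + real m))"

definition U_coeff :: "nat \<Rightarrow> nat \<Rightarrow> nat \<Rightarrow> nat \<Rightarrow> nat \<Rightarrow> real" where
  "U_coeff r s m a t =
     (2 * real m + real r + real s + 1 - 2 * real t) *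
     Gamma (real r + real m - real t + 1) *
     Gamma (real r + real s + 2 * real m - real a - real t + 1) /
     (fact (a - t) * fact (t - 1) *
      Gamma (real m - real a + 1) * Gamma (real r + real m - real a + 1) *
      Gamma (real m + real s - real t + 1) * Gamma (2 * real m + real r + real s - real t + 1))"

end

theory Submission
  imports Defs "HOL-Real_Asymp.Real_Asymp"
begin

text \<open>Write \<open>k i = \<tau>\<^sub>i\<^sub>+\<^sub>1 + m - 1 - i\<close> and \<open>\<lambda> k = k (k + r + s + 1)\<close>. Since
  \<open>\<nu>\<^sub>\<tau> = \<Sum>\<^sub>i (\<lambda> (k i) - \<lambda> (m - 1 - i))\<close>, the factor \<open>exp (- \<nu>\<^sub>\<tau> t)\<close> beats every other
  factor of the density, and the moment is the sum over \<open>\<tau>\<close> of the integrals of the terms.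
  Newton's divided differences stay continuous when points collide; at \<open>1, \<dots>, 1\<close> they are Taylor
  coefficients, so up to a constant \<open>P\<^sub>\<tau>(1\<^sup>m)\<close> is the product of the values \<open>P\<^bsub>k i\<^esub>(1)\<close> and the Vandermonde
  determinant of the \<open>\<lambda> (k i)\<close>. Multiplying the Vandermonde determinant \<open>V(y)\<close> by a power sum is
  the same as multiplying one row of \<open>det (P\<^bsub>m - 1 - i\<^esub>(y\<^sub>j))\<close> by \<open>y\<^sub>j\<^sup>n\<close>, summed over the rows; by
  Andreief's identity and orthogonality only hooks \<open>\<tau>\<close> survive, each leaving one inner product
  \<open>\<langle>u\<^sup>n P\<^bsub>m - l(\<tau>)\<^esub>, P\<^bsub>\<tau>\<^sub>1 + m - 1\<^esub>\<rangle>\<close>. Expanding \<open>P\<^bsub>m - l(\<tau>)\<^esub>\<close> in powers of \<open>u\<close> turns it into the sum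
  over the hooks \<open>\<alpha>\<close>, the power \<open>u\<^sup>j\<close> corresponding to \<open>l(\<alpha>) = m - j\<close>.\<close>

hide_const (open) module.smult

section \<open>Jacobi polynomials\<close>

text \<open>No normalising constant has to be evaluated: the empty partition yields the stationary
  moment, and a hook \<tau> enters through the ratio of its value at \<open>1, ..., 1\<close> to
  that of the empty partition. Put \<open>L = \<tau>\<^sub>1 + m - 1\<close> and
  \<open>A = m - l(\<tau>)\<close>. The degrees attached to \<tau> are \<open>m - 1, ..., 0\<close>
  with \<open>A\<close> replaced by \<open>L\<close>, so in this ratio every factor cancels that
  involves neither \<open>A\<close> nor \<open>L\<close>. What keeps the rest from being complete
  factorial products is the absent difference \<open>\<lambda> L - \<lambda> A = (r + s +
  \<tau>\<^sub>1 + 2 m - l(\<tau>)) (\<tau>\<^sub>1 + l(\<tau>) - 1)\<close>: this is the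
  denominator of the formula. For \<open>l(\<alpha>) = m - j\<close> and weight \<open>n\<close> one
  has \<open>n + j - L = \<alpha>\<^sub>1 - \<tau>\<^sub>1\<close>. Hence the inner product of
  \<open>u^(n+j)\<close> with the polynomial of degree \<open>L\<close> depends on first parts only
  and vanishes unless \<open>\<tau>\<^sub>1 \<le> \<alpha>\<^sub>1\<close>; the coefficient of
  \<open>u^j\<close> in the polynomial of degree \<open>A\<close> depends on lengths only and
  vanishes unless \<open>l(\<tau>) \<le> l(\<alpha>)\<close>. This separates V from U and produces
  the condition that \<tau> lies in \<alpha>. Convergence needs no sharp estimate, since bounds of
  size \<open>k^(6k)\<close> lose against \<open>exp (- t k^2)\<close>.\<close>

definition jcoef :: "nat \<Rightarrow> nat \<Rightarrow> nat \<Rightarrow> nat \<Rightarrow> real" where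
  "jcoef r s k j = pochhammer (real r + 1) k / fact k *
     (pochhammer (- real k) j * pochhammer (real k + real r + real s + 1) j /
      (pochhammer (real r + 1) j * fact j))"

definition jpoly :: "nat \<Rightarrow> nat \<Rightarrow> nat \<Rightarrow> real poly" where
  "jpoly r s k = (\<Sum>j\<le>k. monom (jcoef r s k j) j)"

lemma jcoef_eq_0: "k < j \<Longrightarrow> jcoef r s k j = 0"
  by (simp add: jcoef_def pochhammer_of_nat_eq_0_lemma)

lemma coeff_jpoly: "coeff (jpoly r s k) j = jcoef r s k j"
proof -
  have "coeff (jpoly r s k) j = (\<Sum>i\<le>k. if j = i then jcoef r s k i else 0)"
    by (auto simp: jpoly_def coeff_sum intro!: sum.cong)
  then show ?thesis by (simp add: sum.delta' jcoef_eq_0)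
qed

lemma poly_jpoly: "poly (jpoly r s k) u = (\<Sum>j\<le>k. jcoef r s k j * u ^ j)"
  by (simp add: jpoly_def poly_sum poly_monom)

lemma jacobi_poly_eq_poly: "jacobi_poly r s k u = poly (jpoly r s k) u"
proof -
  let ?f = "\<lambda>n. pochhammer (- real k) n * pochhammer (real k + real r + real s + 1) n /
      (pochhammer (real r + 1) n * fact n) * u ^ n"
  have "suminf ?f = sum ?f {..k}"
    by (rule suminf_finite) (auto simp: pochhammer_of_nat_eq_0_lemma)
  then show ?thesis
    unfolding jacobi_poly_def hyp2F1_def poly_jpoly jcoef_def
    by (simp add: sum_distrib_left mult.assoc)
qed

lemma jcoef_Suc:
  "jcoef r s k (Suc i) = jcoef r s k i *
     ((real i - real k) * (real k + real r + real s + 1 + real i) / ((real r + 1 + real i) * (real i + 1)))"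
  by (simp add: jcoef_def pochhammer_Suc add_ac mult_ac)

text \<open>Coefficientwise this is the derivative rule \<open>P' = - (k + r + s + 2) Q\<close> with
  \<open>P = jpoly r s (Suc k)\<close> and \<open>Q = jpoly (Suc r) (Suc s) k\<close>. The factor
  \<open>k + 1\<close> is kept on both sides because \<open>jpoly_raise\<close> carries it.\<close>

lemma jcoef_raise_Suc:
  "real (Suc k) * jcoef r s (Suc k) (Suc i) =
   - jcoef (Suc r) (Suc s) k i * (real k + 1) * (real k + real r + real s + 2) / (real i + 1)"
proof -
  have p: "pochhammer (- (1 + real k)) (Suc i) = - (1 + real k) * pochhammer (- real k) i"
    "pochhammer (real r + 1) (Suc k) = (real r + 1) * pochhammer (real r + 2) k"
    "pochhammer (real r + 1) (Suc i) = (real r + 1) * pochhammer (real r + 2) i"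
    "pochhammer (real k + real r + real s + 2) (Suc i) =
       (real k + real r + real s + 2) * pochhammer (real k + real r + real s + 3) i"
    by (subst pochhammer_rec, simp add: add_ac)+
  have [simp]: "pochhammer (real r + 1) i \<noteq> 0" "pochhammer (real r + 2) i \<noteq> 0" "real r + 1 \<noteq> 0"
    using pochhammer_pos[of "real r + 1" i] pochhammer_pos[of "real r + 2" i] by auto
  have "jcoef r s (Suc k) (Suc i) = (real r + 1) * pochhammer (real r + 2) k / fact (Suc k) *
     (- (1 + real k) * pochhammer (- real k) i * ((real k + real r + real s + 2) *
       pochhammer (real k + real r + real s + 3) i) /
      ((real r + 1) * pochhammer (real r + 2) i * fact (Suc i)))"
    unfolding jcoef_def p[symmetric] by (simp add: add_ac)
  moreover have "jcoef (Suc r) (Suc s) k i = pochhammer (real r + 2) k / fact k *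
     (pochhammer (- real k) i * pochhammer (real k + real r + real s + 3) i /
      (pochhammer (real r + 2) i * fact i))"
    unfolding jcoef_def by (simp add: add_ac)
  moreover have "(fact (Suc k) :: real) = (real k + 1) * fact k"
     "(fact (Suc i) :: real) = (real i + 1) * fact i" by simp_all
  moreover have "(k' + 1) * (R * Q / ((k' + 1) * F) * (- (k' + 1) * P * (K * S) / (R * T * ((i' + 1) * G)))) =
     - (Q / F * (P * S / (T * G))) * (k' + 1) * K / (i' + 1)"
    if "k' + 1 \<noteq> 0" "i' + 1 \<noteq> 0" "R \<noteq> 0" "F \<noteq> 0" "T \<noteq> 0" "G \<noteq> 0"
    for k' i' R Q F P K S T G :: real
    using that by (simp add: divide_simps) (simp add: algebra_simps)
  moreover have "real k + 1 \<noteq> 0" "real i + 1 \<noteq> 0" by linarith+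
  ultimately show ?thesis by (simp only: of_nat_Suc add.commute[of 1 "real k"] \<open>real r + 1 \<noteq> 0\<close>
      \<open>pochhammer (real r + 2) i \<noteq> 0\<close> fact_nonzero not_False_eq_True simp_thms)
qed

lemma jcoef_raise_0:
  "real (Suc k) * jcoef r s (Suc k) 0 = (real r + 1) * jcoef (Suc r) (Suc s) k 0"
proof -
  have "pochhammer (real r + 1) (Suc k) = (real r + 1) * pochhammer (real r + 2) k"
    by (subst pochhammer_rec) (simp add: add_ac)
  then show ?thesis by (simp add: jcoef_def add_ac divide_simps) 
qed

text \<open>Multiplied by the weight \<open>u^r (1 - u)^s\<close>, the right side is the derivative
  of \<open>u^(r+1) (1 - u)^(s+1)\<close> times \<open>jpoly (Suc r) (Suc s) k\<close>: one step of
  Rodrigues' formula. Reflection and orthogonality both follow from it by induction.\<close>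

lemma jpoly_raise:
  "smult (real (Suc k)) (jpoly r s (Suc k)) =
   [:real r + 1, - (real r + real s + 2):] * jpoly (Suc r) (Suc s) k +
   [:0, 1, -1:] * pderiv (jpoly (Suc r) (Suc s) k)"
proof (rule poly_eqI)
  fix j
  let ?p = "jcoef (Suc r) (Suc s) k"
  show "coeff (smult (real (Suc k)) (jpoly r s (Suc k))) j =
   coeff ([:real r + 1, - (real r + real s + 2):] * jpoly (Suc r) (Suc s) k +
   [:0, 1, -1:] * pderiv (jpoly (Suc r) (Suc s) k)) j"
  proof (cases j)
    case 0
    then show ?thesis
      using jcoef_raise_0[of k r s] by (simp add: coeff_jpoly)
  next
    case (Suc i)
    have c: "coeff ([:real r + 1, - (real r + real s + 2):] * jpoly (Suc r) (Suc s) k +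
        [:0, 1, -1:] * pderiv (jpoly (Suc r) (Suc s) k)) (Suc i) =
        (real r + 2 + real i) * ?p (Suc i) - (real r + real s + 2 + real i) * ?p i"
      by (cases i) (simp_all add: coeff_jpoly coeff_pderiv algebra_simps)
    have q: "(real r + 2 + real i) * ?p (Suc i) =
        ?p i * ((real i - real k) * (real k + real r + real s + 3 + real i) / (real i + 1))"
    proof -
      have "real r + 2 + real i \<noteq> 0" by linarith
      then show ?thesis
        unfolding jcoef_Suc[of "Suc r" "Suc s" k i] by (simp add: divide_simps add_ac)
    qed
    have alg: "(i' - k') * (k' + r' + s' + 3 + i') - (r' + s' + 2 + i') * (i' + 1) =
        - ((k' + 1) * (k' + r' + s' + 2))" for i' k' r' s' :: real
      by (simp add: algebra_simps)
    have "- ?p i * (real k + 1) * (real k + real r + real s + 2) / (real i + 1) =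
      ?p i * ((real i - real k) * (real k + real r + real s + 3 + real i)
         - (real r + real s + 2 + real i) * (real i + 1)) / (real i + 1)"
      unfolding alg by (simp add: mult_ac)
    also have "\<dots> = ?p i * ((real i - real k) * (real k + real r + real s + 3 + real i) / (real i + 1))
         - (real r + real s + 2 + real i) * ?p i"
      by (simp add: divide_simps) (simp add: algebra_simps)
    finally show ?thesis
      using jcoef_raise_Suc[of k r s i] unfolding Suc c q by (simp add: coeff_jpoly)
  qed
qed

lemma jpoly_0: "jpoly r s 0 = 1"
  by (simp add: jpoly_def jcoef_def)

text \<open>The operator in \<open>jpoly_raise\<close> changes sign when \<open>u\<close> becomes
  \<open>1 - u\<close> and the parameters are exchanged, so the sign \<open>(-1) ^ k\<close> builds
  up by induction. The value at 1 is then read off the constant coefficient, without summing a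
  hypergeometric series.\<close>

lemma jpoly_reflect: "poly (jpoly r s k) u = (-1) ^ k * poly (jpoly s r k) (1 - u)"
proof (induction k arbitrary: r s u)
  case 0
  then show ?case by (simp add: jpoly_0)
next
  case (Suc k)
  let ?P = "jpoly (Suc r) (Suc s) k" and ?Q = "jpoly (Suc s) (Suc r) k"
  have pe: "?P = smult ((-1) ^ k) (pcompose ?Q [:1, -1:])"
    by (rule poly_ext) (simp add: poly_pcompose Suc[of "Suc r" "Suc s"])
  have d: "poly (pderiv ?P) u = - ((-1) ^ k * poly (pderiv ?Q) (1 - u))"
    unfolding pe by (simp add: pderiv_smult pderiv_pcompose poly_pcompose pderiv_pCons)
  have 1: "real (Suc k) * poly (jpoly r s (Suc k)) u =
      (real r + 1 - (real r + real s + 2) * u) * poly ?P u + u * (1 - u) * poly (pderiv ?P) u"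
    using arg_cong[OF jpoly_raise[of k r s], of "\<lambda>p. poly p u"] by (simp add: algebra_simps)
  have 2: "real (Suc k) * poly (jpoly s r (Suc k)) (1 - u) =
      (real s + 1 - (real s + real r + 2) * (1 - u)) * poly ?Q (1 - u)
       + (1 - u) * u * poly (pderiv ?Q) (1 - u)"
    using arg_cong[OF jpoly_raise[of k s r], of "\<lambda>p. poly p (1 - u)"] by (simp add: algebra_simps)
  have "real (Suc k) * poly (jpoly r s (Suc k)) u =
     (-1) ^ Suc k * ((real s + 1 - (real s + real r + 2) * (1 - u)) * poly ?Q (1 - u)
       + (1 - u) * u * poly (pderiv ?Q) (1 - u))"
    unfolding 1 d unfolding Suc[of "Suc r" "Suc s"] by (simp add: algebra_simps)
  then have "real (Suc k) * poly (jpoly r s (Suc k)) u =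
      real (Suc k) * ((-1) ^ Suc k * poly (jpoly s r (Suc k)) (1 - u))"
    unfolding 2[symmetric] by simp
  moreover have "real (Suc k) \<noteq> 0" by simp
  ultimately show ?case using mult_left_cancel by blast
qed

section \<open>One-variable integrals against the Jacobi weight\<close>

definition pint :: "real poly \<Rightarrow> real" where
  "pint p = (LINT u:{0..1}|lborel. poly p u)"

text \<open>As \<open>r\<close> and \<open>s\<close> are natural numbers, the weight is itself a
  polynomial. One-variable integrals thus become \<open>pint\<close> of a polynomial, and
  integration by parts an identity between derivatives.\<close>

definition wpoly :: "nat \<Rightarrow> nat \<Rightarrow> real poly" where
  "wpoly r s = monom 1 r * [:1, -1:] ^ s"

lemma poly_wpoly: "poly (wpoly r s) u = u ^ r * (1 - u) ^ s"
  by (simp add: wpoly_def poly_monom poly_power)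

lemma pint_def': "pint p = (LINT u|lborel. indicator {0..1} u * poly p u)"
  by (simp add: pint_def set_lebesgue_integral_def)

lemma integrable_poly_Icc: "integrable lborel (\<lambda>u. indicator {0..1::real} u * poly p u)"
proof -
  have "set_integrable lborel {0..1::real} (poly p)"
    by (rule borel_integrable_atLeastAtMost') (intro continuous_intros)
  then show ?thesis by (simp add: set_integrable_def)
qed

lemma pint_add: "pint (p + q) = pint p + pint q"
  unfolding pint_def' using integrable_poly_Icc[of p] integrable_poly_Icc[of q]
  by (simp add: distrib_left)

lemma pint_smult: "pint (smult c p) = c * pint p"
  unfolding pint_def' by (simp add: mult.left_commute)

lemma pint_0: "pint 0 = 0"
  unfolding pint_def by (simp add: set_lebesgue_integral_def)

lemma pint_sum: "pint (\<Sum>i\<in>I. f i) = (\<Sum>i\<in>I. pint (f i))"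
  by (induction I rule: infinite_finite_induct) (auto simp: pint_0 pint_add)

lemma pint_pderiv: "pint (pderiv F) = poly F 1 - poly F 0"
proof -
  have "(LINT x|lborel. poly (pderiv F) x * indicator {0..1} x) = poly F 1 - poly F 0"
    by (rule integral_FTC_Icc_real) (auto intro!: poly_DERIV continuous_intros)
  then show ?thesis by (simp add: pint_def set_lebesgue_integral_def mult.commute)
qed

lemma pderiv_wpoly:
  "pderiv (wpoly (Suc r) (Suc s)) =
     smult (real r + 1) (wpoly r (Suc s)) + smult (- (real s + 1)) (wpoly (Suc r) s)"
proof -
  have *: "pderiv ([:1, -1:] ^ Suc s) = smult (- (real s + 1)) ([:1, -1:] ^ s)"
    unfolding pderiv_power_Suc by (rule poly_ext) (simp add: pderiv_pCons algebra_simps)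
  show ?thesis
    unfolding wpoly_def pderiv_mult *
    by (rule poly_ext) (simp add: pderiv_monom poly_monom algebra_simps)
qed

text \<open>The derivative of \<open>wpoly (Suc N) (Suc s)\<close> has integral 0, because this
  polynomial vanishes at both ends of the interval.\<close>

lemma pint_beta_step: "(real N + 1) * pint (wpoly N (Suc s)) = (real s + 1) * pint (wpoly (Suc N) s)"
proof -
  from arg_cong[OF pderiv_wpoly, of pint N s] show ?thesis
    by (simp add: pint_pderiv pint_add pint_smult poly_wpoly algebra_simps)
qed

text \<open>The Beta integral. \<open>N\<close> stays arbitrary in the induction since each step
  trades a factor \<open>1 - u\<close> for a factor \<open>u\<close>.\<close>

lemma pint_wpoly: "pint (wpoly N s) = fact N * fact s / fact (N + s + 1)"
proof (induction s arbitrary: N)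
  case 0
  have "pderiv (wpoly (Suc N) 0) = smult (real N + 1) (wpoly N 0)"
    unfolding wpoly_def by (simp add: pderiv_monom smult_monom)
  from arg_cong[OF this, of pint] have "(real N + 1) * pint (wpoly N 0) = 1"
    by (simp add: pint_pderiv pint_smult poly_wpoly)
  then have "pint (wpoly N 0) = 1 / (real N + 1)" by (simp add: field_simps)
  then show ?case by (simp add: add_ac)
next
  case (Suc s)
  have "pint (wpoly N (Suc s)) = (real s + 1) / (real N + 1) * pint (wpoly (Suc N) s)"
    using pint_beta_step[of N s] by (simp add: field_simps)
  also have "\<dots> = fact N * fact (Suc s) / fact (N + Suc s + 1)"
    unfolding Suc by (simp add: divide_simps add_ac)
  finally show ?case .
qed

definition wint :: "nat \<Rightarrow> nat \<Rightarrow> real poly \<Rightarrow> real" where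
  "wint r s p = pint (p * wpoly r s)"

lemma wint_eq: "wint r s p = (LINT u:{0..1}|lborel. poly p u * (u ^ r * (1 - u) ^ s))"
  by (simp add: wint_def pint_def poly_wpoly)

lemma wint_smult: "wint r s (smult c p) = c * wint r s p"
  by (simp add: wint_def pint_smult)

lemma wint_sum: "wint r s (\<Sum>i\<in>I. f i) = (\<Sum>i\<in>I. wint r s (f i))"
  by (simp add: wint_def sum_distrib_right pint_sum)

text \<open>By \<open>jpoly_raise\<close> the integrand on the left is \<open>q\<close> times the
  derivative of a polynomial that vanishes at 0 and 1, so no boundary term arises.\<close>

lemma wint_by_parts:
  "real (Suc k) * wint r s (q * jpoly r s (Suc k)) =
   - wint (Suc r) (Suc s) (pderiv q * jpoly (Suc r) (Suc s) k)"
proof -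
  let ?P = "jpoly (Suc r) (Suc s) k"
  have d: "pderiv (wpoly (Suc r) (Suc s)) = [:real r + 1, - (real r + real s + 2):] * wpoly r s"
    unfolding pderiv_wpoly
    by (rule poly_ext) (simp add: poly_wpoly algebra_simps)
  have w: "wpoly (Suc r) (Suc s) = [:0, 1, -1:] * wpoly r s"
    unfolding wpoly_def
    by (rule poly_ext) (simp add: poly_monom algebra_simps)
  have "pderiv (q * ?P * wpoly (Suc r) (Suc s)) = pderiv q * ?P * wpoly (Suc r) (Suc s) +
     q * ([:real r + 1, - (real r + real s + 2):] * ?P + [:0, 1, -1:] * pderiv ?P) * wpoly r s"
    unfolding pderiv_mult d unfolding w by (simp only: algebra_simps)
  also have "\<dots> = pderiv q * ?P * wpoly (Suc r) (Suc s) +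
     smult (real (Suc k)) (q * jpoly r s (Suc k) * wpoly r s)"
    unfolding jpoly_raise[symmetric] by simp
  finally have "pint (pderiv (q * ?P * wpoly (Suc r) (Suc s))) =
     wint (Suc r) (Suc s) (pderiv q * ?P) + real (Suc k) * wint r s (q * jpoly r s (Suc k))"
    by (simp add: wint_def pint_add pint_smult)
  moreover have "pint (pderiv (q * ?P * wpoly (Suc r) (Suc s))) = 0"
    unfolding pint_pderiv by (simp add: poly_wpoly)
  ultimately show ?thesis by simp
qed

text \<open>Each integration by parts lowers \<open>N\<close> and \<open>k\<close> by one and raises
  both parameters. As \<open>N < k\<close>, the monomial becomes constant first, and then its
  derivative is 0.\<close>

lemma wint_monom_jpoly_less: "N < k \<Longrightarrow> wint r s (monom 1 N * jpoly r s k) = 0"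
proof (induction k arbitrary: N r s)
  case (Suc k)
  have "wint (Suc r) (Suc s) (pderiv (monom 1 N) * jpoly (Suc r) (Suc s) k) = 0"
  proof (cases N)
    case 0
    then show ?thesis by (simp add: pderiv_monom wint_def pint_0)
  next
    case (Suc N')
    have "pderiv (monom 1 N :: real poly) = smult (real N) (monom 1 N')"
      by (simp add: Suc pderiv_monom smult_monom)
    then show ?thesis using Suc.IH[of N' "Suc r" "Suc s"] Suc.prems Suc
      by (simp add: wint_smult)
  qed
  then show ?case using wint_by_parts[of k r s "monom 1 N"] by (simp del: of_nat_Suc)
qed simp

text \<open>The same descent, now reaching degree 0: after \<open>k\<close> steps the Beta integral
  with exponents \<open>N + r\<close> and \<open>s + k\<close> is left, and the differentiations
  have produced \<open>fact N / fact (N - k)\<close>.\<close>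

lemma wint_monom_jpoly:
  "k \<le> N \<Longrightarrow> wint r s (monom 1 N * jpoly r s k) =
    (-1) ^ k * fact N / (fact (N - k) * fact k) * (fact (N + r) * fact (s + k) / fact (N + r + s + k + 1))"
proof (induction k arbitrary: N r s)
  case 0
  have "monom 1 N * wpoly r s = wpoly (N + r) s"
    by (simp add: wpoly_def mult_monom flip: mult.assoc)
  then show ?case by (simp add: wint_def jpoly_0 pint_wpoly)
next
  case (Suc k)
  then obtain N' where N: "N = Suc N'" "k \<le> N'" by (cases N) auto
  have "pderiv (monom 1 N :: real poly) = smult (real N) (monom 1 N')"
    by (simp add: N pderiv_monom smult_monom)
  then have "real (Suc k) * wint r s (monom 1 N * jpoly r s (Suc k)) =
     - real N * wint (Suc r) (Suc s) (monom 1 N' * jpoly (Suc r) (Suc s) k)"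
    using wint_by_parts[of k r s "monom 1 N"] by (simp add: wint_smult)
  then have "wint r s (monom 1 N * jpoly r s (Suc k)) =
     - real N / real (Suc k) * wint (Suc r) (Suc s) (monom 1 N' * jpoly (Suc r) (Suc s) k)"
    by (simp add: field_simps)
  also have "\<dots> = (-1) ^ Suc k * fact N / (fact (N - Suc k) * fact (Suc k)) *
      (fact (N + r) * fact (s + Suc k) / fact (N + r + s + Suc k + 1))"
  proof -
    have "(fact N :: real) = real N * fact N'" "(fact (Suc k) :: real) = real (Suc k) * fact k"
      "N - Suc k = N' - k" "N' + Suc r = N + r" "Suc s + k = s + Suc k"
      "N + r + Suc s + k + 1 = N + r + s + Suc k + 1"
      using N by simp_all
    note e = this
    have alg: "- n / k' * (g * f' / (X * fk) * Y) = (-1) * g * (n * f') / (X * (k' * fk)) * Y"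
      for n k' g f' X fk Y :: real by (simp add: field_simps)
    show ?thesis unfolding Suc.IH[OF N(2)] e power_Suc by (rule alg)
  qed
  finally show ?case .
qed

lemma degree_jpoly_le: "degree (jpoly r s k) \<le> k"
  by (rule degree_le) (auto simp: coeff_jpoly jcoef_eq_0)

lemma poly_expand: "degree p \<le> k \<Longrightarrow> p = (\<Sum>j\<le>k. smult (coeff p j) (monom 1 j))" for p :: "real poly"
  by (simp add: smult_monom poly_as_sum_of_monoms')

lemma wint_mult_jpoly:
  assumes "degree q \<le> k"
  shows "wint r s (q * jpoly r s k) = coeff q k * wint r s (monom 1 k * jpoly r s k)"
proof -
  have "wint r s (q * jpoly r s k) = (\<Sum>j\<le>k. coeff q j * wint r s (monom 1 j * jpoly r s k))"
    by (subst poly_expand[OF assms]) (simp add: sum_distrib_right wint_sum wint_smult)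
  also have "\<dots> = (\<Sum>j\<in>{k}. coeff q j * wint r s (monom 1 j * jpoly r s k))"
    by (rule sum.mono_neutral_right) (auto simp: wint_monom_jpoly_less)
  finally show ?thesis by simp
qed

definition jnorm2 :: "nat \<Rightarrow> nat \<Rightarrow> nat \<Rightarrow> real" where
  "jnorm2 r s k = wint r s (jpoly r s k * jpoly r s k)"

lemma wint_jpoly_orthogonal:
  assumes "k \<noteq> l"
  shows "wint r s (jpoly r s k * jpoly r s l) = 0"
proof -
  have *: "wint r s (jpoly r s k * jpoly r s l) = 0" if "k < l" for k l
    using wint_mult_jpoly[of "jpoly r s k" l r s] degree_jpoly_le[of r s k] that
    by (simp add: coeff_jpoly jcoef_eq_0)
  show ?thesis
    using assms *[of k l] *[of l k] by (cases "k < l") (auto simp: mult.commute)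
qed

lemma pochhammer_eq_fact: "pochhammer (real a + 1) k = fact (a + k) / fact a"
  using pochhammer_fact[of "a + k", where ?'a = real] pochhammer_fact[of a, where ?'a = real]
    pochhammer_product'[of "1::real" a k] pochhammer_pos[of "1::real" a] by (simp add: add_ac)

lemma lead_coeff_jpoly: "jcoef r s k k = (-1) ^ k * fact (2 * k + r + s) / (fact k * fact (k + r + s))"
proof -
  have "pochhammer (- real k) k = (-1) ^ k * fact k"
    using pochhammer_minus[of "real k" k] pochhammer_fact[of k, where ?'a = real] by simp
  moreover have "pochhammer (real k + real r + real s + 1) k = fact (2 * k + r + s) / fact (k + r + s)"
    using pochhammer_eq_fact[of "k + r + s" k] by (simp add: add_ac mult_2)
  moreover have "pochhammer (real r + 1) k \<noteq> 0"
    using pochhammer_pos[of "real r + 1" k] by auto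
  moreover have "A / F * (S * F * (G / H) / (A * F)) = S * G / (F * H)"
    if "A \<noteq> 0" "F \<noteq> 0" for A F S G H :: real
    using that by (simp add: divide_simps)
  ultimately show ?thesis by (simp only: jcoef_def fact_nonzero not_False_eq_True)
qed

text \<open>Orthogonality removes all but the leading monomial of one factor, so the norm is a
  leading coefficient times a single moment.\<close>

lemma jnorm2_eq:
  "jnorm2 r s k = fact (k + r) * fact (k + s) /
     ((2 * real k + real r + real s + 1) * fact k * fact (k + r + s))"
proof -
  have "jnorm2 r s k = jcoef r s k k * wint r s (monom 1 k * jpoly r s k)"
    unfolding jnorm2_def using wint_mult_jpoly[OF degree_jpoly_le] by (simp add: coeff_jpoly)
  moreover have "(fact (k + r + s + k + 1) :: real) = (2 * real k + real r + real s + 1) * fact (2 * k + r + s)"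
  proof -
    have "k + r + s + k + 1 = Suc (2 * k + r + s)" by simp
    then show ?thesis by (simp only: fact_Suc) simp
  qed
  moreover have "((-1) ^ k * (-1) ^ k :: real) = 1"
    by (simp flip: power_mult_distrib)
  moreover have "g * F / (fk * K) * (g * fk / (fact (k - k) * fk) * (a * b / (c * F))) = a * b / (c * fk * K)"
    if "g * g = 1" "F \<noteq> 0" "fk \<noteq> 0" for g F fk K a b c :: real
    using that by (simp add: field_simps)
  ultimately show ?thesis
    unfolding lead_coeff_jpoly wint_monom_jpoly[OF order_refl]
    by (simp only: fact_nonzero not_False_eq_True add.commute[of s k])
qed

lemma jnorm2_pos: "jnorm2 r s k > 0"
  unfolding jnorm2_eq by (intro divide_pos_pos mult_pos_pos) auto

lemma jacobi_L2_norm_jacobi_poly: "(jacobi_L2_norm r s (jacobi_poly r s k))\<^sup>2 = jnorm2 r s k"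
proof -
  have "(LINT u:{0..1}|lborel. (jacobi_poly r s k u)\<^sup>2 * (u ^ r * (1 - u) ^ s)) = jnorm2 r s k"
    unfolding jnorm2_def wint_eq by (simp add: jacobi_poly_eq_poly power2_eq_square)
  then show ?thesis using jnorm2_pos[of r s k] by (simp add: jacobi_L2_norm_def)
qed

lemma wint_shift_jpoly:
  "wint r s (monom 1 n * jpoly r s A * jpoly r s L) =
    (\<Sum>j\<le>A. jcoef r s A j * wint r s (monom 1 (n + j) * jpoly r s L))"
proof -
  have "monom 1 n * jpoly r s A = (\<Sum>j\<le>A. smult (jcoef r s A j) (monom 1 (n + j)))"
    by (simp add: jpoly_def sum_distrib_left mult_monom smult_monom)
  then show ?thesis by (simp add: sum_distrib_right wint_sum wint_smult)
qed

lemma jpoly_at_1: "poly (jpoly r s k) 1 = (-1) ^ k * (fact (s + k) / (fact s * fact k))"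
  using jpoly_reflect[of r s k 1]
  by (simp add: poly_0_coeff_0 coeff_jpoly jcoef_def pochhammer_eq_fact)

section \<open>Determinants of polynomial evaluations\<close>

abbreviation detf :: "nat \<Rightarrow> (nat \<Rightarrow> nat \<Rightarrow> real) \<Rightarrow> real" where
  "detf n F \<equiv> Determinant.det (Matrix.mat n n (\<lambda>(i, j). F i j))"

text \<open>The differences are oriented as in \<open>vandermonde\<close>, with indices from 0.
  Newton's factorisation yields the opposite differences, whence the products of signs further
  on.\<close>

definition vdm :: "nat \<Rightarrow> (nat \<Rightarrow> real) \<Rightarrow> real" where
  "vdm n w = (\<Prod>j<n. \<Prod>i<j. w i - w j)"

lemma detf_leibniz:
  "detf n F = (\<Sum>p | p permutes {..<n}. signof p * (\<Prod>i<n. F i (p i)))"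
proof -
  have "detf n F = (\<Sum>p | p permutes {0..<n}. signof p *
      (\<Prod>i=0..<n. Matrix.mat n n (\<lambda>(i, j). F i j) $$ (i, p i)))"
    by (rule det_def') simp
  also have "\<dots> = (\<Sum>p | p permutes {..<n}. signof p * (\<Prod>i<n. F i (p i)))"
    unfolding lessThan_atLeast0
    by (intro sum.cong prod.cong arg_cong2[of _ _ _ _ "(*)"] refl)
       (auto dest: permutes_in_image[of _ "{0..<n}"])
  finally show ?thesis .
qed

lemma detf_cong: "(\<And>i j. i < n \<Longrightarrow> j < n \<Longrightarrow> F i j = G i j) \<Longrightarrow> detf n F = detf n G"
  by (rule arg_cong[of _ _ Determinant.det]) auto

lemma detf_scale: "detf n (\<lambda>i j. a i * b j * F i j) = (\<Prod>i<n. a i) * (\<Prod>j<n. b j) * detf n F"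
proof -
  have *: "(\<Prod>i<n. b (p i)) = (\<Prod>j<n. b j)" if "p permutes {..<n}" for p
    using prod.permute[OF that, of b] by (simp add: o_def)
  show ?thesis
    unfolding detf_leibniz sum_distrib_left
    by (rule sum.cong) (simp_all add: prod.distrib * mult_ac)
qed

lemma detf_transpose: "detf n F = detf n (\<lambda>i j. F j i)"
proof -
  have "detf n (\<lambda>i j. F j i) = Determinant.det (transpose_mat (Matrix.mat n n (\<lambda>(i, j). F i j)))"
    by (rule arg_cong[of _ _ Determinant.det]) auto
  then show ?thesis by (simp add: det_transpose[of _ n])
qed

lemma detf_permute:
  assumes "p permutes {..<n}"
  shows "detf n (\<lambda>i j. F i (p j)) = signof p * detf n F"
proof -
  have "detf n (\<lambda>i j. F j (p i)) = signof p * detf n (\<lambda>i j. F j i)"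
    using det_permute_rows[of "Matrix.mat n n (\<lambda>(i, j). F j i)" n p] assms
      detf_cong[of n "\<lambda>i j. F j (p i)" "\<lambda>i j. Matrix.mat n n (\<lambda>(i, j). F j i) $$ (p i, j)"]
      permutes_in_image[of p "{..<n}"]
    by (auto simp: lessThan_atLeast0)
  then show ?thesis
    using detf_transpose[of n "\<lambda>i j. F i (p j)"] detf_transpose[of n F] by simp
qed

lemma vdm_eq_0_iff: "vdm n w = 0 \<longleftrightarrow> \<not> inj_on w {..<n}"
proof -
  have "vdm n w = 0 \<longleftrightarrow> (\<exists>j<n. \<exists>i<j. w i = w j)"
    by (simp add: vdm_def Bex_def)
  also have "\<dots> \<longleftrightarrow> \<not> inj_on w {..<n}"
  proof
    assume "\<exists>j<n. \<exists>i<j. w i = w j"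
    then obtain i j where "i < j" "j < n" "w i = w j" by blast
    then show "\<not> inj_on w {..<n}" by (auto dest: inj_onD[of w _ i j])
  next
    assume "\<not> inj_on w {..<n}"
    then obtain i j where ij: "i < n" "j < n" "w i = w j" "i \<noteq> j" by (auto simp: inj_on_def)
    then show "\<exists>j<n. \<exists>i<j. w i = w j"
      by (metis nat_neq_iff)
  qed
  finally show ?thesis .
qed

section \<open>Divided differences and Vandermonde determinants\<close>

primrec newton_quot :: "real poly \<Rightarrow> (nat \<Rightarrow> real) \<Rightarrow> nat \<Rightarrow> real poly" where
  "newton_quot p x 0 = p"
| "newton_quot p x (Suc l) = synthetic_div (newton_quot p x l) (x l)"

text \<open>The divided difference \<open>p[x 0, ..., x l]\<close>: \<open>newton_quot\<close>
  divides by \<open>u - x 0\<close>, ..., \<open>u - x (l - 1)\<close> in turn and drops the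
  remainders. Synthetic division never divides by a difference of nodes, so nodes may
  coincide.\<close>

definition divdiff :: "real poly \<Rightarrow> (nat \<Rightarrow> real) \<Rightarrow> nat \<Rightarrow> real" where
  "divdiff p x l = poly (newton_quot p x l) (x l)"

lemma newton_expansion:
  "poly p u = (\<Sum>l<n. divdiff p x l * (\<Prod>i<l. u - x i)) + poly (newton_quot p x n) u * (\<Prod>i<n. u - x i)"
proof (induction n)
  case (Suc n)
  have "poly (newton_quot p x n) u = (u - x n) * poly (newton_quot p x (Suc n)) u + divdiff p x n"
    using arg_cong[OF synthetic_div_correct'[of "x n" "newton_quot p x n"], of "\<lambda>p. poly p u"]
    by (simp add: divdiff_def algebra_simps)
  then have "poly (newton_quot p x n) u * (\<Prod>i<n. u - x i) =
      divdiff p x n * (\<Prod>i<n. u - x i) + poly (newton_quot p x (Suc n)) u * (\<Prod>i<Suc n. u - x i)"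
    by (simp only: prod.lessThan_Suc) (simp add: algebra_simps)
  then show ?case using Suc by (simp del: prod.lessThan_Suc)
qed simp

text \<open>Newton's expansion at the nodes \<open>z\<close> is a matrix factorisation. The second
  factor evaluates the Newton basis at the nodes; it is upper triangular because the basis
  polynomial of index \<open>l\<close> vanishes at \<open>z j\<close> for
  \<open>j < l\<close>.\<close>

lemma detf_newton:
  "detf n (\<lambda>i j. poly (p i) (z j)) = detf n (\<lambda>i l. divdiff (p i) z l) * (\<Prod>j<n. \<Prod>i<j. z j - z i)"
proof -
  let ?A = "Matrix.mat n n (\<lambda>(i, j). poly (p i) (z j))"
  let ?D = "Matrix.mat n n (\<lambda>(i, l). divdiff (p i) z l)"
  let ?N = "Matrix.mat n n (\<lambda>(l, j). \<Prod>i<l. z j - z i)"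
  have "?A = ?D * ?N"
  proof (rule eq_matI)
    fix i j assume ij: "i < dim_row (?D * ?N)" "j < dim_col (?D * ?N)"
    \<comment> \<open>The remainder of Newton's expansion disappears at every node, since one factor
      is \<open>z j - z j\<close>.\<close>
    then have "(\<Prod>i<n. z j - z i) = 0" by auto
    then have "poly (p i) (z j) = (\<Sum>l<n. divdiff (p i) z l * (\<Prod>i<l. z j - z i))"
      using newton_expansion[of "p i" "z j" z n] by simp
    then show "?A $$ (i, j) = (?D * ?N) $$ (i, j)"
      using ij by (simp add: scalar_prod_def lessThan_atLeast0)
  qed auto
  then have "detf n (\<lambda>i j. poly (p i) (z j)) = Determinant.det ?D * Determinant.det ?N"
    by (simp add: det_mult[of _ n])
  also have "Determinant.det ?N = prod_list (diag_mat ?N)"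
  proof (rule det_upper_triangular[of _ n])
    show "upper_triangular ?N"
      by (auto simp: upper_triangular_def)
  qed auto
  also have "\<dots> = (\<Prod>j<n. \<Prod>i<j. z j - z i)"
    by (simp add: prod_list_diag_prod lessThan_atLeast0)
  finally show ?thesis .
qed

lemma degree_newton_quot: "degree (newton_quot p x l) = degree p - l"
  by (induction l) (auto simp: degree_synthetic_div)

lemma coeff_synthetic_div:
  "coeff (synthetic_div p c) j = coeff p (Suc j) + c * coeff (synthetic_div p c) (Suc j)"
  for c :: real
  using arg_cong[OF synthetic_div_correct[of p c], of "\<lambda>p. coeff p (Suc j)"] by simp

lemma coeff_newton_quot_top:
  assumes "degree p \<le> k" "l \<le> k"
  shows "coeff (newton_quot p x l) (k - l) = coeff p k"
  using assms(2)
proof (induction l)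
  case (Suc l)
  have "coeff (newton_quot p x (Suc l)) (Suc (k - Suc l)) = 0"
    using assms Suc.prems degree_newton_quot[of p x "Suc l"] by (intro coeff_eq_0) auto
  then have "coeff (newton_quot p x (Suc l)) (k - Suc l) = coeff (newton_quot p x l) (Suc (k - Suc l))"
    using coeff_synthetic_div[of "newton_quot p x l" "x l" "k - Suc l"] by simp
  also have "Suc (k - Suc l) = k - l" using Suc.prems by simp
  finally show ?case using Suc by simp
qed simp

lemma divdiff_degree:
  assumes "degree p \<le> k"
  shows "divdiff p x k = coeff p k" and "k < l \<Longrightarrow> divdiff p x l = 0"
proof -
  have "degree (newton_quot p x k) = 0" using assms by (simp add: degree_newton_quot)
  then obtain c where c: "newton_quot p x k = [:c:]" by (metis degree_eq_zeroE)
  with coeff_newton_quot_top[OF assms order_refl, of x]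
  show "divdiff p x k = coeff p k" by (simp add: divdiff_def)
  have *: "newton_quot p x (k + Suc m) = 0" for m
    by (induction m) (simp_all add: c)
  show "divdiff p x l = 0" if "k < l"
    using *[of "l - Suc k"] that by (simp add: divdiff_def)
qed

text \<open>If \<open>p i\<close> has degree at most \<open>i\<close>, its divided differences of
  order above \<open>i\<close> vanish, so their matrix is lower triangular with the coefficients of
  \<open>u^i\<close> on the diagonal.\<close>

lemma detf_poly_vandermonde:
  assumes "\<And>i. i < n \<Longrightarrow> degree (p i) \<le> i"
  shows "detf n (\<lambda>i j. poly (p i) (z j)) = (\<Prod>i<n. coeff (p i) i) * (\<Prod>j<n. \<Prod>i<j. z j - z i)"
proof -
  let ?D = "Matrix.mat n n (\<lambda>(i, l). divdiff (p i) z l)"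
  have "Determinant.det ?D = prod_list (diag_mat ?D)"
    by (rule det_lower_triangular[of n]) (use assms divdiff_degree(2)[OF assms] in auto)
  also have "\<dots> = (\<Prod>i<n. coeff (p i) i)"
    using assms divdiff_degree(1) by (simp add: prod_list_diag_prod lessThan_atLeast0)
  finally show ?thesis by (simp add: detf_newton)
qed

lemma prod_pairs_sign:
  "(\<Prod>j<n. \<Prod>i<j. z j - z i) = (\<Prod>j<n. (-1) ^ j) * vdm n (z :: nat \<Rightarrow> real)"
proof -
  have "(\<Prod>i<j. z j - z i) = (-1) ^ j * (\<Prod>i<j. z i - z j)" for j
  proof -
    have "(\<Prod>i<j. z j - z i) = (\<Prod>i<j. (-1) * (z i - z j))" by (rule prod.cong) auto
    also have "\<dots> = (-1) ^ j * (\<Prod>i<j. z i - z j)" unfolding prod.distrib by simp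
    finally show ?thesis .
  qed
  then show ?thesis by (simp add: vdm_def prod.distrib)
qed

text \<open>Reversing rows and columns together costs the sign of the reversal twice. This turns the
  descending degrees in which a partition lists its rows into the ascending order of
  \<open>detf_poly_vandermonde\<close>.\<close>

lemma detf_reverse: "detf n (\<lambda>i j. F (n - Suc i) (n - Suc j)) = detf n F"
proof -
  define \<rho> where "\<rho> = (\<lambda>i. if i < n then n - Suc i else i)"
  have \<rho>: "\<rho> permutes {..<n}"
    by (rule bij_imp_permutes) (auto simp: \<rho>_def intro!: bij_betwI[of _ _ _ \<rho>])
  have s: "(signof \<rho> :: real) * signof \<rho> = 1"
    by (simp add: sign_def)
  have "detf n (\<lambda>i j. F (n - Suc i) (n - Suc j)) = detf n (\<lambda>i j. F (\<rho> i) (\<rho> j))"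
    by (rule detf_cong) (auto simp: \<rho>_def)
  also have "\<dots> = signof \<rho> * detf n (\<lambda>i j. F (\<rho> i) j)"
    by (rule detf_permute[OF \<rho>])
  also have "detf n (\<lambda>i j. F (\<rho> i) j) = signof \<rho> * detf n F"
    using detf_permute[OF \<rho>, of "\<lambda>i j. F j i"]
      detf_transpose[of n "\<lambda>i j. F (\<rho> i) j"] detf_transpose[of n F] by simp
  finally show ?thesis using s by (simp flip: mult.assoc)
qed

lemma vdm_reverse: "(\<Prod>j<n. \<Prod>i<j. z (n - Suc j) - z (n - Suc i)) = vdm n z"
proof -
  have "(\<Prod>j<n. \<Prod>i<j. z (n - Suc j) - z (n - Suc i)) =
     (\<Prod>(j, i)\<in>(SIGMA j:{..<n}. {..<j}). z (n - Suc j) - z (n - Suc i))"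
    by (rule prod.Sigma) auto
  also have "\<dots> = (\<Prod>(j, i)\<in>(SIGMA j:{..<n}. {..<j}). z i - z j)"
    by (rule prod.reindex_bij_witness[of _ "\<lambda>(j, i). (n - Suc i, n - Suc j)" "\<lambda>(j, i). (n - Suc i, n - Suc j)"])
       auto
  also have "\<dots> = vdm n z"
    unfolding vdm_def by (rule prod.Sigma[symmetric]) auto
  finally show ?thesis .
qed

lemma detf_poly_vdm:
  assumes "\<And>i. i < n \<Longrightarrow> degree (p i) \<le> i"
  shows "detf n (\<lambda>i j. poly (p (n - Suc i)) (z j)) = (\<Prod>i<n. coeff (p i) i) * vdm n z"
proof -
  have "detf n (\<lambda>i j. poly (p (n - Suc i)) (z j)) =
      detf n (\<lambda>i j. poly (p (n - Suc i)) (z (n - Suc (n - Suc j))))"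
    by (rule detf_cong) simp
  also have "\<dots> = detf n (\<lambda>i j. poly (p i) (z (n - Suc j)))"
    by (rule detf_reverse[of n "\<lambda>i j. poly (p i) (z (n - Suc j))"])
  also have "\<dots> = (\<Prod>i<n. coeff (p i) i) * vdm n z"
    using detf_poly_vandermonde[of n p "\<lambda>j. z (n - Suc j)", OF assms] by (simp add: vdm_reverse)
  finally show ?thesis .
qed

section \<open>Continuity of divided differences in the nodes\<close>

lemma tendsto_coordinate: "((\<lambda>x. x l) \<longlongrightarrow> c l) (at c within S)" for c :: "nat \<Rightarrow> real"
proof -
  have "continuous_on UNIV (\<lambda>x :: nat \<Rightarrow> real. x l)" by simp
  then have "isCont (\<lambda>x :: nat \<Rightarrow> real. x l) c" using continuous_on_eq_continuous_at[OF open_UNIV] by blast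
  then show ?thesis using tendsto_within_subset[of _ _ c UNIV S] by (simp add: isCont_def)
qed

text \<open>Synthetic division computes the coefficients from the top down: the coefficient
  \<open>j\<close> is obtained from the coefficient \<open>Suc j\<close> by
  \<open>coeff_synthetic_div\<close>. Hence the inner induction on \<open>degree p - j\<close>
  inside the induction on \<open>l\<close>.\<close>

lemma tendsto_coeff_newton_quot:
  "((\<lambda>x. coeff (newton_quot p x l) j) \<longlongrightarrow> coeff (newton_quot p c l) j) (at c within S)"
proof (induction l arbitrary: j)
  case (Suc l)
  show ?case
  proof (induction "degree p - j" arbitrary: j)
    case 0
    have "coeff (newton_quot p x (Suc l)) j = 0" for x
    \<comment> \<open>For constant \<open>p\<close> the truncated \<open>degree p - Suc l\<close> is
      0 and does not exclude the coefficient 0; there the quotient itself is zero.\<close>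
    proof (cases "degree p = 0")
      case True
      then have "degree (newton_quot p x l) = 0" by (simp add: degree_newton_quot)
      then have "newton_quot p x (Suc l) = 0" by (simp add: synthetic_div_eq_0_iff)
      then show ?thesis by simp
    next
      case False
      then show ?thesis using 0 degree_newton_quot[of p x "Suc l"] by (intro coeff_eq_0) auto
    qed
    then show ?case by simp
  next
    case (Suc d)
    have "((\<lambda>x. coeff (newton_quot p x l) (Suc j) + x l * coeff (newton_quot p x (Suc l)) (Suc j))
      \<longlongrightarrow> coeff (newton_quot p c l) (Suc j) + c l * coeff (newton_quot p c (Suc l)) (Suc j)) (at c within S)"
      using Suc.hyps(2)
      by (intro tendsto_intros tendsto_coordinate Suc.hyps(1) \<open>\<And>j. (_ \<longlongrightarrow> coeff (newton_quot p c l) j) _\<close>) auto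
    then show ?case
      unfolding newton_quot.simps coeff_synthetic_div[of _ _ j, symmetric] .
  qed
qed simp

lemma tendsto_divdiff: "((\<lambda>x. divdiff p x l) \<longlongrightarrow> divdiff p c l) (at c within S)"
proof -
  have "divdiff p x l = (\<Sum>j\<le>degree p. coeff (newton_quot p x l) j * x l ^ j)" for x
    unfolding divdiff_def
    by (subst poly_expand[of "newton_quot p x l" "degree p"])
       (simp_all add: degree_newton_quot poly_sum poly_monom)
  then show ?thesis
    by (simp only:) (intro tendsto_intros tendsto_coeff_newton_quot tendsto_coordinate)
qed

text \<open>\<open>B\<close> holds the coefficients of the polynomial in powers of
  \<open>u - 1\<close>. Dividing by \<open>u - 1\<close> drops the lowest of them and shifts the
  others down.\<close>

lemma newton_quot_const:
  "newton_quot (pcompose B [:-1, 1:]) (\<lambda>_. 1) l = pcompose (poly_shift l B) [:-1, 1:]"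
proof (induction l)
  case (Suc l)
  let ?B = "poly_shift l B" and ?B' = "poly_shift (Suc l) B"
  have "?B = pCons (coeff ?B 0) ?B'"
    by (rule poly_eqI) (simp add: coeff_pCons coeff_poly_shift split: nat.split)
  then have "pcompose ?B [:-1, 1:] = [:coeff ?B 0:] + [:-1, 1:] * pcompose ?B' [:-1, 1:]"
    by (metis pcompose_pCons)
  then have "pcompose ?B [:-1, 1:] + smult 1 (pcompose ?B' [:-1, 1:]) = pCons (coeff ?B 0) (pcompose ?B' [:-1, 1:])"
    by (simp add: algebra_simps)
  from synthetic_div_unique[OF this] show ?case using Suc by simp
qed simp

lemma divdiff_const: "divdiff (pcompose B [:-1, 1:]) (\<lambda>_. 1) l = coeff B l"
  unfolding divdiff_def newton_quot_const by (simp add: poly_pcompose poly_0_coeff_0 coeff_poly_shift)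

section \<open>Multivariate Jacobi polynomials\<close>

definition jshift :: "nat \<Rightarrow> nat list \<Rightarrow> nat \<Rightarrow> nat" where
  "jshift m \<tau> i = part \<tau> (i + 1) + m - (i + 1)"

text \<open>Up to sign, the eigenvalue of the Jacobi differential operator at the eigenfunction
  \<open>jpoly r s k\<close>.\<close>

definition jeig :: "nat \<Rightarrow> nat \<Rightarrow> nat \<Rightarrow> real" where
  "jeig r s k = real k * (real k + real r + real s + 1)"

definition jeig_poly :: "nat \<Rightarrow> nat \<Rightarrow> nat \<Rightarrow> real poly" where
  "jeig_poly r s l = (\<Prod>i<l. [:- jeig r s i, 1:])"

text \<open>Since \<open>(- k + i) (k + r + s + 1 + i) = - (jeig k - jeig i)\<close>, the two
  Pochhammer symbols of the coefficient combine to a polynomial in \<open>jeig k\<close>. So, apart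
  from the value at 1, a Taylor coefficient of order \<open>l\<close> at 1 depends on
  \<open>k\<close> through a monic polynomial of degree \<open>l\<close> in the eigenvalue, up to a
  constant.\<close>

lemma jcoef_reflected:
  "(-1) ^ k * ((-1) ^ l * jcoef s r k l) =
     poly (jpoly r s k) 1 * (1 / (pochhammer (real s + 1) l * fact l)) * poly (jeig_poly r s l) (jeig r s k)"
proof -
  have "poly (jeig_poly r s l) (jeig r s k) =
     (-1) ^ l * (pochhammer (- real k) l * pochhammer (real k + real r + real s + 1) l)"
  proof (induction l)
    case (Suc l)
    have "jeig r s k - jeig r s l = (-1) * ((- real k + real l) * (real k + real r + real s + 1 + real l))"
      unfolding jeig_def by (simp add: algebra_simps)
    moreover have "poly (jeig_poly r s (Suc l)) (jeig r s k) =
        poly (jeig_poly r s l) (jeig r s k) * (jeig r s k - jeig r s l)"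
      by (simp add: jeig_poly_def algebra_simps)
    ultimately show ?case using Suc
      by (simp only: pochhammer_Suc power_Suc mult_ac)
  qed (simp add: jeig_poly_def)
  moreover have "poly (jpoly r s k) 1 = (-1) ^ k * (pochhammer (real s + 1) k / fact k)"
    using jpoly_reflect[of r s k 1] by (simp add: poly_0_coeff_0 coeff_jpoly jcoef_def)
  ultimately show ?thesis
    by (simp add: jcoef_def add_ac)
qed

lemma jpoly_expansion_1:
  "jpoly r s k = pcompose (smult ((-1) ^ k) (pcompose (jpoly s r k) [:0, -1:])) [:-1, 1:]"
  by (rule poly_ext) (simp add: poly_pcompose jpoly_reflect[of r s])

lemma coeff_pcompose_uminus: "coeff (pcompose p [:0, -1:]) l = (-1) ^ l * coeff p l" for p :: "real poly"
proof (induction p arbitrary: l)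
  case (pCons a p)
  then show ?case by (cases l) (simp_all add: pcompose_pCons)
qed simp

lemma divdiff_jpoly_1:
  "divdiff (jpoly r s k) (\<lambda>_. 1) l =
     poly (jpoly r s k) 1 * (1 / (pochhammer (real s + 1) l * fact l)) * poly (jeig_poly r s l) (jeig r s k)"
  by (subst jpoly_expansion_1)
     (simp add: divdiff_const coeff_pcompose_uminus coeff_jpoly jcoef_reflected)

lemma degree_jeig_poly: "degree (jeig_poly r s l) = l" and coeff_jeig_poly: "coeff (jeig_poly r s l) l = 1"
proof -
  show 1: "degree (jeig_poly r s l) = l"
    unfolding jeig_poly_def by (subst degree_prod_eq_sum_degree) auto
  have "lead_coeff (jeig_poly r s l) = 1"
    unfolding jeig_poly_def lead_coeff_prod by simp
  then show "coeff (jeig_poly r s l) l = 1" using 1 by simp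
qed

definition jconst :: "nat \<Rightarrow> nat \<Rightarrow> real" where
  "jconst s m = (\<Prod>l<m. 1 / (pochhammer (real s + 1) l * fact l))"

definition jvalue :: "nat \<Rightarrow> nat \<Rightarrow> nat \<Rightarrow> (nat \<Rightarrow> nat) \<Rightarrow> real" where
  "jvalue r s m k = jconst s m * (\<Prod>i<m. poly (jpoly r s (k i)) 1) * vdm m (\<lambda>i. jeig r s (k i))"

text \<open>Row \<open>i\<close> carries the factor \<open>poly (jpoly r s (k i)) 1\<close> and
  column \<open>l\<close> a constant collected in \<open>jconst\<close>. What remains evaluates
  monic polynomials of degrees \<open>0, ..., m - 1\<close> at the eigenvalues, which is a
  Vandermonde determinant.\<close>

lemma detf_divdiff_1:
  "(\<Prod>j<m. (-1) ^ j) * detf m (\<lambda>i l. divdiff (jpoly r s (k i)) (\<lambda>_. 1) l) = jvalue r s m k"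
proof -
  have "detf m (\<lambda>i l. divdiff (jpoly r s (k i)) (\<lambda>_. 1) l) =
      (\<Prod>i<m. poly (jpoly r s (k i)) 1) * jconst s m *
      detf m (\<lambda>i l. poly (jeig_poly r s l) (jeig r s (k i)))"
    unfolding divdiff_jpoly_1 jconst_def by (rule detf_scale)
  also have "detf m (\<lambda>i l. poly (jeig_poly r s l) (jeig r s (k i))) =
      detf m (\<lambda>l i. poly (jeig_poly r s l) (jeig r s (k i)))"
    by (rule detf_transpose)
  also have "\<dots> = (\<Prod>j<m. (-1) ^ j) * vdm m (\<lambda>i. jeig r s (k i))"
    by (subst detf_poly_vandermonde) (auto simp: degree_jeig_poly coeff_jeig_poly prod_pairs_sign)
  finally have "(\<Prod>j<m. (-1) ^ j) * detf m (\<lambda>i l. divdiff (jpoly r s (k i)) (\<lambda>_. 1) l) =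
      ((\<Prod>j<m. (-1) ^ j) * (\<Prod>j<m. (-1) ^ j)) * jvalue r s m k"
    unfolding jvalue_def by (simp only: mult_ac)
  also have "(\<Prod>j<m. (-1) ^ j) * (\<Prod>j<m. (-1) ^ j) = (1 :: real)"
  proof -
    have "(-1) ^ j * (-1) ^ j = (1 :: real)" for j by (simp flip: power_mult_distrib)
    then show ?thesis unfolding prod.distrib[symmetric] by simp
  qed
  finally show ?thesis by simp
qed

lemma vandermonde_eq_vdm: "vandermonde m x = vdm m (\<lambda>i. x (Suc i))"
proof -
  have "(\<Prod>i=1..<Suc j. x i - x (Suc j)) = (\<Prod>i<j. x (Suc i) - x (Suc j))" for j
    by (rule prod.reindex_bij_witness[of _ Suc "\<lambda>i. i - 1"]) auto
  then have "(\<Prod>j<m. \<Prod>i<j. x (Suc i) - x (Suc j)) = (\<Prod>j<m. \<Prod>i=1..<Suc j. x i - x (Suc j))"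
    by simp
  also have "\<dots> = (\<Prod>j=1..m. \<Prod>i=1..<j. x i - x j)"
    by (rule prod.reindex_bij_witness[of _ "\<lambda>i. i - 1" Suc]) auto
  finally show ?thesis by (simp add: vandermonde_def vdm_def)
qed

lemma inj_on_shift: "inj_on x {1..m} \<longleftrightarrow> inj_on (\<lambda>i. x (Suc i)) {..<m}"
  using comp_inj_on_iff[of Suc "{..<m}" x] by (simp add: image_Suc_lessThan o_def)

lemma multi_jacobi_quotient_eq:
  "multi_jacobi_quotient r s m \<tau> x =
     detf m (\<lambda>i j. poly (jpoly r s (jshift m \<tau> i)) (x (Suc j))) / vdm m (\<lambda>i. x (Suc i))"
  by (simp add: multi_jacobi_quotient_def vandermonde_eq_vdm jshift_def jacobi_poly_eq_poly)

lemma multi_jacobi_quotient_divdiff: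
  assumes "inj_on x {1..m}"
  shows "multi_jacobi_quotient r s m \<tau> x = (\<Prod>j<m. (-1) ^ j) *
     detf m (\<lambda>i l. divdiff (jpoly r s (jshift m \<tau> i)) (\<lambda>j. x (Suc j)) l)"
proof -
  have "vdm m (\<lambda>i. x (Suc i)) \<noteq> 0"
    using assms unfolding vdm_eq_0_iff inj_on_shift by simp
  then show ?thesis
    using detf_newton[of m "\<lambda>i. jpoly r s (jshift m \<tau> i)" "\<lambda>j. x (Suc j)"]
    unfolding multi_jacobi_quotient_eq prod_pairs_sign by simp
qed

lemma tendsto_comp_Suc_at:
  "((\<lambda>x :: nat \<Rightarrow> real. divdiff p (\<lambda>j. x (Suc j)) l) \<longlongrightarrow> divdiff p (\<lambda>j. c (Suc j)) l) (at c within S)"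
proof -
  have "((\<lambda>x. divdiff p x l) \<longlongrightarrow> divdiff p y l) (nhds y)" for y
    using tendsto_divdiff[of p l y UNIV] by (simp add: tendsto_nhds_iff)
  moreover have "filterlim (\<lambda>x :: nat \<Rightarrow> real. (\<lambda>j. x (Suc j))) (nhds (\<lambda>j. c (Suc j))) (at c within S)"
  proof -
    have "continuous_on UNIV (\<lambda>x :: nat \<Rightarrow> real. (\<lambda>j. x (Suc j)))"
      by (intro continuous_on_coordinatewise_then_product) simp
    then have "isCont (\<lambda>x :: nat \<Rightarrow> real. (\<lambda>j. x (Suc j))) c"
      using continuous_on_eq_continuous_at[OF open_UNIV] by blast
    then show ?thesis using tendsto_within_subset[of _ _ c UNIV S] by (simp add: isCont_def)
  qed
  ultimately show ?thesis by (rule filterlim_compose)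
qed

text \<open>\<open>Lim\<close> is determined only along a proper filter. The points with coordinates
  \<open>1 + e * i\<close> are injective for \<open>e > 0\<close> and tend to
  \<open>1, ..., 1\<close> as \<open>e\<close> tends to 0.\<close>

lemma at_ones_nontrivial: "at (\<lambda>_. 1 :: real) within {z. inj_on z {1..m :: nat}} \<noteq> bot"
proof
  assume bot: "at (\<lambda>_. 1 :: real) within {z. inj_on z {1..m :: nat}} = bot"
  let ?f = "\<lambda>e :: real. (\<lambda>i :: nat. 1 + e * real i)"
  have "continuous_on UNIV ?f"
    by (intro continuous_on_coordinatewise_then_product continuous_intros)
  then have "isCont ?f 0"
    using continuous_on_eq_continuous_at[OF open_UNIV] by blast
  then have "(?f \<longlongrightarrow> ?f 0) (at_right 0)"
    using tendsto_within_subset[of ?f _ 0 UNIV "{0<..}"] by (simp add: isCont_def)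
  moreover have "eventually (\<lambda>e. ?f e \<in> {z. inj_on z {1..m}} \<and> ?f e \<noteq> (\<lambda>_. 1)) (at_right 0)"
  proof (rule eventually_at_rightI[of 0 1])
    fix e :: real assume "e \<in> {0<..<1}"
    then have e: "e \<noteq> 0" by simp
    have "?f e 1 \<noteq> 1" using e by simp
    then have "?f e \<noteq> (\<lambda>_. 1)" by metis
    moreover have "inj_on (?f e) {1..m}" using e by (auto simp: inj_on_def)
    ultimately show "?f e \<in> {z. inj_on z {1..m}} \<and> ?f e \<noteq> (\<lambda>_. 1)" by simp
  qed simp
  ultimately have "filterlim ?f (at (\<lambda>_. 1) within {z. inj_on z {1..m}}) (at_right 0)"
    by (simp add: filterlim_at)
  then show False
    unfolding bot filterlim_def bot_unique filtermap_bot_iff using trivial_limit_at_right_real by blast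
qed

lemma tendsto_multi_jacobi_quotient:
  "(multi_jacobi_quotient r s m \<tau> \<longlongrightarrow> jvalue r s m (jshift m \<tau>)) (at (\<lambda>_. 1) within {z. inj_on z {1..m}})"
proof -
  let ?g = "\<lambda>x :: nat \<Rightarrow> real. (\<Prod>j<m. (-1) ^ j) *
     detf m (\<lambda>i l. divdiff (jpoly r s (jshift m \<tau> i)) (\<lambda>j. x (Suc j)) l)"
  have "(?g \<longlongrightarrow> ?g (\<lambda>_. 1)) (at (\<lambda>_. 1) within {z. inj_on z {1..m}})"
    unfolding detf_leibniz by (intro tendsto_intros tendsto_comp_Suc_at)
  then show ?thesis
    unfolding detf_divdiff_1
    by (rule Lim_transform_eventually)
       (auto simp: eventually_at_filter multi_jacobi_quotient_divdiff)
qed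

lemma multi_jacobi_poly_ones: "multi_jacobi_poly r s m \<tau> (\<lambda>_. 1) = jvalue r s m (jshift m \<tau>)"
proof -
  have "Lim (at (\<lambda>_. 1) within {z. inj_on z {1..m}}) (multi_jacobi_quotient r s m \<tau>) = jvalue r s m (jshift m \<tau>)"
    by (rule tendsto_Lim[OF at_ones_nontrivial tendsto_multi_jacobi_quotient])
  \<comment> \<open>A constant point is injective on the coordinates only for
    \<open>m \<le> 1\<close>; the definition then takes the quotient itself instead of the
    limit.\<close>
  moreover have "multi_jacobi_quotient r s m \<tau> (\<lambda>_. 1) = jvalue r s m (jshift m \<tau>)"
    if "inj_on (\<lambda>_. 1 :: real) {1..m}"
    using multi_jacobi_quotient_divdiff[OF that, of r s \<tau>] detf_divdiff_1[of m r s "jshift m \<tau>"] by simp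
  ultimately show ?thesis by (simp add: multi_jacobi_poly_def)
qed

section \<open>Integration over the chamber\<close>

text \<open>The rank \<open>rk i\<close> counts the entries larger than \<open>w i\<close>. Distinct
  entries have distinct ranks below \<open>m\<close>, and the permutation that sorts is the inverse
  of the ranking.\<close>

lemma sorting_permutation:
  fixes w :: "nat \<Rightarrow> real"
  assumes inj: "inj_on w {..<m}"
  shows "\<exists>!\<sigma>. \<sigma> permutes {..<m} \<and> (\<forall>i j. i < j \<longrightarrow> j < m \<longrightarrow> w (\<sigma> j) < w (\<sigma> i))"
proof -
  define rk where "rk i = card {j. j < m \<and> w i < w j}" for i
  define \<rho> where "\<rho> i = (if i < m then rk i else i)" for i
  have rk_less: "rk i < rk j" if "i < m" "w j < w i" for i j
    unfolding rk_def using that by (intro psubset_card_mono) auto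
  have rk_bound: "rk i < m" if "i < m" for i
  proof -
    have "rk i < card {..<m}"
      unfolding rk_def using that by (intro psubset_card_mono) auto
    then show ?thesis by simp
  qed
  have inj_rk: "inj_on rk {..<m}"
  proof (rule inj_onI)
    fix i j assume ij: "i \<in> {..<m}" "j \<in> {..<m}" "rk i = rk j"
    then have "w i = w j" using rk_less[of i j] rk_less[of j i] by force
    then show "i = j" using inj ij by (auto dest: inj_onD)
  qed
  have "bij_betw rk {..<m} {..<m}"
    unfolding bij_betw_def using inj_rk rk_bound
    by (intro conjI card_subset_eq) (auto simp: card_image)
  then have "bij_betw \<rho> {..<m} {..<m}"
    by (subst bij_betw_cong[of _ _ rk]) (auto simp: \<rho>_def)
  then have \<rho>: "\<rho> permutes {..<m}"
    by (rule bij_imp_permutes) (auto simp: \<rho>_def)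
  show ?thesis
  proof (rule ex1I[of _ "Hilbert_Choice.inv \<rho>"], intro conjI allI impI)
    show "Hilbert_Choice.inv \<rho> permutes {..<m}" by (rule permutes_inv[OF \<rho>])
  next
    fix i j :: nat assume ij: "i < j" "j < m"
    have *: "Hilbert_Choice.inv \<rho> i < m" "Hilbert_Choice.inv \<rho> j < m"
      using permutes_in_image[OF permutes_inv[OF \<rho>]] ij by auto
    have "rk (Hilbert_Choice.inv \<rho> i) = i" "rk (Hilbert_Choice.inv \<rho> j) = j"
      using permutes_inverses(1)[OF \<rho>, of i] permutes_inverses(1)[OF \<rho>, of j] * by (auto simp: \<rho>_def)
    then have "rk (Hilbert_Choice.inv \<rho> i) < rk (Hilbert_Choice.inv \<rho> j)" using ij by simp
    moreover have "card {k. k < m \<and> w (Hilbert_Choice.inv \<rho> j) < w k} \<le> card {k. k < m \<and> w (Hilbert_Choice.inv \<rho> i) < w k}"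
      if "w (Hilbert_Choice.inv \<rho> i) \<le> w (Hilbert_Choice.inv \<rho> j)"
      using that by (intro card_mono) auto
    ultimately show "w (Hilbert_Choice.inv \<rho> j) < w (Hilbert_Choice.inv \<rho> i)"
      unfolding rk_def by force
  next
    fix \<sigma> assume \<sigma>: "\<sigma> permutes {..<m} \<and> (\<forall>i j. i < j \<longrightarrow> j < m \<longrightarrow> w (\<sigma> j) < w (\<sigma> i))"
    have "\<rho> (\<sigma> i) = i" for i
    proof (cases "i < m")
      case True
      then have "\<sigma> i < m" using permutes_in_image[of \<sigma> "{..<m}" i] \<sigma> by simp
      have "{j. j < m \<and> w (\<sigma> i) < w j} = \<sigma> ` {..<i}"
      proof (intro equalityI subsetI)
        fix j assume j: "j \<in> {j. j < m \<and> w (\<sigma> i) < w j}"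
        then have "j \<in> \<sigma> ` {..<m}" using permutes_image[of \<sigma> "{..<m}"] \<sigma> by simp
        then obtain k where k: "j = \<sigma> k" "k < m" by auto
        have "\<not> i < k"
        proof
          assume "i < k"
          then have "w (\<sigma> k) < w (\<sigma> i)" using \<sigma> k(2) by blast
          then show False using j k(1) by simp
        qed
        moreover have "i \<noteq> k" using j k(1) by auto
        ultimately show "j \<in> \<sigma> ` {..<i}" using k(1) by auto
      next
        fix j assume "j \<in> \<sigma> ` {..<i}"
        then obtain k where "j = \<sigma> k" "k < i" by auto
        then show "j \<in> {j. j < m \<and> w (\<sigma> i) < w j}"
          using \<sigma> True permutes_in_image[of \<sigma> "{..<m}" k] by auto
      qed
      moreover have "inj_on \<sigma> {..<i}" using \<sigma> permutes_inj_on by blast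
      ultimately have "rk (\<sigma> i) = i" by (simp add: rk_def card_image)
      with \<open>\<sigma> i < m\<close> show ?thesis by (simp add: \<rho>_def)
    next
      case False
      then show ?thesis using \<sigma> permutes_not_in[of \<sigma> "{..<m}" i] by (simp add: \<rho>_def)
    qed
    then show "\<sigma> = Hilbert_Choice.inv \<rho>"
      using permutes_inverses(2)[OF \<rho>] by (intro ext) metis
  qed
qed

text \<open>Coordinates are numbered from 1 while permutations act on \<open>{..<m}\<close>, hence
  the shifts. The restriction keeps the result extensional, as points of the product space must
  be.\<close>

definition perm_point :: "nat \<Rightarrow> (nat \<Rightarrow> nat) \<Rightarrow> (nat \<Rightarrow> real) \<Rightarrow> nat \<Rightarrow> real" where
  "perm_point m \<sigma> y = (\<lambda>i\<in>{1..m}. y (Suc (\<sigma> (i - 1))))"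

lemma perm_point_Suc: "j < m \<Longrightarrow> perm_point m \<sigma> y (Suc j) = y (Suc (\<sigma> j))"
  by (simp add: perm_point_def)

lemma chamber_iff:
  "y \<in> chamber m \<longleftrightarrow> (\<forall>i<m. 0 < y (Suc i) \<and> y (Suc i) < 1) \<and>
     (\<forall>i j. i < j \<longrightarrow> j < m \<longrightarrow> y (Suc j) < y (Suc i))"
proof -
  have *: "(\<forall>i\<in>{1..m}. P i) \<longleftrightarrow> (\<forall>i<m. P (Suc i))" for P :: "nat \<Rightarrow> bool"
    unfolding image_Suc_lessThan[symmetric] by auto
  show ?thesis unfolding chamber_def mem_Collect_eq * by auto
qed

definition cube_ind :: "nat \<Rightarrow> (nat \<Rightarrow> real) \<Rightarrow> real" where
  "cube_ind m y = (\<Prod>i<m. indicator {0<..<1} (y (Suc i)))"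

lemma cube_ind_eq: "cube_ind m y = (if \<forall>i<m. 0 < y (Suc i) \<and> y (Suc i) < 1 then 1 else 0)"
  by (auto simp: cube_ind_def indicator_def)

text \<open>Of all reorderings of a point with distinct coordinates exactly one is decreasing; it
  lies in the chamber precisely when the point lies in the open cube.\<close>

lemma sum_indicator_chamber_perm:
  assumes inj: "inj_on (\<lambda>i. y (Suc i)) {..<m}"
  shows "(\<Sum>\<sigma> | \<sigma> permutes {..<m}. indicator (chamber m) (perm_point m \<sigma> y)) = cube_ind m y"
proof -
  let ?P = "\<lambda>\<tau>. \<tau> permutes {..<m} \<and> (\<forall>i j. i < j \<longrightarrow> j < m \<longrightarrow> y (Suc (\<tau> j)) < y (Suc (\<tau> i)))"
  from sorting_permutation[OF inj] obtain \<sigma> where P: "?P \<sigma>" and uniq: "\<forall>\<tau>. ?P \<tau> \<longrightarrow> \<tau> = \<sigma>"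
    by (rule ex1E) (rule that)
  have sorted_iff: "(\<forall>i j. i < j \<longrightarrow> j < m \<longrightarrow> y (Suc (\<tau> j)) < y (Suc (\<tau> i))) \<longleftrightarrow> \<tau> = \<sigma>"
    if "\<tau> permutes {..<m}" for \<tau>
  proof
    assume "\<forall>i j. i < j \<longrightarrow> j < m \<longrightarrow> y (Suc (\<tau> j)) < y (Suc (\<tau> i))"
    with that uniq show "\<tau> = \<sigma>" by simp
  next
    assume "\<tau> = \<sigma>"
    with P show "\<forall>i j. i < j \<longrightarrow> j < m \<longrightarrow> y (Suc (\<tau> j)) < y (Suc (\<tau> i))" by simp
  qed
  have cube: "(\<forall>i<m. 0 < y (Suc (\<tau> i)) \<and> y (Suc (\<tau> i)) < 1) \<longleftrightarrow> (\<forall>i<m. 0 < y (Suc i) \<and> y (Suc i) < 1)"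
    if "\<tau> permutes {..<m}" for \<tau>
  proof -
    have "(\<forall>i\<in>{..<m}. Q i) \<longleftrightarrow> (\<forall>i\<in>{..<m}. Q (\<tau> i))" for Q
      by (subst permutes_image[OF that, symmetric]) auto
    from this[of "\<lambda>i. 0 < y (Suc i) \<and> y (Suc i) < 1"] show ?thesis by (simp add: Ball_def)
  qed
  have mem: "perm_point m \<tau> y \<in> chamber m \<longleftrightarrow> (\<forall>i<m. 0 < y (Suc i) \<and> y (Suc i) < 1) \<and> \<tau> = \<sigma>"
    if \<tau>: "\<tau> permutes {..<m}" for \<tau>
  proof -
    have "perm_point m \<tau> y \<in> chamber m \<longleftrightarrow> (\<forall>i<m. 0 < y (Suc (\<tau> i)) \<and> y (Suc (\<tau> i)) < 1) \<and>
        (\<forall>i j. i < j \<longrightarrow> j < m \<longrightarrow> y (Suc (\<tau> j)) < y (Suc (\<tau> i)))"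
      unfolding chamber_iff by (simp add: perm_point_Suc)
    then show ?thesis unfolding cube[OF \<tau>] sorted_iff[OF \<tau>] .
  qed
  have "(\<Sum>\<tau> | \<tau> permutes {..<m}. indicator (chamber m) (perm_point m \<tau> y)) =
     (\<Sum>\<tau> | \<tau> permutes {..<m}. if \<tau> = \<sigma> then cube_ind m y else 0)"
    by (rule sum.cong) (auto simp: mem cube_ind_eq indicator_def)
  also have "\<dots> = cube_ind m y"
    using P by (simp add: finite_permutations)
  finally show ?thesis .
qed

text \<open>It suffices to compare the two measures on boxes, whose preimages are boxes with the
  same sides in another order.\<close>

lemma distr_PiM_lborel_reindex:
  assumes f: "bij_betw f I J" and I: "finite I"
  shows "distr (PiM J (\<lambda>_. lborel :: real measure)) (PiM I (\<lambda>_. lborel)) (\<lambda>\<omega>. \<lambda>i\<in>I. \<omega> (f i)) = PiM I (\<lambda>_. lborel)"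
proof -
  interpret product_sigma_finite "\<lambda>_. lborel :: real measure" ..
  have J: "finite J" using bij_betw_finite[OF f] I by simp
  have fI: "f i \<in> J" if "i \<in> I" for i using f that by (auto simp: bij_betw_def)
  have meas: "(\<lambda>\<omega>. \<lambda>i\<in>I. \<omega> (f i)) \<in> PiM J (\<lambda>_. lborel :: real measure) \<rightarrow>\<^sub>M PiM I (\<lambda>_. lborel)"
    by (intro measurable_restrict measurable_component_singleton fI)
  show ?thesis
  proof (rule PiM_eqI)
    show "sets (distr (PiM J (\<lambda>_. lborel)) (PiM I (\<lambda>_. lborel)) (\<lambda>\<omega>. \<lambda>i\<in>I. \<omega> (f i))) = sets (PiM I (\<lambda>_. lborel))"
      by simp
    fix A :: "_ \<Rightarrow> real set" assume A: "\<And>i. i \<in> I \<Longrightarrow> A i \<in> sets lborel"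
    let ?g = "the_inv_into I f"
    have g: "?g (f i) = i" if "i \<in> I" for i
      using f that by (auto simp: bij_betw_def the_inv_into_f_f)
    have gJ: "?g j \<in> I" "f (?g j) = j" if "j \<in> J" for j
      using f that by (auto simp: bij_betw_def the_inv_into_into f_the_inv_into_f)
    have vim: "(\<lambda>\<omega>. \<lambda>i\<in>I. \<omega> (f i)) -` PiE I A \<inter> space (PiM J (\<lambda>_. lborel)) = PiE J (\<lambda>j. A (?g j))"
    proof (intro equalityI subsetI)
      fix \<omega> assume "\<omega> \<in> (\<lambda>\<omega>. \<lambda>i\<in>I. \<omega> (f i)) -` PiE I A \<inter> space (PiM J (\<lambda>_. lborel))"
      then have 1: "\<And>i. i \<in> I \<Longrightarrow> \<omega> (f i) \<in> A i" and 2: "\<omega> \<in> extensional J"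
        by (auto simp: space_PiM PiE_def Pi_def restrict_def split: if_splits)
      show "\<omega> \<in> PiE J (\<lambda>j. A (?g j))"
        using 1[OF gJ(1)] gJ(2) 2 by (auto simp: PiE_def)
    next
      fix \<omega> assume \<omega>: "\<omega> \<in> PiE J (\<lambda>j. A (?g j))"
      then have "\<omega> (f i) \<in> A i" if "i \<in> I" for i
        using fI[OF that] g[OF that] by (metis PiE_mem)
      with \<omega> show "\<omega> \<in> (\<lambda>\<omega>. \<lambda>i\<in>I. \<omega> (f i)) -` PiE I A \<inter> space (PiM J (\<lambda>_. lborel))"
        by (auto simp: space_PiM PiE_def)
    qed
    have "emeasure (distr (PiM J (\<lambda>_. lborel)) (PiM I (\<lambda>_. lborel)) (\<lambda>\<omega>. \<lambda>i\<in>I. \<omega> (f i))) (PiE I A) =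
        emeasure (PiM J (\<lambda>_. lborel)) (PiE J (\<lambda>j. A (?g j)))"
      using A I by (subst emeasure_distr[OF meas]) (auto simp: vim intro: sets_PiM_I_finite)
    also have "\<dots> = (\<Prod>j\<in>J. emeasure lborel (A (?g j)))"
      using A J gJ by (intro emeasure_PiM) auto
    also have "\<dots> = (\<Prod>i\<in>I. emeasure lborel (A i))"
      using prod.reindex_bij_betw[OF f, of "\<lambda>j. emeasure lborel (A (?g j))"] g by simp
    finally show "emeasure (distr (PiM J (\<lambda>_. lborel)) (PiM I (\<lambda>_. lborel)) (\<lambda>\<omega>. \<lambda>i\<in>I. \<omega> (f i))) (PiE I A) =
        (\<Prod>i\<in>I. emeasure lborel (A i))" .
  qed fact
qed

lemma measurable_perm_point:
  assumes "\<sigma> permutes {..<m}"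
  shows "perm_point m \<sigma> \<in> lborel_m m \<rightarrow>\<^sub>M lborel_m m"
proof -
  have "Suc (\<sigma> (i - 1)) \<in> {1..m}" if "i \<in> {1..m}" for i
    using permutes_in_image[OF assms, of "i - 1"] that by auto
  then show ?thesis
    unfolding perm_point_def by (intro measurable_restrict measurable_component_singleton)
qed

lemma integral_perm_point:
  assumes \<sigma>: "\<sigma> permutes {..<m}" and g: "g \<in> borel_measurable (lborel_m m)"
  shows "(LINT y|lborel_m m. g (perm_point m \<sigma> y)) = (LINT y|lborel_m m. g y :: real)"
proof -
  have "bij_betw (\<lambda>i. Suc (\<sigma> (i - 1))) {1..m} {1..m}"
  proof (rule bij_betw_byWitness[where f' = "\<lambda>i. Suc (Hilbert_Choice.inv \<sigma> (i - 1))"])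
    show "(\<lambda>i. Suc (\<sigma> (i - 1))) ` {1..m} \<subseteq> {1..m}" "(\<lambda>i. Suc (Hilbert_Choice.inv \<sigma> (i - 1))) ` {1..m} \<subseteq> {1..m}"
    proof -
      have "\<sigma> i < m" "Hilbert_Choice.inv \<sigma> i < m" if "i < m" for i
        using permutes_in_image[OF \<sigma>, of i] permutes_in_image[OF permutes_inv[OF \<sigma>], of i] that
        by simp_all
      then show "(\<lambda>i. Suc (\<sigma> (i - 1))) ` {1..m} \<subseteq> {1..m}"
        "(\<lambda>i. Suc (Hilbert_Choice.inv \<sigma> (i - 1))) ` {1..m} \<subseteq> {1..m}"
        by (auto simp: Suc_le_eq)
    qed
  qed (simp_all add: permutes_inverses[OF \<sigma>])
  from distr_PiM_lborel_reindex[OF this]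
  have "distr (lborel_m m) (lborel_m m) (perm_point m \<sigma>) = lborel_m m"
    unfolding perm_point_def[abs_def] by simp
  with integral_distr[OF measurable_perm_point[OF \<sigma>] g] show ?thesis by simp
qed

lemma borel_measurable_coordinate: "j < m \<Longrightarrow> (\<lambda>y. y (Suc j)) \<in> borel_measurable (lborel_m m)"
  using measurable_component_singleton[of "Suc j" "{1..m}" "\<lambda>_. lborel :: real measure"] by simp

lemma borel_measurable_poly_coordinate:
  "j < m \<Longrightarrow> (\<lambda>y. poly p (y (Suc j))) \<in> borel_measurable (lborel_m m)"
  by (rule measurable_compose[OF borel_measurable_coordinate])
     (auto intro!: borel_measurable_continuous_onI continuous_intros)

lemma borel_measurable_detf:
  assumes "\<And>i j. i < m \<Longrightarrow> j < m \<Longrightarrow> (\<lambda>y. F y i j) \<in> borel_measurable M"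
  shows "(\<lambda>y. detf m (F y)) \<in> borel_measurable M"
  unfolding detf_leibniz
proof (intro borel_measurable_sum borel_measurable_times borel_measurable_const borel_measurable_prod)
  fix p i assume "p \<in> {p. p permutes {..<m}}" "i \<in> {..<m}"
  then show "(\<lambda>y. F y i (p i)) \<in> borel_measurable M"
    using permutes_in_image[of p "{..<m}" i] by (intro assms) auto
qed

lemma borel_measurable_cube_ind: "cube_ind m \<in> borel_measurable (lborel_m m)"
  unfolding cube_ind_def[abs_def]
  by (intro borel_measurable_prod measurable_compose[OF borel_measurable_coordinate]) auto

lemma borel_measurable_chamber: "(\<lambda>y. indicator (chamber m) y :: real) \<in> borel_measurable (lborel_m m)"
proof -
  have "(\<lambda>y. indicator (chamber m) y :: real) = (\<lambda>y. cube_ind m y *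
     (\<Prod>j<m. \<Prod>i<j. indicator {0<..} (y (Suc i) - y (Suc j))))"
  proof
    fix y
    show "indicator (chamber m) y = cube_ind m y * (\<Prod>j<m. \<Prod>i<j. indicator {0<..} (y (Suc i) - y (Suc j)))"
    proof (cases "y \<in> chamber m")
      case True
      then have "(\<Prod>j<m. \<Prod>i<j. indicator {0<..} (y (Suc i) - y (Suc j))) = (1 :: real)"
        by (intro prod.neutral ballI) (auto simp: chamber_iff)
      then show ?thesis using True by (auto simp: chamber_iff cube_ind_eq)
    next
      case False
      then have "cube_ind m y = 0 \<or> (\<exists>j<m. \<exists>i<j. indicator {0<..} (y (Suc i) - y (Suc j)) = (0::real))"
        by (auto simp: chamber_iff cube_ind_eq indicator_def)
      then show ?thesis using False by auto
    qed
  qed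
  also have "\<dots> \<in> borel_measurable (lborel_m m)"
    by (intro borel_measurable_times borel_measurable_cube_ind borel_measurable_prod
          measurable_compose[OF borel_measurable_diff[OF borel_measurable_coordinate borel_measurable_coordinate]]) auto
  finally show ?thesis .
qed

lemma prod_Suc_index: "(\<Prod>i=1..m. F i) = (\<Prod>i<m. F (Suc i))"
  by (rule prod.reindex_bij_witness[of _ Suc "\<lambda>i. i - 1"]) auto

lemma integrable_PiM_prod:
  assumes "\<And>i. i < m \<Longrightarrow> integrable lborel (f i)"
  shows "integrable (lborel_m m) (\<lambda>y. \<Prod>i<m. f i (y (Suc i)) :: real)"
    and "(LINT y|lborel_m m. (\<Prod>i<m. f i (y (Suc i)))) = (\<Prod>i<m. integral\<^sup>L lborel (f i))"
proof -
  interpret product_sigma_finite "\<lambda>_. lborel :: real measure" ..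
  have *: "integrable lborel (f (i - 1))" if "i \<in> {1..m}" for i using assms that by auto
  show "integrable (lborel_m m) (\<lambda>y. \<Prod>i<m. f i (y (Suc i)))"
    using product_integrable_prod[of "{1..m}" "\<lambda>i. f (i - 1)", OF _ *] unfolding prod_Suc_index by simp
  show "(LINT y|lborel_m m. (\<Prod>i<m. f i (y (Suc i)))) = (\<Prod>i<m. integral\<^sup>L lborel (f i))"
    using product_integral_prod[of "{1..m}" "\<lambda>i. f (i - 1)", OF _ *] unfolding prod_Suc_index by simp
qed

lemma integrable_bounded_on_cube:
  assumes g: "g \<in> borel_measurable (lborel_m m)" and b: "\<And>y. \<bar>g y\<bar> \<le> B * cube_ind m y"
  shows "integrable (lborel_m m) (g :: _ \<Rightarrow> real)"
    and "(LINT y|lborel_m m. \<bar>g y\<bar>) \<le> B"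
proof -
  have i: "integrable (lborel_m m) (\<lambda>y. B * cube_ind m y)" "(LINT y|lborel_m m. B * cube_ind m y) = B"
    using integrable_PiM_prod[of m "\<lambda>_. indicator {0<..<1::real}"] by (simp_all add: cube_ind_def)
  show 1: "integrable (lborel_m m) g"
    using Bochner_Integration.integrable_bound[OF i(1) g] b by (force intro: order_trans[OF b])
  have "(LINT y|lborel_m m. \<bar>g y\<bar>) \<le> (LINT y|lborel_m m. B * cube_ind m y)"
    using i(1) 1 b by (intro integral_mono) auto
  then show "(LINT y|lborel_m m. \<bar>g y\<bar>) \<le> B" unfolding i(2) .
qed


section \<open>Determinants of functions on the cube\<close>

definition pbound :: "real poly \<Rightarrow> real" where
  "pbound p = (\<Sum>i\<le>degree p. \<bar>coeff p i\<bar>)"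

lemma pbound_nonneg: "0 \<le> pbound p"
  by (simp add: pbound_def sum_nonneg)

lemma poly_le_pbound:
  assumes "0 \<le> u" "u \<le> 1"
  shows "\<bar>poly p u\<bar> \<le> pbound p"
proof -
  have "\<bar>poly p u\<bar> \<le> (\<Sum>i\<le>degree p. \<bar>coeff p i * u ^ i\<bar>)"
    unfolding poly_altdef by (rule sum_abs)
  also have "\<dots> \<le> pbound p"
    unfolding pbound_def using assms
    by (intro sum_mono) (simp add: abs_mult mult_left_le power_le_one)
  finally show ?thesis .
qed

lemma detf_bound:
  assumes "\<And>i j. i < m \<Longrightarrow> j < m \<Longrightarrow> \<bar>F i j\<bar> \<le> B i"
  shows "\<bar>detf m F\<bar> \<le> fact m * (\<Prod>i<m. B i)"
proof -
  have "\<bar>detf m F\<bar> \<le> (\<Sum>p | p permutes {..<m}. \<bar>signof p * (\<Prod>i<m. F i (p i))\<bar>)"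
    unfolding detf_leibniz by (rule sum_abs)
  also have "\<dots> \<le> (\<Sum>p | p permutes {..<m}. \<Prod>i<m. B i)"
  proof (rule sum_mono)
    fix p assume "p \<in> {p. p permutes {..<m}}"
    then have "\<bar>F i (p i)\<bar> \<le> B i" if "i < m" for i
      using permutes_in_image[of p "{..<m}" i] that by (intro assms) auto
    then have "(\<Prod>i<m. \<bar>F i (p i)\<bar>) \<le> (\<Prod>i<m. B i)"
      by (intro prod_mono) auto
    then show "\<bar>signof p * (\<Prod>i<m. F i (p i))\<bar> \<le> (\<Prod>i<m. B i)"
      by (simp add: abs_mult abs_prod sign_def)
  qed
  also have "\<dots> = fact m * (\<Prod>i<m. B i)"
    by (simp add: card_permutations)
  finally show ?thesis .
qed

definition detp :: "nat \<Rightarrow> (nat \<Rightarrow> real poly) \<Rightarrow> (nat \<Rightarrow> real) \<Rightarrow> real" where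
  "detp m f y = detf m (\<lambda>i j. poly (f i) (y (Suc j)))"

lemma detp_bound:
  assumes "\<And>i. i < m \<Longrightarrow> 0 \<le> y (Suc i) \<and> y (Suc i) \<le> 1"
  shows "\<bar>detp m f y\<bar> \<le> fact m * (\<Prod>i<m. pbound (f i))"
  unfolding detp_def by (rule detf_bound) (use assms in \<open>auto intro: poly_le_pbound\<close>)

lemma borel_measurable_detp: "detp m f \<in> borel_measurable (lborel_m m)"
  unfolding detp_def[abs_def] by (intro borel_measurable_detf borel_measurable_poly_coordinate)

lemma detp_perm_point:
  assumes "\<sigma> permutes {..<m}"
  shows "detp m f (perm_point m \<sigma> y) = signof \<sigma> * detp m f y"
proof -
  have "detp m f (perm_point m \<sigma> y) = detf m (\<lambda>i j. poly (f i) (y (Suc (\<sigma> j))))"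
    unfolding detp_def by (rule detf_cong) (simp add: perm_point_Suc)
  then show ?thesis
    using detf_permute[OF assms, of "\<lambda>i j. poly (f i) (y (Suc j))"] by (simp add: detp_def)
qed

text \<open>The chamber and its reorderings miss the points with equal coordinates. Since the
  determinant vanishes there, identities over the cube hold pointwise, without a null set to
  discard.\<close>

lemma detp_noninj: "\<not> inj_on (\<lambda>i. y (Suc i)) {..<m} \<Longrightarrow> detp m f y = 0"
proof -
  assume "\<not> inj_on (\<lambda>i. y (Suc i)) {..<m}"
  then have "vdm m (\<lambda>i. y (Suc i)) = 0" by (simp add: vdm_eq_0_iff)
  then show ?thesis
    unfolding detp_def detf_newton[of m f "\<lambda>i. y (Suc i)"] prod_pairs_sign by simp
qed

lemma perm_point_chamber_cube:
  assumes \<sigma>: "\<sigma> permutes {..<m}" and y: "perm_point m \<sigma> y \<in> chamber m"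
  shows "cube_ind m y = 1"
proof -
  have "0 < y (Suc i) \<and> y (Suc i) < 1" if "i < m" for i
  proof -
    have "Hilbert_Choice.inv \<sigma> i < m"
      using permutes_in_image[OF permutes_inv[OF \<sigma>], of i] that by simp
    with y have "0 < perm_point m \<sigma> y (Suc (Hilbert_Choice.inv \<sigma> i)) \<and> perm_point m \<sigma> y (Suc (Hilbert_Choice.inv \<sigma> i)) < 1"
      unfolding chamber_iff by blast
    then show ?thesis
      using \<open>Hilbert_Choice.inv \<sigma> i < m\<close> by (simp add: perm_point_Suc permutes_inverses[OF \<sigma>])
  qed
  then show ?thesis by (simp add: cube_ind_eq)
qed

text \<open>Both places for a permutation occur in \<open>andreief\<close>: inside the chamber
  indicator before the change of variables, and inside the product after it.\<close>

lemma integrable_prod_detp_chamber: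
  assumes \<sigma>: "\<sigma> permutes {..<m}" and \<rho>: "\<rho> permutes {..<m}"
  shows "(\<lambda>y. (\<Prod>j<m. poly (q j) (y (Suc (\<sigma> j)))) * detp m f y * indicator (chamber m) (perm_point m \<rho> y))
      \<in> borel_measurable (lborel_m m)" (is "?h \<in> _")
    and "integrable (lborel_m m)
      (\<lambda>y. (\<Prod>j<m. poly (q j) (y (Suc (\<sigma> j)))) * detp m f y * indicator (chamber m) (perm_point m \<rho> y))"
proof -
  have \<sigma>m: "\<sigma> j < m" if "j < m" for j using permutes_in_image[OF \<sigma>, of j] that by simp
  show 1: "?h \<in> borel_measurable (lborel_m m)"
    by (intro borel_measurable_times borel_measurable_prod borel_measurable_detp borel_measurable_poly_coordinate
        measurable_compose[OF measurable_perm_point[OF \<rho>] borel_measurable_chamber] \<sigma>m) simp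
  show "integrable (lborel_m m) ?h"
  proof (rule integrable_bounded_on_cube(1)[OF 1])
    fix y
    let ?B = "(\<Prod>j<m. pbound (q j)) * (fact m * (\<Prod>i<m. pbound (f i)))"
    show "\<bar>?h y\<bar> \<le> ?B * cube_ind m y"
    proof (cases "perm_point m \<rho> y \<in> chamber m")
      case True
      then have c: "cube_ind m y = 1" by (rule perm_point_chamber_cube[OF \<rho>])
      then have y: "0 \<le> y (Suc i) \<and> y (Suc i) \<le> 1" if "i < m" for i
        using that by (auto simp: cube_ind_eq split: if_splits)
      have "(\<Prod>j<m. \<bar>poly (q j) (y (Suc (\<sigma> j)))\<bar>) \<le> (\<Prod>j<m. pbound (q j))"
        using y \<sigma>m by (intro prod_mono) (auto intro: poly_le_pbound)
      then have "\<bar>?h y\<bar> \<le> ?B"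
        using True detp_bound[of m y f, OF y]
        by (auto simp: abs_mult abs_prod intro!: mult_mono prod_nonneg pbound_nonneg)
      then show ?thesis using c by simp
    next
      case False
      then show ?thesis
        by (simp add: cube_ind_eq prod_nonneg pbound_nonneg)
    qed
  qed
qed

lemma pint_Ioo: "(LINT u|lborel. indicator {0<..<1} u * poly p u) = pint p"
proof -
  have "AE u in lborel. u \<noteq> (0::real)" "AE u in lborel. u \<noteq> (1::real)"
    by (rule AE_lborel_singleton)+
  then have "AE u in lborel. indicator {0<..<1} u * poly p u = indicator {0..1} u * poly p u"
    by eventually_elim (auto simp: indicator_def)
  then show ?thesis
    unfolding pint_def'
    by (intro integral_cong_AE borel_measurable_times borel_measurable_indicator)
       (auto intro!: borel_measurable_continuous_onI continuous_intros)
qed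

lemma integrable_poly_Ioo: "integrable lborel (\<lambda>u. indicator {0<..<1::real} u * poly p u)"
proof -
  have "set_integrable lborel {0<..<1::real} (poly p)"
    by (rule set_integrable_subset[of _ "{0..1}"])
       (use integrable_poly_Icc[of p] in \<open>auto simp: set_integrable_def\<close>)
  then show ?thesis by (simp add: set_integrable_def)
qed

text \<open>Leibniz' formula for \<open>detp\<close> makes the integrand a sum of products of
  one-variable functions; Fubini's theorem integrates each factor separately.\<close>

lemma integral_cube_detp:
  "(LINT y|lborel_m m. cube_ind m y * ((\<Prod>j<m. poly (q j) (y (Suc j))) * detp m f y)) =
     detf m (\<lambda>i j. pint (f i * q j))"
proof -
  let ?k = "\<lambda>p j u. indicator {0<..<1} u * poly (f (p j) * q j) u"
  have "cube_ind m y * ((\<Prod>j<m. poly (q j) (y (Suc j))) * detp m f y) =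
      (\<Sum>p | p permutes {..<m}. signof p * (\<Prod>j<m. ?k p j (y (Suc j))))" for y
  proof -
    have "detp m f y = (\<Sum>p | p permutes {..<m}. signof p * (\<Prod>j<m. poly (f (p j)) (y (Suc j))))"
      unfolding detp_def by (subst detf_transpose) (simp add: detf_leibniz)
    then show ?thesis
      unfolding cube_ind_def sum_distrib_left
      by (simp add: sum_distrib_left prod.distrib mult_ac)
  qed
  then have "(LINT y|lborel_m m. cube_ind m y * ((\<Prod>j<m. poly (q j) (y (Suc j))) * detp m f y)) =
      (\<Sum>p | p permutes {..<m}. LINT y|lborel_m m. signof p * (\<Prod>j<m. ?k p j (y (Suc j))))"
    by (simp only:)
       (intro Bochner_Integration.integral_sum integrable_mult_right integrable_PiM_prod(1) integrable_poly_Ioo)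
  also have "\<dots> = (\<Sum>p | p permutes {..<m}. signof p * (\<Prod>j<m. pint (f (p j) * q j)))"
  proof (intro sum.cong refl)
    fix p :: "nat \<Rightarrow> nat"
    have "(LINT y|lborel_m m. (\<Prod>j<m. ?k p j (y (Suc j)))) = (\<Prod>j<m. pint (f (p j) * q j))"
      unfolding pint_Ioo[symmetric] by (rule integrable_PiM_prod(2)) (rule integrable_poly_Ioo)
    then show "(LINT y|lborel_m m. signof p * (\<Prod>j<m. ?k p j (y (Suc j)))) =
        signof p * (\<Prod>j<m. pint (f (p j) * q j))"
      by simp
  qed
  also have "\<dots> = detf m (\<lambda>i j. pint (f i * q j))"
    unfolding detf_transpose[of m "\<lambda>i j. pint (f i * q j)"] by (simp add: detf_leibniz)
  finally show ?thesis .
qed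

text \<open>Andreief's identity. Instead of symmetrising over the cube, which would produce a factor
  \<open>m!\<close>, one of the determinants is replaced by its diagonal term: summing over all
  reorderings of the coordinates turns the chamber into the cube.\<close>

lemma andreief:
  "(LINT y|lborel_m m. detp m f y * detp m g y * (\<Prod>i<m. poly w (y (Suc i))) * indicator (chamber m) y) =
     detf m (\<lambda>i j. pint (f i * g j * w))"
proof -
  let ?S = "{\<sigma>. \<sigma> permutes {..<m}}"
  let ?q = "\<lambda>j. g j * w"
  let ?G = "\<lambda>\<sigma> y. \<Prod>j<m. poly (?q j) (y (Suc (\<sigma> j)))"
  let ?C = "\<lambda>y. indicator (chamber m) y :: real"
  let ?inv = "Hilbert_Choice.inv"
  have perm: "?inv \<sigma> permutes {..<m}" if "\<sigma> \<in> ?S" for \<sigma> using that permutes_inv by auto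
  \<comment> \<open>Substituting the inverse reordering frees the chamber from \<sigma>; the product
    takes up the inverse permutation and the determinant contributes its sign.\<close>
  have swap: "(LINT y|lborel_m m. ?G id y * detp m f y * ?C (perm_point m \<sigma> y)) =
      (LINT y|lborel_m m. signof (?inv \<sigma>) * ?G (?inv \<sigma>) y * detp m f y * ?C y)" if \<sigma>: "\<sigma> \<in> ?S" for \<sigma>
  proof -
    have \<sigma>p: "\<sigma> permutes {..<m}" using \<sigma> by simp
    have C: "?C (perm_point m \<sigma> (perm_point m (?inv \<sigma>) y)) = ?C y" for y
    proof -
      have "\<sigma> i < m" if "i < m" for i using permutes_in_image[OF \<sigma>p, of i] that by simp
      then have "perm_point m \<sigma> (perm_point m (?inv \<sigma>) y) (Suc i) = y (Suc i)" if "i < m" for i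
        using that by (simp add: perm_point_Suc permutes_inverses[OF \<sigma>p])
      then have "perm_point m \<sigma> (perm_point m (?inv \<sigma>) y) \<in> chamber m \<longleftrightarrow> y \<in> chamber m"
        unfolding chamber_iff by auto
      then show ?thesis by (simp add: indicator_def)
    qed
    have "(LINT y|lborel_m m. ?G id y * detp m f y * ?C (perm_point m \<sigma> y)) =
        (LINT y|lborel_m m. ?G id (perm_point m (?inv \<sigma>) y) * detp m f (perm_point m (?inv \<sigma>) y) *
          ?C (perm_point m \<sigma> (perm_point m (?inv \<sigma>) y)))"
      by (rule integral_perm_point[symmetric, OF perm[OF \<sigma>]])
         (rule integrable_prod_detp_chamber(1)[OF permutes_id \<sigma>p])
    also have "\<dots> = (LINT y|lborel_m m. signof (?inv \<sigma>) * ?G (?inv \<sigma>) y * detp m f y * ?C y)"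
      unfolding C detp_perm_point[OF perm[OF \<sigma>]] by (simp add: perm_point_Suc mult_ac)
    finally show ?thesis .
  qed
  have "detf m (\<lambda>i j. pint (f i * g j * w)) =
      (LINT y|lborel_m m. cube_ind m y * (?G id y * detp m f y))"
    using integral_cube_detp[of m ?q f] by (simp add: mult.assoc)
  also have "\<dots> = (LINT y|lborel_m m. (\<Sum>\<sigma>\<in>?S. ?G id y * detp m f y * ?C (perm_point m \<sigma> y)))"
  proof (rule Bochner_Integration.integral_cong[OF refl])
    fix y
    show "cube_ind m y * (?G id y * detp m f y) = (\<Sum>\<sigma>\<in>?S. ?G id y * detp m f y * ?C (perm_point m \<sigma> y))"
    proof (cases "inj_on (\<lambda>i. y (Suc i)) {..<m}")
      case True
      then show ?thesis
        unfolding sum_distrib_left[symmetric] sum_indicator_chamber_perm[OF True] by simp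
    qed (simp add: detp_noninj)
  qed
  also have "\<dots> = (\<Sum>\<sigma>\<in>?S. LINT y|lborel_m m. ?G id y * detp m f y * ?C (perm_point m \<sigma> y))"
    using integrable_prod_detp_chamber(2)[OF permutes_id, of _ m ?q f]
    by (intro Bochner_Integration.integral_sum) simp
  also have "\<dots> = (\<Sum>\<sigma>\<in>?S. LINT y|lborel_m m. signof (?inv \<sigma>) * ?G (?inv \<sigma>) y * detp m f y * ?C y)"
    by (rule sum.cong[OF refl swap])
  also have "\<dots> = (\<Sum>\<sigma>\<in>?S. LINT y|lborel_m m. signof \<sigma> * ?G \<sigma> y * detp m f y * ?C y)"
    by (rule sum_permutations_inverse[symmetric])
  also have "\<dots> = (LINT y|lborel_m m. (\<Sum>\<sigma>\<in>?S. signof \<sigma> * ?G \<sigma> y * detp m f y * ?C y))"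
  proof (rule Bochner_Integration.integral_sum[symmetric])
    fix \<sigma> assume \<sigma>: "\<sigma> \<in> ?S"
    have C: "?C (perm_point m id y) = ?C y" for y
      by (simp add: indicator_def chamber_iff perm_point_Suc)
    show "integrable (lborel_m m) (\<lambda>y. signof \<sigma> * ?G \<sigma> y * detp m f y * ?C y)"
      using integrable_mult_right[OF integrable_prod_detp_chamber(2)[of \<sigma> m id ?q f], of "signof \<sigma>"] \<sigma>
      by (simp add: C permutes_id mult.assoc)
  qed
  also have "\<dots> = (LINT y|lborel_m m. detp m f y * detp m g y * (\<Prod>i<m. poly w (y (Suc i))) * ?C y)"
  proof (rule Bochner_Integration.integral_cong[OF refl])
    fix y
    \<comment> \<open>The signed sum of the permuted products rebuilds the second determinant, each
      column \<open>j\<close> carrying the factor \<open>poly w (y (Suc j))\<close>.\<close>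
    have "(\<Sum>\<sigma>\<in>?S. signof \<sigma> * ?G \<sigma> y) = detf m (\<lambda>i j. 1 * poly w (y (Suc j)) * poly (g i) (y (Suc j)))"
      unfolding detf_leibniz by (simp add: mult_ac)
    also have "\<dots> = (\<Prod>i<m. poly w (y (Suc i))) * detp m g y"
      unfolding detf_scale detp_def by simp
    finally show "(\<Sum>\<sigma>\<in>?S. signof \<sigma> * ?G \<sigma> y * detp m f y * ?C y) =
      detp m f y * detp m g y * (\<Prod>i<m. poly w (y (Suc i))) * ?C y"
      by (simp flip: sum_distrib_right)
  qed
  finally show ?thesis by simp
qed

section \<open>Growth of the Jacobi polynomials\<close>

lemma pochhammer_le_power:
  assumes "0 \<le> a" "a + real n \<le> A" shows "pochhammer a n \<le> A ^ n"
proof -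
  have "(\<Prod>i<n. a + real i) \<le> (\<Prod>i<n. A)"
    using assms by (intro prod_mono) auto
  then show ?thesis by (simp add: pochhammer_prod atLeast0LessThan)
qed

lemma pochhammer_ge_1: "1 \<le> a \<Longrightarrow> 1 \<le> pochhammer a n" for a :: real
  unfolding pochhammer_prod by (rule prod_ge_1) auto

text \<open>All \<open>k + 2 * j\<close> factors of the Pochhammer symbols in the numerator are at
  most \<open>A\<close> in absolute value, and the denominator is at least 1.\<close>

lemma abs_jcoef_le:
  assumes j: "j \<le> k"
  shows "\<bar>jcoef r s k j\<bar> \<le> (2 * real k + real r + real s + 2) ^ (3 * k)"
proof -
  define A where "A = 2 * real k + real r + real s + 2"
  have A: "1 \<le> A" by (simp add: A_def)
  have 1: "\<bar>pochhammer (real r + 1) k\<bar> \<le> A ^ k" "\<bar>pochhammer (real k + real r + real s + 1) j\<bar> \<le> A ^ j"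
    using j by (auto simp: A_def abs_of_nonneg pochhammer_nonneg intro!: pochhammer_le_power)
  have 2: "\<bar>pochhammer (- real k) j\<bar> \<le> A ^ j"
  proof -
    have "(\<Prod>i<j. \<bar>- real k + real i\<bar>) \<le> (\<Prod>i<j. A)"
      using j by (intro prod_mono) (auto simp: A_def)
    then show ?thesis by (simp add: pochhammer_prod abs_prod atLeast0LessThan)
  qed
  have 3: "1 \<le> \<bar>fact k * (pochhammer (real r + 1) j * fact j)\<bar>"
  proof -
    have "1 * (1 * 1) \<le> fact k * (pochhammer (real r + 1) j * fact j)"
      by (intro mult_mono pochhammer_ge_1) (auto intro: fact_ge_1 order_trans[OF _ pochhammer_ge_1])
    then show ?thesis by linarith
  qed
  have "\<bar>jcoef r s k j\<bar> = \<bar>pochhammer (real r + 1) k\<bar> * (\<bar>pochhammer (- real k) j\<bar> * \<bar>pochhammer (real k + real r + real s + 1) j\<bar>)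
      / \<bar>fact k * (pochhammer (real r + 1) j * fact j)\<bar>"
    by (simp add: jcoef_def abs_mult abs_divide)
  also have "\<dots> \<le> \<bar>pochhammer (real r + 1) k\<bar> * (\<bar>pochhammer (- real k) j\<bar> * \<bar>pochhammer (real k + real r + real s + 1) j\<bar>)"
  proof -
    have "X / D \<le> X" if "0 \<le> X" "1 \<le> D" for X D :: real
      using divide_left_mono[of 1 D X] that by simp
    from this[OF _ 3] show ?thesis by simp
  qed
  also have "\<dots> \<le> A ^ k * (A ^ j * A ^ j)"
    using A by (intro mult_mono 1 2) auto
  also have "\<dots> = A ^ (k + 2 * j)" by (simp add: power_add mult_2)
  also have "\<dots> \<le> A ^ (3 * k)" using A j by (intro power_increasing) auto
  finally show ?thesis unfolding A_def .
qed

lemma pbound_jpoly_le: "pbound (jpoly r s k) \<le> (2 * real k + real r + real s + 2) ^ (3 * k + 1)"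
proof -
  let ?A = "2 * real k + real r + real s + 2"
  have "pbound (jpoly r s k) \<le> (\<Sum>j\<le>k. \<bar>jcoef r s k j\<bar>)"
    unfolding pbound_def coeff_jpoly using degree_jpoly_le[of r s k] by (intro sum_mono2) auto
  also have "\<dots> \<le> (\<Sum>j\<le>k. ?A ^ (3 * k))"
    by (intro sum_mono abs_jcoef_le) auto
  also have "\<dots> = (real k + 1) * ?A ^ (3 * k)" by (simp add: add_ac)
  also have "\<dots> \<le> ?A * ?A ^ (3 * k)" by (intro mult_right_mono) auto
  finally show ?thesis by simp
qed

lemma inverse_jnorm2_le: "1 / jnorm2 r s k \<le> (2 * real k + real r + real s + 2) ^ (r + 1)"
proof -
  let ?A = "2 * real k + real r + real s + 2"
  have "fact (k + r + s) / fact (k + s) = pochhammer (real (k + s) + 1) r"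
    unfolding pochhammer_eq_fact by (simp add: add_ac)
  also have "\<dots> \<le> ?A ^ r" by (rule pochhammer_le_power) auto
  finally have 1: "(fact (k + r + s) / fact (k + s) :: real) \<le> ?A ^ r" .
  have 2: "(fact k / fact (k + r) :: real) \<le> 1"
    by (simp add: fact_mono)
  have "1 / jnorm2 r s k = (2 * real k + real r + real s + 1) * (fact k / fact (k + r)) * (fact (k + r + s) / fact (k + s))"
    by (simp add: jnorm2_eq)
  also have "\<dots> \<le> ?A * 1 * ?A ^ r"
    by (intro mult_mono 1 2) auto
  finally show ?thesis by simp
qed

text \<open>The share of a single degree \<open>k\<close> in the majorant of a term of the density.
  The power of \<open>1 + jeig r s k\<close> pays for the Vandermonde determinant of the
  eigenvalues, which is not a product over single degrees.\<close>

definition jmajor :: "nat \<Rightarrow> nat \<Rightarrow> nat \<Rightarrow> real \<Rightarrow> nat \<Rightarrow> real" where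
  "jmajor r s c t k = exp (- jeig r s k * t) * (1 / jnorm2 r s k) * \<bar>poly (jpoly r s k) 1\<bar> *
     (1 + jeig r s k) ^ c * pbound (jpoly r s k)"

lemma jeig_nonneg: "0 \<le> jeig r s k" by (simp add: jeig_def)

lemma jmajor_nonneg: "0 \<le> jmajor r s c t k"
  unfolding jmajor_def using jnorm2_pos[of r s k] jeig_nonneg[of r s k] pbound_nonneg[of "jpoly r s k"]
  by (intro mult_nonneg_nonneg) auto

text \<open>The exponent adds \<open>r + 1\<close> for the norm, \<open>2 * c\<close> for the power
  of the eigenvalue, and \<open>3 * k + 1\<close> twice: for the value at 1 and for
  \<open>pbound\<close>.\<close>

lemma jmajor_le:
  assumes "0 \<le> t"
  shows "jmajor r s c t k \<le> exp (- t * (real k)\<^sup>2) * (2 * real k + real r + real s + 2) ^ (6 * k + (r + 2 * c + 3))"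
proof -
  let ?A = "2 * real k + real r + real s + 2"
  have e: "exp (- jeig r s k * t) \<le> exp (- t * (real k)\<^sup>2)"
  proof -
    have "(real k)\<^sup>2 * t \<le> jeig r s k * t"
      using assms by (intro mult_right_mono) (simp_all add: jeig_def power2_eq_square algebra_simps)
    then show ?thesis by (simp add: mult.commute)
  qed
  have "1 + jeig r s k \<le> ?A\<^sup>2"
    by (simp add: jeig_def power2_eq_square algebra_simps)
  then have p: "(1 + jeig r s k) ^ c \<le> (?A\<^sup>2) ^ c"
    using jeig_nonneg by (intro power_mono) auto
  have v: "\<bar>poly (jpoly r s k) 1\<bar> \<le> ?A ^ (3 * k + 1)"
    by (rule order_trans[OF poly_le_pbound pbound_jpoly_le]) auto
  have "jmajor r s c t k \<le> exp (- t * (real k)\<^sup>2) * ?A ^ (r + 1) * ?A ^ (3 * k + 1) * (?A\<^sup>2) ^ c * ?A ^ (3 * k + 1)"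
    unfolding jmajor_def using jnorm2_pos[of r s k] jeig_nonneg[of r s k] pbound_nonneg[of "jpoly r s k"]
    by (intro mult_mono e inverse_jnorm2_le v p pbound_jpoly_le) auto
  also have "\<dots> = exp (- t * (real k)\<^sup>2) * ?A ^ ((r + 1) + (3 * k + 1) + 2 * c + (3 * k + 1))"
  proof -
    have "(?A\<^sup>2) ^ c = ?A ^ (2 * c)" by (simp only: power_mult)
    then show ?thesis by (simp only: power_add mult_ac)
  qed
  also have "(r + 1) + (3 * k + 1) + 2 * c + (3 * k + 1) = 6 * k + (r + 2 * c + 3)" by simp
  finally show ?thesis .
qed

text \<open>In the exponent \<open>(6 k + c) ln (2 k + d)\<close> is of smaller order than
  \<open>t k^2\<close>, so the terms are eventually below \<open>exp (- k)\<close>.\<close>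

lemma summable_gauss_power:
  fixes t :: real
  assumes "t > 0" and "d \<ge> 1"
  shows "summable (\<lambda>k. exp (- t * (real k)\<^sup>2) * (2 * real k + d) ^ (6 * k + c))"
proof (rule summable_comparison_test_ev)
  have "eventually (\<lambda>k :: nat. exp (- t * (real k)\<^sup>2) * (2 * real k + d) powr (6 * real k + real c) \<le> exp (- real k)) at_top"
    using assms by real_asymp
  then show "eventually (\<lambda>k :: nat. norm (exp (- t * (real k)\<^sup>2) * (2 * real k + d) ^ (6 * k + c)) \<le> exp (-1) ^ k) at_top"
  proof eventually_elim
    case (elim k)
    have "(2 * real k + d) powr (6 * real k + real c) = (2 * real k + d) ^ (6 * k + c)"
      using assms powr_realpow[of "2 * real k + d" "6 * k + c"] by simp
    then show ?case using elim assms by (simp add: exp_of_nat_mult[symmetric])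
  qed
  show "summable (\<lambda>k. exp (-1) ^ k :: real)" by (simp add: summable_geometric)
qed

lemma summable_jmajor:
  assumes "t > 0"
  shows "summable (jmajor r s c t)"
proof (rule summable_comparison_test)
  show "\<exists>N. \<forall>k\<ge>N. norm (jmajor r s c t k) \<le>
      exp (- t * (real k)\<^sup>2) * (2 * real k + (real r + real s + 2)) ^ (6 * k + (r + 2 * c + 3))"
    using jmajor_le[of t r s c] jmajor_nonneg[of r s c t] assms by (auto simp: add_ac)
  show "summable (\<lambda>k. exp (- t * (real k)\<^sup>2) * (2 * real k + (real r + real s + 2)) ^ (6 * k + (r + 2 * c + 3)))"
    by (rule summable_gauss_power[OF assms]) simp
qed


section \<open>Terms of the spectral expansion\<close>

lemma jshift_eq: "i < m \<Longrightarrow> jshift m \<tau> i = part \<tau> (Suc i) + (m - Suc i)"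
  by (simp add: jshift_def)

lemma partition_eqI:
  assumes "\<tau> \<in> partitions" "\<tau>' \<in> partitions" "\<And>i. 1 \<le> i \<Longrightarrow> part \<tau> i = part \<tau>' i"
  shows "\<tau> = \<tau>'"
proof -
  have *: "length \<sigma> \<le> length \<sigma>'"
    if "\<sigma> \<in> partitions" "\<And>i. 1 \<le> i \<Longrightarrow> part \<sigma> i = part \<sigma>' i" for \<sigma> \<sigma>'
  proof (rule ccontr)
    assume l: "\<not> length \<sigma> \<le> length \<sigma>'"
    then have "\<sigma> ! (length \<sigma> - 1) = 0"
      using that(2)[of "length \<sigma>"] by (simp add: part_def split: if_splits)
    moreover have "\<sigma> ! (length \<sigma> - 1) \<in> set \<sigma>" using l by (intro nth_mem) auto
    ultimately show False using that(1) by (simp add: partitions_def)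
  qed
  have len: "length \<tau> = length \<tau>'"
    using *[of \<tau> \<tau>'] *[of \<tau>' \<tau>] assms by (simp add: order_antisym)
  show ?thesis
  proof (rule nth_equalityI[OF len])
    fix i assume "i < length \<tau>"
    then show "\<tau> ! i = \<tau>' ! i" using assms(3)[of "Suc i"] len by (simp add: part_def)
  qed
qed

lemma jshift_inj:
  assumes "\<tau> \<in> partitions" "\<tau>' \<in> partitions" "length \<tau> \<le> m" "length \<tau>' \<le> m"
    and eq: "\<And>i. i < m \<Longrightarrow> jshift m \<tau> i = jshift m \<tau>' i"
  shows "\<tau> = \<tau>'"
proof (rule partition_eqI[OF assms(1,2)])
  fix i :: nat assume i: "1 \<le> i"
  show "part \<tau> i = part \<tau>' i"
  proof (cases "i \<le> m")
    case True
    with i obtain j where "i = Suc j" "j < m" by (cases i) auto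
    then show ?thesis using eq[of j] by (simp add: jshift_eq)
  qed (use assms in \<open>simp add: part_def\<close>)
qed

lemma nu_eq: "real (nu r s m \<tau>) = (\<Sum>i<m. jeig r s (jshift m \<tau> i)) - (\<Sum>i<m. jeig r s (m - Suc i))"
proof -
  have "nu r s m \<tau> = (\<Sum>i<m. part \<tau> (Suc i) * (part \<tau> (Suc i) + r + s + 1 + 2 * (m - Suc i)))"
    unfolding nu_def by (rule sum.reindex_bij_witness[of _ Suc "\<lambda>i. i - 1"]) auto
  also have "real \<dots> = (\<Sum>i<m. jeig r s (jshift m \<tau> i) - jeig r s (m - Suc i))"
    unfolding of_nat_sum
  proof (rule sum.cong[OF refl])
    fix i assume "i \<in> {..<m}"
    then have *: "real (jshift m \<tau> i) = real (part \<tau> (Suc i)) + real (m - Suc i)" by (simp add: jshift_eq)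
    show "real (part \<tau> (Suc i) * (part \<tau> (Suc i) + r + s + 1 + 2 * (m - Suc i))) =
        jeig r s (jshift m \<tau> i) - jeig r s (m - Suc i)"
      unfolding jeig_def * of_nat_mult of_nat_add by (simp add: algebra_simps)
  qed
  finally show ?thesis by (simp add: sum_subtractf)
qed

definition jfactor :: "nat \<Rightarrow> nat \<Rightarrow> nat \<Rightarrow> real \<Rightarrow> nat list \<Rightarrow> real" where
  "jfactor r s m t \<tau> = exp (- real (nu r s m \<tau>) * t) * (\<Prod>i<m. 1 / jnorm2 r s (jshift m \<tau> i)) *
     jvalue r s m (jshift m \<tau>)"

definition jlead :: "nat \<Rightarrow> nat \<Rightarrow> nat \<Rightarrow> real" where
  "jlead r s m = (\<Prod>i<m. jcoef r s i i)"

text \<open>The part of a density term that depends on \<open>y\<close>. One of the two Vandermonde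
  factors of the weight has cancelled the denominator of the multivariate polynomial, so that a
  single one is left.\<close>

definition jmode :: "nat \<Rightarrow> nat \<Rightarrow> nat \<Rightarrow> nat list \<Rightarrow> (nat \<Rightarrow> real) \<Rightarrow> real" where
  "jmode r s m \<tau> y = detp m (\<lambda>i. jpoly r s (jshift m \<tau> i)) y * vdm m (\<lambda>i. y (Suc i)) *
     (\<Prod>i<m. poly (wpoly r s) (y (Suc i))) * indicator (chamber m) y"

lemma jlead_nonzero: "jlead r s m \<noteq> 0"
  by (simp add: jlead_def lead_coeff_jpoly)

lemma detp_empty: "detp m (\<lambda>i. jpoly r s (m - Suc i)) y = jlead r s m * vdm m (\<lambda>i. y (Suc i))"
  unfolding detp_def jlead_def
  using detf_poly_vdm[of m "jpoly r s" "\<lambda>j. y (Suc j)"] degree_jpoly_le by (simp add: coeff_jpoly)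

lemma chamber_inj: "y \<in> chamber m \<Longrightarrow> inj_on y {1..m}"
  unfolding chamber_def by (rule linorder_inj_onI') force+

lemma jacobi_weight_eq:
  "jacobi_weight r s m y = (vdm m (\<lambda>i. y (Suc i)))\<^sup>2 * (\<Prod>i<m. poly (wpoly r s) (y (Suc i))) * indicator (chamber m) y"
  unfolding jacobi_weight_def vandermonde_eq_vdm poly_wpoly prod_Suc_index by simp

lemma multi_jacobi_poly_weight: "multi_jacobi_poly r s m \<tau> y * jacobi_weight r s m y = jmode r s m \<tau> y"
proof (cases "y \<in> chamber m")
  case True
  then have inj: "inj_on y {1..m}" by (rule chamber_inj)
  then have "vdm m (\<lambda>i. y (Suc i)) \<noteq> 0" unfolding vdm_eq_0_iff inj_on_shift by simp
  then show ?thesis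
    using inj unfolding multi_jacobi_poly_def
    by (simp add: multi_jacobi_quotient_eq jacobi_weight_eq jmode_def detp_def power2_eq_square)
qed (simp add: jacobi_weight_eq jmode_def)

lemma jacobi_density_eq:
  "jacobi_density r s m t y =
     (\<Sum>\<^sub>\<infinity>\<tau>\<in>{\<tau> \<in> partitions. length \<tau> \<le> m}. jfactor r s m t \<tau> * jmode r s m \<tau> y)"
  unfolding jacobi_density_def
proof (rule infsum_cong)
  fix \<tau>
  have "(\<Prod>j=1..m. 1 / (jacobi_L2_norm r s (jacobi_poly r s (part \<tau> j + m - j)))\<^sup>2) =
      (\<Prod>i<m. 1 / jnorm2 r s (jshift m \<tau> i))"
    unfolding jacobi_L2_norm_jacobi_poly prod_Suc_index jshift_def by simp
  then show "exp (- real (nu r s m \<tau>) * t) *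
        (\<Prod>j=1..m. 1 / (jacobi_L2_norm r s (jacobi_poly r s (part \<tau> j + m - j)))\<^sup>2) *
        multi_jacobi_poly r s m \<tau> (\<lambda>_. 1) * multi_jacobi_poly r s m \<tau> y * jacobi_weight r s m y =
     jfactor r s m t \<tau> * jmode r s m \<tau> y"
    unfolding jfactor_def multi_jacobi_poly_ones multi_jacobi_poly_weight[symmetric]
    by (simp only: mult.assoc)
qed

text \<open>Every difference is at most \<open>T\<close>, the product of all \<open>1 + w i\<close>,
  and fewer than \<open>m * m\<close> differences are counted when \<open>m > 0\<close>. The bound
  is a product over single indices, as the summation over partitions requires.\<close>

lemma abs_vdm_le:
  assumes "\<And>i. i < m \<Longrightarrow> 0 \<le> w i"
  shows "\<bar>vdm m w\<bar> \<le> (\<Prod>i<m. (1 + w i) ^ (m * m))"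
proof -
  define T where "T = (\<Prod>i<m. 1 + w i)"
  have T1: "1 \<le> T" unfolding T_def using assms by (intro prod_ge_1) auto
  have wT: "w i \<le> T" if "i < m" for i
  proof -
    have "w i \<le> (\<Prod>j\<in>{i}. 1 + w j)" by simp
    also have "\<dots> \<le> T" unfolding T_def using assms that by (intro prod_mono2) auto
    finally show ?thesis .
  qed
  have "\<bar>vdm m w\<bar> = (\<Prod>j<m. \<Prod>i<j. \<bar>w i - w j\<bar>)" by (simp add: vdm_def abs_prod)
  also have "\<dots> \<le> (\<Prod>j<m. T ^ m)"
  proof (intro prod_mono conjI prod_nonneg)
    fix j assume j: "j \<in> {..<m}"
    have "(\<Prod>i<j. \<bar>w i - w j\<bar>) \<le> (\<Prod>i<j. T)"
    proof (intro prod_mono conjI)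
      fix i assume "i \<in> {..<j}"
      then show "\<bar>w i - w j\<bar> \<le> T"
        using j assms[of i] assms[of j] wT[of i] wT[of j] by auto
    qed simp
    also have "\<dots> \<le> T ^ m" using T1 j by (auto intro: power_increasing)
    finally show "(\<Prod>i<j. \<bar>w i - w j\<bar>) \<le> T ^ m" .
  qed auto
  also have "\<dots> = (\<Prod>i<m. (1 + w i) ^ (m * m))"
    by (simp add: T_def prod_power_distrib flip: power_mult)
  finally show ?thesis .
qed

text \<open>The leading exponential undoes the subtraction of the eigenvalues
  \<open>jeig r s (m - Suc i)\<close> in \<open>nu_eq\<close>; the rest is a product over the
  degrees attached to \<tau>.\<close>

definition jterm_bound :: "nat \<Rightarrow> nat \<Rightarrow> nat \<Rightarrow> real \<Rightarrow> nat list \<Rightarrow> real" where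
  "jterm_bound r s m t \<tau> = exp ((\<Sum>i<m. jeig r s (m - Suc i)) * t) * \<bar>jconst s m\<bar> * fact m *
     (\<Prod>i<m. jmajor r s (m * m) t (jshift m \<tau> i))"

lemma jfactor_bound:
  "\<bar>jfactor r s m t \<tau>\<bar> * (fact m * (\<Prod>i<m. pbound (jpoly r s (jshift m \<tau> i)))) \<le> jterm_bound r s m t \<tau>"
proof -
  let ?k = "jshift m \<tau>"
  have e: "exp (- real (nu r s m \<tau>) * t) =
      exp ((\<Sum>i<m. jeig r s (m - Suc i)) * t) * (\<Prod>i<m. exp (- jeig r s (?k i) * t))"
    unfolding nu_eq exp_sum[OF finite_lessThan, symmetric]
    by (simp add: algebra_simps sum_negf sum_distrib_left flip: exp_add)
  have "\<bar>jfactor r s m t \<tau>\<bar> = exp ((\<Sum>i<m. jeig r s (m - Suc i)) * t) * \<bar>jconst s m\<bar> *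
     ((\<Prod>i<m. exp (- jeig r s (?k i) * t)) * (\<Prod>i<m. 1 / jnorm2 r s (?k i)) * (\<Prod>i<m. \<bar>poly (jpoly r s (?k i)) 1\<bar>)) *
     \<bar>vdm m (\<lambda>i. jeig r s (?k i))\<bar>"
    unfolding jfactor_def jvalue_def e using jnorm2_pos[of r s]
    by (simp add: abs_mult abs_prod abs_divide abs_of_pos mult_ac)
  also have "\<dots> \<le> exp ((\<Sum>i<m. jeig r s (m - Suc i)) * t) * \<bar>jconst s m\<bar> *
     ((\<Prod>i<m. exp (- jeig r s (?k i) * t)) * (\<Prod>i<m. 1 / jnorm2 r s (?k i)) * (\<Prod>i<m. \<bar>poly (jpoly r s (?k i)) 1\<bar>)) *
     (\<Prod>i<m. (1 + jeig r s (?k i)) ^ (m * m))"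
    using jnorm2_pos[of r s]
    by (intro mult_left_mono abs_vdm_le mult_nonneg_nonneg prod_nonneg jeig_nonneg)
       (auto simp: less_imp_le)
  finally have "\<bar>jfactor r s m t \<tau>\<bar> * (fact m * (\<Prod>i<m. pbound (jpoly r s (?k i)))) \<le>
     exp ((\<Sum>i<m. jeig r s (m - Suc i)) * t) * \<bar>jconst s m\<bar> *
     ((\<Prod>i<m. exp (- jeig r s (?k i) * t)) * (\<Prod>i<m. 1 / jnorm2 r s (?k i)) * (\<Prod>i<m. \<bar>poly (jpoly r s (?k i)) 1\<bar>)) *
     (\<Prod>i<m. (1 + jeig r s (?k i)) ^ (m * m)) * (fact m * (\<Prod>i<m. pbound (jpoly r s (?k i))))"
    by (intro mult_right_mono mult_nonneg_nonneg prod_nonneg pbound_nonneg) auto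
  also have "\<dots> = jterm_bound r s m t \<tau>"
    unfolding jterm_bound_def jmajor_def prod.distrib by (simp only: mult_ac)
  finally show ?thesis .
qed

text \<open>A partition is determined by its \<open>m\<close> degrees
  \<open>jshift m \<tau> i\<close>. The sum over partitions is thus at most the sum over all
  \<open>m\<close>-tuples of natural numbers, which is the \<open>m\<close>-th power of a convergent
  series.\<close>

lemma summable_on_jterm_bound:
  assumes t: "t > 0"
  shows "jterm_bound r s m t summable_on {\<tau> \<in> partitions. length \<tau> \<le> m}"
proof -
  let ?P = "{\<tau> \<in> partitions. length \<tau> \<le> m}"
  let ?b = "jmajor r s (m * m) t"
  have "(\<lambda>\<tau>. \<Prod>i<m. ?b (jshift m \<tau> i)) summable_on ?P"
  proof (rule nonneg_bdd_above_summable_on)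
    show "bdd_above (sum (\<lambda>\<tau>. \<Prod>i<m. ?b (jshift m \<tau> i)) ` {F. F \<subseteq> ?P \<and> finite F})"
    proof (rule bdd_aboveI2)
      fix F assume F: "F \<in> {F. F \<subseteq> ?P \<and> finite F}"
      \<comment> \<open>\<open>N\<close> exceeds every degree occurring in the finite set
        \<open>F\<close>, so \<open>F\<close> embeds in a finite box of tuples.\<close>
      define N where "N = Suc (\<Sum>\<tau>\<in>F. \<Sum>i<m. jshift m \<tau> i)"
      let ?f = "\<lambda>\<tau>. restrict (jshift m \<tau>) {..<m}"
      have inj: "inj_on ?f F"
      proof (rule inj_onI)
        fix \<tau> \<tau>' assume a: "\<tau> \<in> F" "\<tau>' \<in> F" "?f \<tau> = ?f \<tau>'"
        have "jshift m \<tau> i = jshift m \<tau>' i" if "i < m" for i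
          using fun_cong[OF a(3), of i] that by simp
        then show "\<tau> = \<tau>'" using F a by (intro jshift_inj[of _ _ m]) auto
      qed
      have lt: "jshift m \<tau> i < N" if "\<tau> \<in> F" "i < m" for \<tau> i
      proof -
        have "jshift m \<tau> i \<le> (\<Sum>i<m. jshift m \<tau> i)" using that by (intro member_le_sum) auto
        also have "\<dots> \<le> (\<Sum>\<tau>\<in>F. \<Sum>i<m. jshift m \<tau> i)"
          using that F by (intro member_le_sum[of \<tau> F "\<lambda>\<tau>. \<Sum>i<m. jshift m \<tau> i"]) auto
        finally show ?thesis by (simp add: N_def)
      qed
      have "(\<Sum>\<tau>\<in>F. \<Prod>i<m. ?b (jshift m \<tau> i)) = (\<Sum>\<kappa>\<in>?f ` F. \<Prod>i<m. ?b (\<kappa> i))"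
        by (subst sum.reindex[OF inj]) simp
      also have "\<dots> \<le> (\<Sum>\<kappa>\<in>PiE {..<m} (\<lambda>_. {..<N}). \<Prod>i<m. ?b (\<kappa> i))"
      proof (rule sum_mono2)
        show "finite (PiE {..<m} (\<lambda>_. {..<N}))" by (intro finite_PiE) auto
        show "?f ` F \<subseteq> PiE {..<m} (\<lambda>_. {..<N})"
          using lt by (intro image_subsetI) (simp add: restrict_PiE_iff)
        show "0 \<le> (\<Prod>i<m. ?b (\<kappa> i))" for \<kappa>
          by (intro prod_nonneg) (simp add: jmajor_nonneg)
      qed
      also have "\<dots> = (\<Prod>i<m. \<Sum>k<N. ?b k)"
        by (rule prod_sum_PiE[symmetric]) auto
      also have "\<dots> \<le> (\<Prod>i<m. suminf ?b)"
        using sum_le_suminf[OF summable_jmajor[OF t]] jmajor_nonneg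
        by (intro prod_mono conjI sum_nonneg) auto
      finally show "(\<Sum>\<tau>\<in>F. \<Prod>i<m. ?b (jshift m \<tau> i)) \<le> (\<Prod>i<m. suminf ?b)" .
    qed
  qed (intro prod_nonneg jmajor_nonneg)
  then show ?thesis
    unfolding jterm_bound_def[abs_def] by (rule summable_on_cmult_right)
qed

lemma jmode_bound:
  "\<bar>jmode r s m \<tau> y\<bar> \<le> fact m * (\<Prod>i<m. pbound (jpoly r s (jshift m \<tau> i))) * cube_ind m y"
proof (cases "y \<in> chamber m")
  case True
  then have y: "0 \<le> y (Suc i) \<and> y (Suc i) \<le> 1" if "i < m" for i
    using that unfolding chamber_iff by (auto intro: less_imp_le)
  have c: "cube_ind m y = 1" using True by (simp add: chamber_iff cube_ind_eq)
  have v: "\<bar>vdm m (\<lambda>i. y (Suc i))\<bar> \<le> 1"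
  proof -
    have "\<bar>y (Suc i) - y (Suc j)\<bar> \<le> 1" if "i < j" "j < m" for i j
      using y[of i] y[of j] that by (auto simp: abs_if)
    then show ?thesis unfolding vdm_def abs_prod by (intro prod_le_1 conjI prod_nonneg) auto
  qed
  have w: "\<bar>\<Prod>i<m. poly (wpoly r s) (y (Suc i))\<bar> \<le> 1"
    unfolding abs_prod poly_wpoly using y
    by (intro prod_le_1 conjI) (auto simp: abs_mult power_abs intro!: mult_le_one power_le_one)
  have "\<bar>jmode r s m \<tau> y\<bar> \<le> (fact m * (\<Prod>i<m. pbound (jpoly r s (jshift m \<tau> i)))) * 1 * 1 * 1"
    unfolding jmode_def abs_mult using True
    by (intro mult_mono detp_bound y v w) (auto simp: prod_nonneg pbound_nonneg)
  then show ?thesis by (simp add: c)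
next
  case False
  then show ?thesis by (simp add: jmode_def cube_ind_eq prod_nonneg pbound_nonneg)
qed

lemma jterm_le:
  "\<bar>jfactor r s m t \<tau> * jmode r s m \<tau> y\<bar> \<le> jterm_bound r s m t \<tau> * cube_ind m y"
proof -
  have c: "0 \<le> cube_ind m y" by (simp add: cube_ind_eq)
  have "\<bar>jfactor r s m t \<tau> * jmode r s m \<tau> y\<bar> \<le>
      \<bar>jfactor r s m t \<tau>\<bar> * (fact m * (\<Prod>i<m. pbound (jpoly r s (jshift m \<tau> i))) * cube_ind m y)"
    unfolding abs_mult by (intro mult_left_mono jmode_bound) auto
  also have "\<dots> = \<bar>jfactor r s m t \<tau>\<bar> * (fact m * (\<Prod>i<m. pbound (jpoly r s (jshift m \<tau> i)))) * cube_ind m y"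
    by (simp only: mult.assoc)
  also have "\<dots> \<le> jterm_bound r s m t \<tau> * cube_ind m y"
    by (intro mult_right_mono jfactor_bound c)
  finally show ?thesis .
qed

lemma borel_measurable_vdm: "(\<lambda>y. vdm m (\<lambda>i. y (Suc i))) \<in> borel_measurable (lborel_m m)"
  unfolding vdm_def
  by (intro borel_measurable_prod borel_measurable_diff borel_measurable_coordinate) auto

lemma borel_measurable_jmode: "jmode r s m \<tau> \<in> borel_measurable (lborel_m m)"
  unfolding jmode_def[abs_def]
  by (intro borel_measurable_times borel_measurable_detp borel_measurable_vdm borel_measurable_prod
      borel_measurable_poly_coordinate borel_measurable_chamber) auto

section \<open>Exchanging sum and integral\<close>

lemma infsum_nat_eq_suminf:
  fixes f :: "nat \<Rightarrow> real"
  assumes "summable (\<lambda>n. \<bar>f n\<bar>)"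
  shows "infsum f UNIV = suminf f"
  using assms by (intro infsumI norm_summable_imp_has_sum) (auto intro: summable_sums summable_rabs_cancel)

text \<open>An enumeration of \<open>P\<close> turns the unconditional sum into a series. The bound
  \<open>c \<tau> * q y\<close>, summable in \<tau> and integrable in \<open>y\<close>, makes the
  integrals of the absolute values summable.\<close>

lemma integral_infsum_dominated:
  fixes f :: "'i \<Rightarrow> 'b \<Rightarrow> real"
  assumes P: "countable P" "infinite P"
    and c: "c summable_on P" and q: "integrable M q"
    and f: "\<And>\<tau>. \<tau> \<in> P \<Longrightarrow> f \<tau> \<in> borel_measurable M"
    and bound: "\<And>\<tau> y. \<tau> \<in> P \<Longrightarrow> \<bar>f \<tau> y\<bar> \<le> c \<tau> * q y"
  shows "(\<lambda>y. \<Sum>\<^sub>\<infinity>\<tau>\<in>P. f \<tau> y) \<in> borel_measurable M"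
    and "(LINT y|M. (\<Sum>\<^sub>\<infinity>\<tau>\<in>P. f \<tau> y)) = (\<Sum>\<^sub>\<infinity>\<tau>\<in>P. LINT y|M. f \<tau> y)"
proof -
  define e where "e = from_nat_into P"
  have e: "bij_betw e UNIV P" unfolding e_def by (rule bij_betw_from_nat_into[OF P])
  have eP: "e n \<in> P" for n using e by (auto simp: bij_betw_def)
  have ce: "summable (\<lambda>n. c (e n))"
    using c by (intro summable_on_imp_summable) (simp add: summable_on_reindex_bij_betw[OF e])
  have abs: "summable (\<lambda>n. \<bar>f (e n) y\<bar>)" for y
  proof (rule summable_comparison_test[OF exI summable_mult2[OF ce, of "q y"]], intro allI impI)
    show "norm \<bar>f (e n) y\<bar> \<le> c (e n) * q y" for n using bound[OF eP, of n y] by simp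
  qed
  have eq: "(\<Sum>\<^sub>\<infinity>\<tau>\<in>P. f \<tau> y) = (\<Sum>n. f (e n) y)" for y
    using infsum_nat_eq_suminf[OF abs[of y]] infsum_reindex_bij_betw[OF e, of "\<lambda>\<tau>. f \<tau> y"] by simp
  show "(\<lambda>y. \<Sum>\<^sub>\<infinity>\<tau>\<in>P. f \<tau> y) \<in> borel_measurable M"
    unfolding eq by (intro borel_measurable_suminf f eP)
  have int: "integrable M (f (e n))" for n
    by (rule Bochner_Integration.integrable_bound[OF integrable_mult_right[OF q, of "c (e n)"] f[OF eP]])
       (rule AE_I2, use order_trans[OF bound[OF eP] abs_ge_self] in simp)
  have norm_int: "(LINT y|M. \<bar>f (e n) y\<bar>) \<le> c (e n) * (LINT y|M. q y)" for n
  proof -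
    have "(LINT y|M. \<bar>f (e n) y\<bar>) \<le> (LINT y|M. c (e n) * q y)"
      using int q bound[OF eP] by (intro integral_mono) auto
    then show ?thesis by simp
  qed
  have sum_norm: "summable (\<lambda>n. LINT y|M. \<bar>f (e n) y\<bar>)"
  proof (rule summable_comparison_test[OF exI summable_mult2[OF ce, of "LINT y|M. q y"]], intro allI impI)
    show "norm (LINT y|M. \<bar>f (e n) y\<bar>) \<le> c (e n) * (LINT y|M. q y)" for n
      using norm_int[of n] by simp
  qed
  have "summable (\<lambda>n. \<bar>LINT y|M. f (e n) y\<bar>)"
    by (rule summable_comparison_test[OF exI sum_norm]) (auto intro: integral_abs_bound)
  then have "(\<Sum>n. LINT y|M. f (e n) y) = (\<Sum>\<^sub>\<infinity>\<tau>\<in>P. LINT y|M. f \<tau> y)"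
    using infsum_nat_eq_suminf[of "\<lambda>n. LINT y|M. f (e n) y"]
      infsum_reindex_bij_betw[OF e, of "\<lambda>\<tau>. LINT y|M. f \<tau> y"] by simp
  moreover have "(LINT y|M. (\<Sum>n. f (e n) y)) = (\<Sum>n. LINT y|M. f (e n) y)"
    using int abs sum_norm by (intro integral_suminf) auto
  ultimately show "(LINT y|M. (\<Sum>\<^sub>\<infinity>\<tau>\<in>P. f \<tau> y)) = (\<Sum>\<^sub>\<infinity>\<tau>\<in>P. LINT y|M. f \<tau> y)"
    unfolding eq by simp
qed

lemma infinite_partitions:
  assumes "m \<ge> 1"
  shows "infinite {\<tau> \<in> partitions. length \<tau> \<le> m}"
proof -
  have "inj (\<lambda>k. [Suc k])" by (auto simp: inj_on_def)
  then have "infinite (range (\<lambda>k. [Suc k]))" by (rule range_inj_infinite)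
  moreover have "range (\<lambda>k. [Suc k]) \<subseteq> {\<tau> \<in> partitions. length \<tau> \<le> m}"
    using assms by (auto simp: partitions_def)
  ultimately show ?thesis using infinite_super by blast
qed

lemma countable_partitions: "countable {\<tau> \<in> partitions. length \<tau> \<le> m}"
  by (rule countableI_type)

lemma integrable_cube_ind: "integrable (lborel_m m) (cube_ind m)"
  using integrable_PiM_prod(1)[of m "\<lambda>_. indicator {0<..<1::real}"] by (simp add: cube_ind_def[abs_def])

lemma borel_measurable_jacobi_density:
  assumes "m \<ge> 1" "t > 0"
  shows "jacobi_density r s m t \<in> borel_measurable (lborel_m m)"
  unfolding jacobi_density_eq[abs_def]
  by (rule integral_infsum_dominated(1)[OF countable_partitions infinite_partitions[OF assms(1)]
        summable_on_jterm_bound[OF assms(2)] integrable_cube_ind])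
     (rule borel_measurable_times[OF borel_measurable_const borel_measurable_jmode], rule jterm_le)

lemma borel_measurable_power_sum_jmode:
  "(\<lambda>y. (\<Sum>i=1..m. y i ^ n) * jmode r s m \<tau> y) \<in> borel_measurable (lborel_m m)"
  by (intro borel_measurable_times borel_measurable_jmode borel_measurable_sum borel_measurable_power)
     (auto intro: measurable_component_singleton)

definition jmode_moment :: "nat \<Rightarrow> nat \<Rightarrow> nat \<Rightarrow> nat \<Rightarrow> nat list \<Rightarrow> real" where
  "jmode_moment r s m n \<tau> = (LINT y|lborel_m m. (\<Sum>i=1..m. y i ^ n) * jmode r s m \<tau> y)"

lemma jacobi_moment_eq_infsum:
  assumes "m \<ge> 1" "t > 0"
  shows "jacobi_moment r s m n t =
     (\<Sum>\<^sub>\<infinity>\<tau>\<in>{\<tau> \<in> partitions. length \<tau> \<le> m}. jfactor r s m t \<tau> * jmode_moment r s m n \<tau>)"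
proof -
  let ?P = "{\<tau> \<in> partitions. length \<tau> \<le> m}"
  let ?p = "\<lambda>y :: nat \<Rightarrow> real. \<Sum>i=1..m. y i ^ n"
  have "jacobi_moment r s m n t =
      (LINT y|lborel_m m. (\<Sum>\<^sub>\<infinity>\<tau>\<in>?P. jfactor r s m t \<tau> * (?p y * jmode r s m \<tau> y)))"
    unfolding jacobi_moment_def jacobi_density_eq infsum_cmult_right'[symmetric]
    by (simp only: mult.left_commute)
  also have "\<dots> = (\<Sum>\<^sub>\<infinity>\<tau>\<in>?P. LINT y|lborel_m m. jfactor r s m t \<tau> * (?p y * jmode r s m \<tau> y))"
  proof (rule integral_infsum_dominated(2)[OF countable_partitions infinite_partitions[OF assms(1)]
        summable_on_jterm_bound[OF assms(2)]])
    show "integrable (lborel_m m) (\<lambda>y. real m * cube_ind m y)"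
      by (intro integrable_mult_right integrable_cube_ind)
    fix \<tau>
    show "(\<lambda>y. jfactor r s m t \<tau> * (?p y * jmode r s m \<tau> y)) \<in> borel_measurable (lborel_m m)"
      by (intro borel_measurable_times[OF borel_measurable_const borel_measurable_power_sum_jmode])
    fix y
    show "\<bar>jfactor r s m t \<tau> * (?p y * jmode r s m \<tau> y)\<bar> \<le> jterm_bound r s m t \<tau> * (real m * cube_ind m y)"
    proof (cases "y \<in> chamber m")
      case True
      have "\<bar>?p y\<bar> \<le> (\<Sum>i=1..m. \<bar>y i ^ n\<bar>)" by (rule sum_abs)
      also have "\<dots> \<le> (\<Sum>i=1..m. 1)"
      proof (rule sum_mono)
        fix i assume "i \<in> {1..m}"
        with True have "0 < y i \<and> y i < 1" by (simp add: chamber_def)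
        then show "\<bar>y i ^ n\<bar> \<le> 1" by (simp add: power_abs power_le_one)
      qed
      finally have "\<bar>?p y\<bar> * \<bar>jfactor r s m t \<tau> * jmode r s m \<tau> y\<bar> \<le>
          real m * (jterm_bound r s m t \<tau> * cube_ind m y)"
        by (intro mult_mono jterm_le) auto
      then show ?thesis by (simp only: abs_mult mult_ac)
    next
      case False
      then show ?thesis
        using jterm_le[of r s m t \<tau> y] by (simp add: jmode_def mult.left_commute)
    qed
  qed
  finally show ?thesis by (simp add: jmode_moment_def)
qed

section \<open>Which partitions contribute\<close>

text \<open>In Leibniz' formula the altered row \<open>a\<close> contributes the factor
  \<open>y (Suc (p a)) ^ n\<close>; summed over \<open>a\<close> this is the power sum, whatever the
  permutation \<open>p\<close>.\<close>

lemma power_sum_detp: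
  "(\<Sum>i=1..m. y i ^ n) * detp m g y =
     (\<Sum>a<m. detp m (\<lambda>i. if i = a then monom 1 n * g i else g i) y)"
proof -
  have "detp m (\<lambda>i. if i = a then monom 1 n * g i else g i) y =
      (\<Sum>p | p permutes {..<m}. y (Suc (p a)) ^ n * (signof p * (\<Prod>i<m. poly (g i) (y (Suc (p i))))))"
    if a: "a < m" for a
  proof -
    have "(\<Prod>i<m. poly (if i = a then monom 1 n * g i else g i) (y (Suc (p i)))) =
        y (Suc (p a)) ^ n * (\<Prod>i<m. poly (g i) (y (Suc (p i))))" for p
    proof -
      have "(\<Prod>i<m. poly (if i = a then monom 1 n * g i else g i) (y (Suc (p i)))) =
        (\<Prod>i<m. (if i = a then y (Suc (p a)) ^ n else 1) * poly (g i) (y (Suc (p i))))"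
        by (rule prod.cong) (auto simp: poly_monom)
      then show ?thesis using a by (simp add: prod.distrib)
    qed
    then show ?thesis by (simp add: detp_def detf_leibniz mult.left_commute)
  qed
  then have "(\<Sum>a<m. detp m (\<lambda>i. if i = a then monom 1 n * g i else g i) y) =
      (\<Sum>p | p permutes {..<m}. \<Sum>a<m. y (Suc (p a)) ^ n * (signof p * (\<Prod>i<m. poly (g i) (y (Suc (p i))))))"
    by (simp add: sum.swap[of _ "{..<m}"])
  also have "\<dots> = (\<Sum>p | p permutes {..<m}. (\<Sum>i=1..m. y i ^ n) * (signof p * (\<Prod>i<m. poly (g i) (y (Suc (p i))))))"
  proof (rule sum.cong[OF refl])
    fix p assume "p \<in> {p. p permutes {..<m}}"
    then have "(\<Sum>a<m. y (Suc (p a)) ^ n) = (\<Sum>a<m. y (Suc a) ^ n)"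
      using sum.permute[of p "{..<m}" "\<lambda>a. y (Suc a) ^ n"] by (simp add: o_def)
    also have "\<dots> = (\<Sum>i=1..m. y i ^ n)"
      by (rule sum.reindex_bij_witness[of _ "\<lambda>i. i - 1" Suc]) auto
    finally show "(\<Sum>a<m. y (Suc (p a)) ^ n * (signof p * (\<Prod>i<m. poly (g i) (y (Suc (p i)))))) =
       (\<Sum>i=1..m. y i ^ n) * (signof p * (\<Prod>i<m. poly (g i) (y (Suc (p i)))))"
      unfolding sum_distrib_right[symmetric] by simp
  qed
  also have "\<dots> = (\<Sum>i=1..m. y i ^ n) * detp m g y"
    unfolding sum_distrib_left[symmetric] by (simp add: detp_def detf_leibniz)
  finally show ?thesis by simp
qed

lemma integrable_detp_detp:
  "integrable (lborel_m m) (\<lambda>y. detp m f y * detp m g y * (\<Prod>i<m. poly w (y (Suc i))) * indicator (chamber m) y)"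
    (is "integrable _ ?h")
proof (rule integrable_bounded_on_cube(1))
  show "?h \<in> borel_measurable (lborel_m m)"
    by (intro borel_measurable_times borel_measurable_detp borel_measurable_prod
        borel_measurable_poly_coordinate borel_measurable_chamber) auto
  fix y
  let ?B = "(fact m * (\<Prod>i<m. pbound (f i))) * (fact m * (\<Prod>i<m. pbound (g i))) * (\<Prod>i<m. pbound w)"
  show "\<bar>?h y\<bar> \<le> ?B * cube_ind m y"
  proof (cases "y \<in> chamber m")
    case True
    then have y: "0 \<le> y (Suc i) \<and> y (Suc i) \<le> 1" if "i < m" for i
      using that unfolding chamber_iff by (auto intro: less_imp_le)
    have "(\<Prod>i<m. \<bar>poly w (y (Suc i))\<bar>) \<le> (\<Prod>i<m. pbound w)"
      using y by (intro prod_mono) (auto intro: poly_le_pbound)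
    then have "\<bar>?h y\<bar> \<le> ?B * 1"
      unfolding abs_mult abs_prod using True
      by (intro mult_mono detp_bound y) (auto simp: prod_nonneg pbound_nonneg)
    then show ?thesis using True by (simp add: chamber_iff cube_ind_eq)
  next
    case False
    then show ?thesis by (simp add: cube_ind_eq prod_nonneg pbound_nonneg)
  qed
qed

text \<open>The matrix left by Andreief's identity: rows belong to the degrees of \<tau>, columns to
  the degrees \<open>m - 1, ..., 0\<close> of the empty partition, and column \<open>a\<close> has
  absorbed the power \<open>u^n\<close>.\<close>

definition jmatrix :: "nat \<Rightarrow> nat \<Rightarrow> nat \<Rightarrow> nat \<Rightarrow> nat list \<Rightarrow> nat \<Rightarrow> nat \<Rightarrow> nat \<Rightarrow> real" where
  "jmatrix r s m n \<tau> a i j = wint r s (jpoly r s (jshift m \<tau> i) *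
     (if j = a then monom 1 n * jpoly r s (m - Suc j) else jpoly r s (m - Suc j)))"

lemma jmode_moment_eq:
  "jmode_moment r s m n \<tau> = (\<Sum>a<m. detf m (jmatrix r s m n \<tau> a)) / jlead r s m"
proof -
  let ?f = "\<lambda>i. jpoly r s (jshift m \<tau> i)"
  let ?g = "\<lambda>a i. if i = a then monom 1 n * jpoly r s (m - Suc i) else jpoly r s (m - Suc i)"
  let ?W = "\<lambda>y. (\<Prod>i<m. poly (wpoly r s) (y (Suc i))) :: real" and ?C = "\<lambda>y. indicator (chamber m) y :: real"
  have "jlead r s m * ((\<Sum>i=1..m. y i ^ n) * jmode r s m \<tau> y) =
      (\<Sum>a<m. detp m ?f y * detp m (?g a) y * ?W y * ?C y)" for y
  proof -
    have "jlead r s m * ((\<Sum>i=1..m. y i ^ n) * jmode r s m \<tau> y) =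
       detp m ?f y * ((\<Sum>i=1..m. y i ^ n) * detp m (\<lambda>i. jpoly r s (m - Suc i)) y) * ?W y * ?C y"
      unfolding jmode_def detp_empty by (simp only: mult_ac)
    then show ?thesis
      unfolding power_sum_detp by (simp only: sum_distrib_left sum_distrib_right)
  qed
  then have "jlead r s m * jmode_moment r s m n \<tau> =
      (LINT y|lborel_m m. (\<Sum>a<m. detp m ?f y * detp m (?g a) y * ?W y * ?C y))"
    unfolding jmode_moment_def by (subst integral_mult_right_zero[symmetric]) simp
  also have "\<dots> = (\<Sum>a<m. LINT y|lborel_m m. detp m ?f y * detp m (?g a) y * ?W y * ?C y)"
    by (intro Bochner_Integration.integral_sum integrable_detp_detp)
  also have "\<dots> = (\<Sum>a<m. detf m (jmatrix r s m n \<tau> a))"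
    unfolding andreief jmatrix_def[abs_def] wint_def by simp
  finally show ?thesis using jlead_nonzero[of r s m] by (simp add: field_simps)
qed

lemma detf_zero_column:
  assumes "j < m" "\<And>i. i < m \<Longrightarrow> F i j = 0"
  shows "detf m F = 0"
proof -
  have "(\<Prod>i<m. F (p i) i) = 0" if "p permutes {..<m}" for p
    using assms permutes_in_image[OF that, of j] by (intro prod_zero) auto
  then show ?thesis
    unfolding detf_transpose[of m F] by (auto simp only: detf_leibniz mult_zero_right sum.neutral_const mem_Collect_eq intro!: sum.neutral)
qed

lemma jmatrix_orthogonal:
  assumes "j \<noteq> a"
  shows "jmatrix r s m n \<tau> a i j = (if jshift m \<tau> i = m - Suc j then jnorm2 r s (jshift m \<tau> i) else 0)"
  using assms by (simp add: jmatrix_def wint_jpoly_orthogonal jnorm2_def)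

lemma detf_jmatrix_eq_0:
  assumes "j < m" "j \<noteq> a" "\<And>i. i < m \<Longrightarrow> jshift m \<tau> i \<noteq> m - Suc j"
  shows "detf m (jmatrix r s m n \<tau> a) = 0"
  using assms by (intro detf_zero_column[of j]) (auto simp: jmatrix_orthogonal)

lemma jshift_strict_antimono:
  assumes "\<tau> \<in> partitions" "i < j" "j < m"
  shows "jshift m \<tau> j < jshift m \<tau> i"
proof -
  have "part \<tau> (Suc j) \<le> part \<tau> (Suc i)"
    using assms unfolding partitions_def part_def by (auto dest: sorted_wrt_nth_less)
  then show ?thesis using assms by (simp add: jshift_eq)
qed

text \<open>A pigeonhole argument: \<open>\<tau>\<^sub>2 \<ge> 2\<close> pushes two degrees to at
  least \<open>m\<close>, leaving at most \<open>m - 2\<close> rows to match the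
  \<open>m - 1\<close> unaltered columns. An unmatched column is zero by orthogonality.\<close>

lemma jmode_moment_non_hook:
  assumes "2 \<le> part \<tau> 2" and \<tau>: "\<tau> \<in> partitions" "length \<tau> \<le> m"
  shows "jmode_moment r s m n \<tau> = 0"
proof -
  have m: "2 \<le> m" using assms by (auto simp: part_def split: if_splits)
  have 1: "m \<le> jshift m \<tau> 1" using assms m by (simp add: jshift_def numeral_2_eq_2)
  then have 0: "m \<le> jshift m \<tau> 0" using jshift_strict_antimono[OF \<tau>(1), of 0 1 m] m by simp
  have "detf m (jmatrix r s m n \<tau> a) = 0" if a: "a < m" for a
  proof -
    \<comment> \<open>\<open>?K\<close> holds the degrees of the unaltered columns,
      \<open>?J\<close> those of the rows from the third on. The degree \<open>K\<close> belongs to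
      the column \<open>m - Suc K\<close>.\<close>
    let ?K = "{..<m} - {m - Suc a}" and ?J = "jshift m \<tau> ` {2..<m}"
    have "card ?J \<le> m - 2" using card_image_le[of "{2..<m}" "jshift m \<tau>"] by simp
    moreover have "card ?K = m - 1" using a by simp
    ultimately have "\<not> ?K \<subseteq> ?J" using card_mono[of ?J ?K] m by auto
    then obtain K where K: "K < m" "K \<noteq> m - Suc a" "K \<notin> ?J" by auto
    show ?thesis
    proof (rule detf_jmatrix_eq_0[of "m - Suc K"])
      show "m - Suc K < m" "m - Suc K \<noteq> a" using K a by auto
      fix i assume i: "i < m"
      show "jshift m \<tau> i \<noteq> m - Suc (m - Suc K)"
      proof (cases "2 \<le> i")
        case True
        then have "jshift m \<tau> i \<in> ?J" using i by auto
        then show ?thesis using K by auto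
      next
        case False
        then have "i = 0 \<or> i = 1" by auto
        then show ?thesis using 0 1 K by auto
      qed
    qed
  qed
  then show ?thesis by (simp add: jmode_moment_eq)
qed

section \<open>Coefficients of the hook partitions\<close>

lemma prod_insert_index:
  assumes "a \<le> n"
  shows "(\<Prod>i<Suc n. F i) = F a * (\<Prod>i<n. F (insert_index a i))"
proof -
  have "(\<Prod>i<n. F (insert_index a i)) = (\<Prod>i\<in>{..<Suc n} - {a}. F i)"
    by (rule prod.reindex_bij_witness[of _ "delete_index a" "insert_index a"])
       (use assms in \<open>auto simp: insert_index_def delete_index_def\<close>)
  then show ?thesis using assms by (simp add: prod.remove[of "{..<Suc n}" a] del: prod.lessThan_Suc)
qed

text \<open>\<open>insert_index a\<close> lists the indices other than \<open>a\<close>. Once the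
  differences involving position \<open>a\<close> are split off, a hook and the empty partition
  leave the same smaller Vandermonde product.\<close>

lemma vdm_extract:
  assumes a: "a \<le> n"
  shows "vdm (Suc n) w = (\<Prod>i<a. w i - w a) * (\<Prod>j=a..<n. w a - w (Suc j)) * vdm n (\<lambda>i. w (insert_index a i))"
proof -
  let ?ins = "insert_index a"
  have inner: "(\<Prod>i<?ins j. w i - w (?ins j)) = (if a \<le> j then w a - w (Suc j) else 1) * (\<Prod>i<j. w (?ins i) - w (?ins j))"
    if "j < n" for j
  proof (cases "a \<le> j")
    case True
    then have "?ins j = Suc j" by (simp add: insert_index_def)
    then show ?thesis using True prod_insert_index[OF True, of "\<lambda>i. w i - w (Suc j)"] by simp
  next
    case False
    then have "?ins i = i" if "i \<le> j" for i using that by (simp add: insert_index_def)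
    then show ?thesis using False by simp
  qed
  have "vdm (Suc n) w = (\<Prod>i<a. w i - w a) * (\<Prod>j<n. \<Prod>i<?ins j. w i - w (?ins j))"
    unfolding vdm_def by (rule prod_insert_index[OF a])
  also have "(\<Prod>j<n. \<Prod>i<?ins j. w i - w (?ins j)) =
      (\<Prod>j<n. if a \<le> j then w a - w (Suc j) else 1) * vdm n (\<lambda>i. w (?ins i))"
    using inner by (simp add: vdm_def prod.distrib)
  also have "(\<Prod>j<n. if a \<le> j then w a - w (Suc j) else 1) = (\<Prod>j=a..<n. w a - w (Suc j))"
    by (subst prod.inter_filter[symmetric]) (auto intro!: prod.cong)
  finally show ?thesis by simp
qed

lemma jeig_diff: "jeig r s k - jeig r s l = (real k - real l) * (real k + real l + real r + real s + 1)"
  unfolding jeig_def by (simp add: algebra_simps)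

lemma prod_diff_fact: "m \<le> L \<Longrightarrow> (\<Prod>j<m. real L - real j) = fact L / fact (L - m)"
proof (induction m)
  case (Suc m)
  then have "L - m = Suc (L - Suc m)" by simp
  then have "(fact (L - m) :: real) = (real L - real m) * fact (L - Suc m)"
    using Suc.prems by (simp add: of_nat_diff)
  moreover have "real L - real m \<noteq> 0" using Suc.prems by simp
  ultimately show ?case using Suc.IH Suc.prems by simp
qed simp

lemma prod_plus_fact: "(\<Prod>j<m. real c + real j + 1) = fact (c + m) / fact c"
  unfolding pochhammer_eq_fact[symmetric] pochhammer_prod by (simp add: lessThan_atLeast0 add_ac)

lemma prod_jeig_below:
  assumes "m \<le> L"
  shows "(\<Prod>j<m. jeig r s L - jeig r s j) = fact L / fact (L - m) * (fact (L + m + r + s) / fact (L + r + s))"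
  unfolding jeig_diff prod.distrib prod_diff_fact[OF assms]
  using prod_plus_fact[of "L + r + s" m] by (simp add: add_ac)

lemma prod_jeig_above:
  "(\<Prod>l<a. jeig r s (Suc (A + l)) - jeig r s A) =
     fact a * (fact (2 * A + r + s + 1 + a) / fact (2 * A + r + s + 1))"
proof -
  have "(\<Prod>l<a. jeig r s (Suc (A + l)) - jeig r s A) =
      (\<Prod>l<a. (real 0 + real l + 1) * (real (2 * A + r + s + 1) + real l + 1))"
    unfolding jeig_diff by (rule prod.cong) (auto simp: algebra_simps)
  then show ?thesis unfolding prod.distrib prod_plus_fact by simp
qed

text \<open>Here \<open>n = m - 1\<close>, and \<open>k\<close> arises from \<open>n, n - 1, \<dots>, 0\<close> by replacing
  the entry \<open>A\<close> at position \<open>a\<close> with \<open>L\<close> and moving it to the front.\<close>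

lemma jvalue_hook:
  assumes n: "n = a + A" and L: "n < L"
    and k0: "k 0 = L" and k: "\<And>i. i < n \<Longrightarrow> k (Suc i) = n - insert_index a i"
  shows "jvalue r s (Suc n) k * ((real L - real A) * (real L + real A + real r + real s + 1)) * poly (jpoly r s A) 1 *
      (fact a * (fact (2 * A + r + s + 1 + a) / fact (2 * A + r + s + 1))) *
      (fact A * (fact (2 * A + r + s) / fact (A + r + s))) =
    jvalue r s (Suc n) (\<lambda>i. n - i) * poly (jpoly r s L) 1 *
      (fact L / fact (L - Suc n) * (fact (L + Suc n + r + s) / fact (L + r + s)))"
proof -
  let ?K = "\<lambda>i. n - i" and ?ins = "insert_index a"
  let ?R = "\<Prod>i<n. poly (jpoly r s (n - ?ins i)) 1"
  let ?D = "vdm n (\<lambda>i. jeig r s (n - ?ins i))"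
  have an: "a \<le> n" using n by simp
  have KA: "n - a = A" using n by simp
  \<comment> \<open>\<open>?R\<close> and \<open>?D\<close> run over the degrees common to both
    sequences. They recur in \<open>v2\<close> and therefore need no evaluation.\<close>
  have v1: "jvalue r s (Suc n) k = jconst s (Suc n) * (poly (jpoly r s L) 1 * ?R) *
      ((\<Prod>i<n. jeig r s L - jeig r s (n - ?ins i)) * ?D)"
  proof -
    have "(\<Prod>i<Suc n. poly (jpoly r s (k i)) 1) = poly (jpoly r s L) 1 * ?R"
      unfolding prod.lessThan_Suc_shift by (simp add: k0 k)
    moreover have "vdm (Suc n) (\<lambda>i. jeig r s (k i)) = (\<Prod>i<n. jeig r s L - jeig r s (n - ?ins i)) * ?D"
      unfolding vdm_extract[of 0 n, OF le0]
      by (simp add: k0 k vdm_def lessThan_atLeast0)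
    ultimately show ?thesis by (simp only: jvalue_def)
  qed
  have v2: "jvalue r s (Suc n) ?K = jconst s (Suc n) * (poly (jpoly r s A) 1 * ?R) *
      ((\<Prod>i<a. jeig r s (n - i) - jeig r s A) * (\<Prod>j=a..<n. jeig r s A - jeig r s (n - Suc j)) * ?D)"
    unfolding jvalue_def prod_insert_index[OF an, of "\<lambda>i. poly (jpoly r s (n - i)) 1"]
      vdm_extract[OF an, of "\<lambda>i. jeig r s (n - i)"] KA ..
  \<comment> \<open>Multiplying by the absent difference \<open>jeig r s L - jeig r s A\<close>
    completes the product to all degrees \<open>0, ..., n\<close>, which has a closed form.\<close>
  have p1: "(\<Prod>i<n. jeig r s L - jeig r s (n - ?ins i)) * ((real L - real A) * (real L + real A + real r + real s + 1)) =
      fact L / fact (L - Suc n) * (fact (L + Suc n + r + s) / fact (L + r + s))"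
  proof -
    have "(\<Prod>i<n. jeig r s L - jeig r s (n - ?ins i)) * ((real L - real A) * (real L + real A + real r + real s + 1)) =
       (\<Prod>i<Suc n. jeig r s L - jeig r s (n - i))"
      unfolding prod_insert_index[OF an, of "\<lambda>i. jeig r s L - jeig r s (n - i)"] KA jeig_diff[of r s L A] by simp
    also have "\<dots> = (\<Prod>j<Suc n. jeig r s L - jeig r s j)"
      by (rule prod.reindex_bij_witness[of _ "\<lambda>i. n - i" "\<lambda>i. n - i"]) auto
    finally show ?thesis using prod_jeig_below[of "Suc n" L r s] L by simp
  qed
  have p2: "(\<Prod>i<a. jeig r s (n - i) - jeig r s A) =
      fact a * (fact (2 * A + r + s + 1 + a) / fact (2 * A + r + s + 1))"
    unfolding prod_jeig_above[symmetric]
    by (rule prod.reindex_bij_witness[of _ "\<lambda>i. a - Suc i" "\<lambda>i. a - Suc i"])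
       (auto simp: n Suc_diff_Suc add.commute)
  have p3: "(\<Prod>j=a..<n. jeig r s A - jeig r s (n - Suc j)) = fact A * (fact (2 * A + r + s) / fact (A + r + s))"
  proof -
    have "(\<Prod>j=a..<n. jeig r s A - jeig r s (n - Suc j)) = (\<Prod>j<A. jeig r s A - jeig r s j)"
      by (rule prod.reindex_bij_witness[of _ "\<lambda>i. n - Suc i" "\<lambda>i. n - Suc i"]) (auto simp: n)
    then show ?thesis using prod_jeig_below[of A A r s] by (simp add: mult_2)
  qed
  show ?thesis
    unfolding v1 v2 p1[symmetric] p2[symmetric] p3[symmetric] by (simp only: mult_ac)
qed

lemma jcoef_fact:
  "jcoef r s (j + e) j = (-1) ^ j * (fact (r + j + e) * fact (j + e + r + s + j) /
     (fact e * fact (j + e + r + s) * fact (r + j) * fact j))"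
proof -
  have 1: "pochhammer (- real (j + e)) j = (-1) ^ j * (fact (j + e) / fact e)"
    using pochhammer_minus[of "real (j + e)" j] pochhammer_eq_fact[of e j] by (simp add: add_ac)
  have 2: "pochhammer (real (j + e) + real r + real s + 1) j = fact (j + e + r + s + j) / fact (j + e + r + s)"
    using pochhammer_eq_fact[of "j + e + r + s" j] by simp
  have alg: "R1 / R / F * (g * (F / E) * (X / Y) / (R2 / R * J)) = g * (R1 * X / (E * Y * R2 * J))"
    if "R \<noteq> 0" "F \<noteq> 0" for R1 R F g E X Y R2 J :: real
    using that by (simp add: mult_ac)
  show ?thesis
    unfolding jcoef_def 1 2 pochhammer_eq_fact[of r] add.assoc[of r j e] by (rule alg) simp_all
qed

lemma Gamma_eq_fact: "x = 1 + real N \<Longrightarrow> Gamma x = fact N"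
  using Gamma_fact[of N, where ?'a = real] by simp

text \<open>Here \<open>t + 1\<close> is the first part of \<tau>, \<open>f\<close> is the excess of
  the first part of \<alpha>, and \<open>L\<close> is the largest degree. With these parameters no
  truncated subtraction occurs and every Gamma argument is visibly a positive integer.\<close>

lemma V_coeff_fact:
  assumes "m + t = L"
  shows "V_coeff r s m (t + 1 + f) (t + 1) =
    (2 * real L + real r + real s + 1) * fact (L + m + r + s) * fact (L + f) * fact (L + f + r) * fact (L + s) /
     (fact f * fact t * fact (2 * L + f + r + s + 1) * fact (L + r))"
proof -
  have "Gamma (real (t + 1) + 2 * real m + real r + real s) = fact (L + m + r + s)"
    "Gamma (real (t + 1 + f) + real m) = fact (L + f)"
    "Gamma (real r + real (t + 1 + f) + real m) = fact (L + f + r)"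
    "Gamma (real (t + 1) + real m + real s) = fact (L + s)"
    "Gamma (real r + real s + real (t + 1 + f) + real (t + 1) + 2 * real m) = fact (2 * L + f + r + s + 1)"
    "Gamma (real r + real (t + 1) + real m) = fact (L + r)"
    by (rule Gamma_eq_fact, use assms in simp)+
  note g = this
  have "real r + real s + 2 * real (t + 1) + 2 * real m - 1 = 2 * real L + real r + real s + 1"
    "t + 1 + f - (t + 1) = f" "t + 1 - 1 = t"
    using assms by auto
  then show ?thesis unfolding V_coeff_def g by simp
qed

text \<open>Here \<open>a + 1\<close> and \<open>a + 1 + e\<close> are the lengths of \<tau> and
  \<alpha>, \<open>j = m - l(\<alpha>)\<close> is the exponent belonging to \<alpha>, and
  \<open>j + e = m - l(\<tau>)\<close> is the degree absent from \<tau>.\<close>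

lemma U_coeff_fact:
  assumes "m = a + j + e + 1"
  shows "U_coeff r s m (a + 1 + e) (a + 1) =
    (2 * real (j + e) + real r + real s + 1) * fact (r + j + e) * fact (j + e + r + s + j) /
     (fact e * fact a * fact j * fact (r + j) * fact (j + e + s) * fact (m + (j + e) + r + s))"
proof -
  have "Gamma (real r + real m - real (a + 1) + 1) = fact (r + j + e)"
    "Gamma (real r + real s + 2 * real m - real (a + 1 + e) - real (a + 1) + 1) = fact (j + e + r + s + j)"
    "Gamma (real m - real (a + 1 + e) + 1) = fact j"
    "Gamma (real r + real m - real (a + 1 + e) + 1) = fact (r + j)"
    "Gamma (real m + real s - real (a + 1) + 1) = fact (j + e + s)"
    "Gamma (2 * real m + real r + real s - real (a + 1) + 1) = fact (m + (j + e) + r + s)"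
    by (rule Gamma_eq_fact, use assms in simp)+
  note g = this
  have "2 * real m + real r + real s + 1 - 2 * real (a + 1) = 2 * real (j + e) + real r + real s + 1"
    "a + 1 + e - (a + 1) = e" "a + 1 - 1 = a"
    using assms by auto
  then show ?thesis unfolding U_coeff_def g by simp
qed

text \<open>\<open>E\<close> is the ratio of the values at \<open>1, ..., 1\<close> for the hook and
  for the empty partition, given only through the equation of \<open>jvalue_hook\<close>. The left
  side is the term of \<open>u^j\<close> in the expansion of degree \<open>A\<close>; on the right
  \<open>a + e = l(\<alpha>) - 1 = n - \<alpha>\<^sub>1\<close>.\<close>

lemma hook_coefficient:
  assumes A: "A = j + e" and m: "m = a + A + 1" and L: "L = m + t"
    and E: "E * ((real L - real A) * (real L + real A + real r + real s + 1)) * poly (jpoly r s A) 1 *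
      (fact a * (fact (2 * A + r + s + 1 + a) / fact (2 * A + r + s + 1))) *
      (fact A * (fact (2 * A + r + s) / fact (A + r + s))) =
    poly (jpoly r s L) 1 *
      (fact L / fact t * (fact (L + m + r + s) / fact (L + r + s)))"
  shows "(-1) ^ a * E * (jcoef r s A j * wint r s (monom 1 (L + f) * jpoly r s L)) / jnorm2 r s L =
    (-1) ^ (a + e) * (V_coeff r s m (t + 1 + f) (t + 1) * U_coeff r s m (a + 1 + e) (a + 1) /
      ((real r + real s + real (t + 1) + 2 * real m - real (a + 1)) * (real (t + 1) + real (a + 1) - 1)))"
proof -
  define d1 d2 where "d1 = real L - real A" and "d2 = real L + real A + real r + real s + 1"
  have d: "d1 \<noteq> 0" "d2 \<noteq> 0" using L m by (auto simp: d1_def d2_def)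
  have den: "real r + real s + real (t + 1) + 2 * real m - real (a + 1) = d2"
    "real (t + 1) + real (a + 1) - 1 = d1"
    unfolding d1_def d2_def L m by simp_all
  have f1: "(fact (2 * A + r + s + 1) :: real) = (2 * real A + real r + real s + 1) * fact (2 * A + r + s)"
    by simp
  have f2: "2 * A + r + s + 1 + a = m + A + r + s" using m by simp
  define c where "c = 2 * real A + real r + real s + 1"
  have c: "c \<noteq> 0" unfolding c_def by (simp add: add_nonneg_eq_0_iff)
  have E': "E = (-1) ^ L * (-1) ^ A * (fact (L + s) * fact (L + m + r + s) * c * fact (A + r + s) /
      (fact (A + s) * fact t * fact (L + r + s) * fact a * fact (m + A + r + s) * (d1 * d2)))"
  proof -
    \<comment> \<open>The factorials become free nonzero variables, so solving for \<open>E\<close>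
      is a purely rational identity; \<open>gA * gA = 1\<close> moves the sign across.\<close>
    have alg: "E = gL * gA * (SL * X * c' * Y / (SA * T * Z * a' * W * (d1 * d2)))"
      if "E * (d1 * d2) * (gA * (SA / (S * FA))) * (a' * (W / (c' * H))) * (FA * (H / Y)) =
        gL * (SL / (S * FL)) * (FL / T * (X / Z))"
        "gA * gA = 1" "SA \<noteq> 0" "S \<noteq> 0" "FA \<noteq> 0" "a' \<noteq> 0" "W \<noteq> 0" "c' \<noteq> 0" "H \<noteq> 0" "Y \<noteq> 0" "FL \<noteq> 0" "T \<noteq> 0" "Z \<noteq> 0"
      for gA gL SA S FA a' W c' H Y SL FL T X Z :: real
    proof -
      have "gA \<noteq> 0" using that(2) by auto
      have "E * (d1 * d2) * gA * (SA * a' * W / (S * c' * Y)) = gL * (SL * X / (S * T * Z))"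
        using that by (simp add: field_simps)
      then have "E * gA = gL * (SL * X / (S * T * Z)) / ((d1 * d2) * (SA * a' * W / (S * c' * Y)))"
        using that d by (simp add: field_simps)
      from arg_cong[OF this, of "\<lambda>z. z * gA"]
      have "E * (gA * gA) = gL * (SL * X / (S * T * Z)) / ((d1 * d2) * (SA * a' * W / (S * c' * Y))) * gA"
        by (simp only: mult.assoc)
      then show ?thesis using that d by (simp add: field_simps)
    qed
    have "(-1 :: real) ^ A * (-1) ^ A = 1" by (simp flip: power_mult_distrib)
    from alg[OF E[unfolded jpoly_at_1 f1 f2 c_def[symmetric] d1_def[symmetric] d2_def[symmetric]] this]
    show ?thesis using c by (simp add: add.commute[of s])
  qed
  have w: "wint r s (monom 1 (L + f) * jpoly r s L) = (-1) ^ L * fact (L + f) / (fact f * fact L) *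
      (fact (L + f + r) * fact (L + s) / fact (2 * L + f + r + s + 1))"
  proof -
    have "L + f + r + s + L + 1 = 2 * L + f + r + s + 1" "L + f - L = f" by simp_all
    note e = this
    show ?thesis
      using wint_monom_jpoly[of L "L + f" r s, OF le_add1] unfolding e add.commute[of s L] .
  qed
  have h: "1 / jnorm2 r s L = (2 * real L + real r + real s + 1) * fact L * fact (L + r + s) / (fact (L + r) * fact (L + s))"
    by (simp add: jnorm2_eq)
  \<comment> \<open>The signs come from the cofactor (\<open>a\<close>), the values at 1
    (\<open>L\<close> and \<open>A\<close>), the coefficient of \<open>u^j\<close>
    (\<open>j\<close>) and the inner product (\<open>L\<close>). With \<open>A = j + e\<close> only
    \<open>a + e\<close> survives modulo 2.\<close>
  have sgn: "(-1) ^ a * ((-1) ^ L * (-1) ^ A) * ((-1) ^ j * (-1) ^ L) = (-1 :: real) ^ (a + e)"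
  proof -
    have "(-1) ^ a * ((-1) ^ L * (-1) ^ A) * ((-1) ^ j * (-1) ^ L) = (-1 :: real) ^ (a + e + 2 * (L + j))"
      unfolding A by (simp only: power_add[symmetric]) (rule arg_cong[of _ _ "power (-1)"], simp)
    then show ?thesis by (simp add: power_add power_mult)
  qed
  have alg: "ga * (gL * gA * (SL * X * c' * Y / (SA * T * Z * a' * W * D))) *
       (gj * (B * C / (e' * Y * R * J)) * (gL' * Lf / (f' * FL) * (G * SL / Q))) * (l * FL * Z / (K * SL)) =
     (ga * (gL * gA) * (gj * gL')) * ((l * X * Lf * G * SL / (f' * T * Q * K)) *
        (c' * B * C / (e' * a' * J * R * SA * W)) / D)"
    if "Y \<noteq> 0" "SL \<noteq> 0" "Z \<noteq> 0" "FL \<noteq> 0"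
    for ga gL gA SL X c' Y SA T Z a' W D gj B C e' R J gL' Lf f' FL G Q l K :: real
    using that by simp (simp only: mult_ac)
  have V: "V_coeff r s m (t + 1 + f) (t + 1) =
    (2 * real L + real r + real s + 1) * fact (L + m + r + s) * fact (L + f) * fact (L + f + r) * fact (L + s) /
     (fact f * fact t * fact (2 * L + f + r + s + 1) * fact (L + r))"
    by (rule V_coeff_fact) (simp add: L)
  have U: "U_coeff r s m (a + 1 + e) (a + 1) = c * fact (r + A) * fact (A + r + s + j) /
     (fact e * fact a * fact j * fact (r + j) * fact (A + s) * fact (m + A + r + s))"
    using U_coeff_fact[of m a j e r s] m unfolding A c_def by (simp add: add.assoc)
  have jc: "jcoef r s A j = (-1) ^ j * (fact (r + A) * fact (A + r + s + j) /
     (fact e * fact (A + r + s) * fact (r + j) * fact j))"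
    unfolding A jcoef_fact by (simp add: add.assoc)
  have "(-1) ^ a * E * (jcoef r s A j * wint r s (monom 1 (L + f) * jpoly r s L)) / jnorm2 r s L =
     (-1) ^ a * E * (jcoef r s A j * wint r s (monom 1 (L + f) * jpoly r s L)) * (1 / jnorm2 r s L)" by simp
  also have "\<dots> = (-1) ^ (a + e) * (V_coeff r s m (t + 1 + f) (t + 1) * U_coeff r s m (a + 1 + e) (a + 1) / (d1 * d2))"
    unfolding E' h w sgn[symmetric] V U jc by (rule alg) simp_all
  finally show ?thesis unfolding den by (simp only: mult.commute[of d2])
qed

section \<open>Traces and ordered eigenvalues\<close>

lemma mat_trace_mult_comm:
  assumes "A \<in> carrier_mat n k" "B \<in> carrier_mat k n"
  shows "mat_trace (A * B) = mat_trace (B * A)"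
proof -
  have "mat_trace (A * B) = (\<Sum>i<n. \<Sum>j<k. A $$ (i, j) * B $$ (j, i))"
    using assms by (simp add: mat_trace_def scalar_prod_def lessThan_atLeast0)
  also have "\<dots> = (\<Sum>j<k. \<Sum>i<n. B $$ (j, i) * A $$ (i, j))"
    by (subst sum.swap) (simp add: mult.commute)
  also have "\<dots> = mat_trace (B * A)"
    using assms by (simp add: mat_trace_def scalar_prod_def lessThan_atLeast0)
  finally show ?thesis .
qed

lemma mat_trace_similar:
  assumes A: "A \<in> carrier_mat n n" and sim: "similar_mat_wit A B P Q"
  shows "mat_trace A = mat_trace B"
proof -
  note d = similar_mat_witD2[OF A sim]
  have "mat_trace A = mat_trace (P * (B * Q))"
    using d by (simp add: assoc_mult_mat[of _ n n _ n _ n])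
  also have "\<dots> = mat_trace ((B * Q) * P)"
    using d by (intro mat_trace_mult_comm[of _ n n]) auto
  also have "(B * Q) * P = B * (Q * P)"
    using d by (intro assoc_mult_mat) auto
  also have "\<dots> = B" using d by simp
  finally show ?thesis .
qed

lemma upper_triangular_mult_diag:
  assumes A: "A \<in> carrier_mat n n" "upper_triangular A" and B: "B \<in> carrier_mat n n" "upper_triangular B"
  shows "upper_triangular (A * B)" and "i < n \<Longrightarrow> (A * B) $$ (i, i) = A $$ (i, i) * (B $$ (i, i) :: complex)"
proof -
  have e: "(A * B) $$ (i, j) = (\<Sum>l<n. A $$ (i, l) * B $$ (l, j))" if "i < n" "j < n" for i j
    using that A B by (simp add: scalar_prod_def lessThan_atLeast0)
  have z: "A $$ (i, l) * B $$ (l, j) = 0" if "i < n" "j < n" "l < n" "l < i \<or> j < l" for i j l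
    using that A B unfolding upper_triangular_def by auto
  show "upper_triangular (A * B)"
    unfolding upper_triangular_def
  proof (intro allI impI)
    fix i j assume "i < dim_row (A * B)" "j < i"
    then have ij: "i < n" "j < n" "j < i" using A by auto
    then show "(A * B) $$ (i, j) = 0"
      unfolding e[OF ij(1,2)] by (intro sum.neutral ballI z) auto
  qed
  show "(A * B) $$ (i, i) = A $$ (i, i) * B $$ (i, i)" if i: "i < n"
  proof -
    have "(\<Sum>l<n. A $$ (i, l) * B $$ (l, i)) = (\<Sum>l\<in>{i}. A $$ (i, l) * B $$ (l, i))"
      using i by (intro sum.mono_neutral_right ballI z) auto
    then show ?thesis by (simp add: e[OF i i])
  qed
qed

lemma upper_triangular_pow_diag:
  assumes B: "B \<in> carrier_mat n n" "upper_triangular B"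
  shows "upper_triangular (B ^\<^sub>m k) \<and> (\<forall>i<n. (B ^\<^sub>m k) $$ (i, i) = (B $$ (i, i) :: complex) ^ k)"
proof (induction k)
  case 0
  then show ?case using B by (auto simp: upper_triangular_def)
next
  case (Suc k)
  have "B ^\<^sub>m k \<in> carrier_mat n n" using B by simp
  then show ?case
    using Suc upper_triangular_mult_diag[of "B ^\<^sub>m k" n B] B by (simp add: mult.commute)
qed

lemma complex_poly_linear_factors:
  fixes p :: "complex poly"
  assumes "monic p"
  shows "\<exists>es. p = (\<Prod>a\<leftarrow>es. [:- a, 1:])"
proof -
  obtain es where es: "mset es = proots p" using ex_mset by blast
  have "p = (\<Prod>x\<in>#proots p. [:- x, 1:])"
    using complex_poly_decompose_multiset[of p] assms by simp
  also have "\<dots> = (\<Prod>a\<leftarrow>es. [:- a, 1:])"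
    unfolding es[symmetric] mset_map[symmetric] prod_mset_prod_list ..
  finally show ?thesis ..
qed

lemma proots_linear_factors: "proots (\<Prod>a\<leftarrow>es. [:- a, 1:]) = mset es" for es :: "complex list"
proof (induction es)
  case (Cons a es)
  have "(\<Prod>a\<leftarrow>es. [:- a, 1:]) \<noteq> 0" by (auto simp: prod_list_zero_iff)
  then have "proots ([:- a, 1:] * (\<Prod>a\<leftarrow>es. [:- a, 1:])) = proots [:- a, 1:] + mset es"
    by (subst proots_mult) (simp_all add: Cons)
  also have "proots [:- a, 1:] = {#a#}"
    by (rule multiset_eqI) (simp add: order_linear')
  finally show ?case by simp
qed simp

text \<open>By Schur's theorem \<open>A\<close> is similar to an upper triangular \<open>B\<close>.
  The diagonal of \<open>B\<close> lists the roots of the characteristic polynomial with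
  multiplicity, and the diagonal of its powers the powers of these.\<close>

lemma mat_trace_pow_eq_sum_eigenvalues:
  assumes A: "A \<in> carrier_mat n n"
  shows "mat_trace (A ^\<^sub>m k) = (\<Sum>x\<in>#proots (char_poly A). x ^ k)"
    and "size (proots (char_poly A)) = n"
proof -
  obtain es where es: "char_poly A = (\<Prod>a\<leftarrow>es. [:- a, 1:])"
    using complex_poly_linear_factors degree_monic_char_poly[OF A] by blast
  obtain B where B: "B \<in> carrier_mat n n" "upper_triangular B" "similar_mat A B"
    using schur_decomposition_exists[OF A es] by blast
  then obtain P Q where PQ: "similar_mat_wit A B P Q" by (auto simp: similar_mat_def)
  have "char_poly A = (\<Prod>a\<leftarrow>diag_mat B. [:- a, 1:])"
    using char_poly_similar[OF B(3)] char_poly_upper_triangular[OF B(1,2)] by simp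
  also have "proots \<dots> = mset (diag_mat B)"
    by (rule proots_linear_factors)
  finally have roots: "proots (char_poly A) = mset (diag_mat B)" .
  have "mat_trace (A ^\<^sub>m k) = mat_trace (B ^\<^sub>m k)"
    using A by (intro mat_trace_similar[of _ n, OF _ similar_mat_wit_pow[OF PQ]]) simp
  also have "\<dots> = (\<Sum>i<n. (B $$ (i, i)) ^ k)"
    using upper_triangular_pow_diag[OF B(1,2), of k] B(1) by (simp add: mat_trace_def)
  also have "\<dots> = (\<Sum>x\<in>#mset (diag_mat B). x ^ k)"
    using B(1) by (simp add: diag_mat_def sum_mset_sum_list sum_list_sum_nth lessThan_atLeast0 flip: mset_map)
  finally show "mat_trace (A ^\<^sub>m k) = (\<Sum>x\<in>#proots (char_poly A). x ^ k)" by (simp add: roots)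
  show "size (proots (char_poly A)) = n"
    using degree_monic_char_poly[OF A] by (simp add: size_proots_complex)
qed

lemma mat_adjoint_index:
  "i < dim_col C \<Longrightarrow> j < dim_row C \<Longrightarrow> mat_adjoint C $$ (i, j) = cnj (C $$ (j, i))"
  by (simp add: mat_adjoint_def mat_of_rows_def conjugate_complex_def)

lemma mat_adjoint_carrier: "C \<in> carrier_mat n k \<Longrightarrow> mat_adjoint C \<in> carrier_mat k n"
  unfolding mat_adjoint_def by auto

text \<open>For an eigenvector \<open>v\<close> with eigenvalue \<open>x\<close>, the squared norm
  of \<open>v\<close> times \<open>x\<close> is the squared norm of \<open>w\<close>, the adjoint of
  \<open>C\<close> applied to \<open>v\<close>.\<close>

lemma eigenvalue_gram_real:
  fixes C :: "complex mat"
  assumes C: "C \<in> carrier_mat n k" and ev: "eigenvalue (C * mat_adjoint C) x"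
  shows "Im x = 0"
proof -
  have adj: "mat_adjoint C \<in> carrier_mat k n" using C by (rule mat_adjoint_carrier)
  obtain v where v: "v \<in> carrier_vec n" "v \<noteq> 0\<^sub>v n" "(C * mat_adjoint C) *\<^sub>v v = x \<cdot>\<^sub>v v"
    using ev C by (auto simp: eigenvalue_def eigenvector_def)
  define w where "w l = (\<Sum>j<n. cnj (C $$ (j, l)) * v $ j)" for l
  have Cv: "x * v $ i = (\<Sum>l<k. C $$ (i, l) * w l)" if i: "i < n" for i
  proof -
    have "x * v $ i = ((C * mat_adjoint C) *\<^sub>v v) $ i" using v i by simp
    also have "\<dots> = (\<Sum>l<k. C $$ (i, l) * w l)"
      using i C adj v(1)
      by (simp add: assoc_mult_mat_vec scalar_prod_def lessThan_atLeast0 mat_adjoint_index w_def)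
    finally show ?thesis .
  qed
  have "x * (\<Sum>i<n. v $ i * cnj (v $ i)) = (\<Sum>i<n. (\<Sum>l<k. C $$ (i, l) * w l) * cnj (v $ i))"
    unfolding sum_distrib_left by (rule sum.cong) (simp_all add: Cv flip: mult.assoc)
  also have "\<dots> = (\<Sum>l<k. w l * (\<Sum>i<n. C $$ (i, l) * cnj (v $ i)))"
    unfolding sum_distrib_left sum_distrib_right by (subst sum.swap) (simp add: mult_ac)
  also have "\<dots> = (\<Sum>l<k. w l * cnj (w l))"
    by (simp add: w_def)
  finally have eq: "x * (\<Sum>i<n. v $ i * cnj (v $ i)) = (\<Sum>l<k. w l * cnj (w l))" .
  have sq: "z * cnj z = of_real ((cmod z)\<^sup>2)" for z
    by (rule complex_norm_square[symmetric])
  obtain i where "i < n" "v $ i \<noteq> 0"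
    using v(1,2) by (metis carrier_vecD eq_vecI index_zero_vec(1) index_zero_vec(2))
  then have pos: "0 < (\<Sum>i<n. (cmod (v $ i))\<^sup>2)"
    by (intro sum_pos2[of _ i]) auto
  have "x * of_real (\<Sum>i<n. (cmod (v $ i))\<^sup>2) = of_real (\<Sum>l<k. (cmod (w l))\<^sup>2)"
    using eq unfolding sq of_real_sum .
  then have "Im (x * of_real (\<Sum>i<n. (cmod (v $ i))\<^sup>2)) = 0" by simp
  then show ?thesis using pos by simp
qed

text \<open>Real eigenvalues lose nothing under \<open>Re\<close>, and a sum of powers does not see
  the ordering.\<close>

lemma sum_ordered_eigenvalues:
  assumes A: "A \<in> carrier_mat m m" and real: "\<And>x. eigenvalue A x \<Longrightarrow> Im x = 0"
  shows "mat_trace (A ^\<^sub>m n) = complex_of_real (\<Sum>i=1..m. ordered_eigenvalues m A i ^ n)"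
proof -
  let ?R = "proots (char_poly A)"
  define xs where "xs = rev (sorted_list_of_multiset (image_mset Re ?R))"
  have mxs: "mset xs = image_mset Re ?R" by (simp add: xs_def)
  have len: "length xs = m"
    using mat_trace_pow_eq_sum_eigenvalues(2)[OF A] arg_cong[OF mxs, of size] by simp
  have nz: "char_poly A \<noteq> 0" using degree_monic_char_poly[OF A] by auto
  have r: "complex_of_real (Re x) = x" if "x \<in># ?R" for x
    using that nz real[of x] eigenvalue_root_char_poly[OF A, of x] by (simp add: complex_eq_iff)
  have "(\<Sum>i=1..m. ordered_eigenvalues m A i ^ n) = (\<Sum>i<m. (xs ! i) ^ n)"
    by (rule sum.reindex_bij_witness[of _ Suc "\<lambda>i. i - 1"])
       (auto simp: ordered_eigenvalues_def xs_def)
  also have "\<dots> = (\<Sum>x\<in>#mset xs. x ^ n)"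
    by (simp add: sum_mset_sum_list sum_list_sum_nth len lessThan_atLeast0 flip: mset_map)
  also have "\<dots> = (\<Sum>x\<in>#?R. Re x ^ n)"
    unfolding mxs by (simp add: image_mset.compositionality o_def)
  finally have "complex_of_real (\<Sum>i=1..m. ordered_eigenvalues m A i ^ n) =
      complex_of_real (\<Sum>x\<in>#?R. Re x ^ n)" by (rule arg_cong)
  also have "\<dots> = (\<Sum>x\<in>#?R. complex_of_real (Re x) ^ n)"
  proof -
    have "complex_of_real (\<Sum>x\<in>#M. Re x ^ n) = (\<Sum>x\<in>#M. complex_of_real (Re x) ^ n)" for M
      by (induction M) simp_all
    then show ?thesis .
  qed
  also have "\<dots> = (\<Sum>x\<in>#?R. x ^ n)"
    by (intro arg_cong[of _ _ sum_mset] image_mset_cong) (simp add: r)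
  also have "\<dots> = mat_trace (A ^\<^sub>m n)"
    by (rule mat_trace_pow_eq_sum_eigenvalues(1)[OF A, symmetric])
  finally show ?thesis by simp
qed

lemma jacobi_matrix_carrier: "jacobi_matrix m p Y \<in> carrier_mat m m"
  unfolding jacobi_matrix_def corner_def
  by (intro mult_carrier_mat[of _ m p] mat_adjoint_carrier) auto

lemma mat_trace_jacobi_matrix_pow:
  "mat_trace (jacobi_matrix m p Y ^\<^sub>m n) =
     complex_of_real (\<Sum>i=1..m. ordered_eigenvalues m (jacobi_matrix m p Y) i ^ n)"
proof (rule sum_ordered_eigenvalues[OF jacobi_matrix_carrier])
  fix x assume "eigenvalue (jacobi_matrix m p Y) x"
  then show "Im x = 0"
    unfolding jacobi_matrix_def by (rule eigenvalue_gram_real[of _ m p, rotated]) (simp add: corner_def)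
qed

section \<open>Contribution of a hook\<close>

text \<open>At injective points the quotient of the empty partition is constantly
  \<open>jlead r s m\<close>. So both sides are limits of the same function at
  \<open>1, ..., 1\<close>, and uniqueness of limits spares any evaluation.\<close>

lemma jvalue_empty: "jvalue r s m (\<lambda>i. m - Suc i) = jlead r s m"
proof -
  let ?F = "at (\<lambda>_. 1 :: real) within {z. inj_on z {1..m}}"
  have e: "jshift m [] = (\<lambda>i. m - Suc i)" by (auto simp: jshift_def part_def)
  have "multi_jacobi_quotient r s m [] z = jlead r s m" if "inj_on z {1..m}" for z
  proof -
    have "vdm m (\<lambda>i. z (Suc i)) \<noteq> 0" using that unfolding vdm_eq_0_iff inj_on_shift by simp
    then show ?thesis
      using detp_empty[of m r s z] by (simp add: multi_jacobi_quotient_eq e detp_def)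
  qed
  then have "(multi_jacobi_quotient r s m [] \<longlongrightarrow> jlead r s m) ?F"
    by (intro Lim_transform_eventually[OF tendsto_const]) (auto simp: eventually_at_filter)
  moreover have "(multi_jacobi_quotient r s m [] \<longlongrightarrow> jvalue r s m (\<lambda>i. m - Suc i)) ?F"
    using tendsto_multi_jacobi_quotient[of r s m "[]"] by (simp add: e)
  ultimately show ?thesis using tendsto_unique[OF at_ones_nontrivial] by blast
qed

lemma detf_diagonal:
  assumes "\<And>i j. i < n \<Longrightarrow> j < n \<Longrightarrow> i \<noteq> j \<Longrightarrow> F i j = 0"
  shows "detf n F = (\<Prod>i<n. F i i)"
proof -
  have "detf n F = prod_list (diag_mat (Matrix.mat n n (\<lambda>(i, j). F i j)))"
    by (rule det_lower_triangular[of n]) (use assms in auto)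
  then show ?thesis by (simp add: prod_list_diag_prod lessThan_atLeast0)
qed

lemma detf_first_row:
  assumes a: "a < Suc n" and z: "\<And>j. j < Suc n \<Longrightarrow> j \<noteq> a \<Longrightarrow> F 0 j = 0"
  shows "detf (Suc n) F = (-1) ^ a * F 0 a * detf n (\<lambda>i j. F (Suc i) (insert_index a j))"
proof -
  let ?A = "Matrix.mat (Suc n) (Suc n) (\<lambda>(i, j). F i j)"
  have "detf (Suc n) F = (\<Sum>j<Suc n. ?A $$ (0, j) * cofactor ?A 0 j)"
    by (rule laplace_expansion_row) auto
  also have "\<dots> = (\<Sum>j\<in>{a}. ?A $$ (0, j) * cofactor ?A 0 j)"
    using a z by (intro sum.mono_neutral_right) auto
  also have "\<dots> = F 0 a * cofactor ?A 0 a" using a by simp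
  also have "mat_delete ?A 0 a = Matrix.mat n n (\<lambda>(i, j). F (Suc i) (insert_index a j))"
    using a by (auto simp: mat_delete_def insert_index_def)
  then have "cofactor ?A 0 a = (-1) ^ a * detf n (\<lambda>i j. F (Suc i) (insert_index a j))"
    by (simp add: cofactor_def)
  finally show ?thesis by simp
qed

text \<open>\<open>b\<close> is the length and \<open>t\<close> the first part. The truncated
  \<open>b - 1\<close> makes \<open>b = 0\<close> give the same list as \<open>b = 1\<close>, hence
  the condition \<open>1 \<le> b\<close> below.\<close>

definition hook :: "nat \<Rightarrow> nat \<Rightarrow> nat list" where
  "hook t b = t # replicate (b - 1) 1"

lemma part_hook:
  assumes "1 \<le> b"
  shows "part (hook t b) (Suc i) = (if i = 0 then t else if i < b then 1 else 0)"
  using assms by (auto simp: part_def hook_def nth_Cons split: nat.split)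

text \<open>The degrees of a hook of length \<open>a + 1\<close>: the new degree
  \<open>Suc n + t\<close> in front, followed by \<open>n, ..., 0\<close> with \<open>n - a\<close>
  left out.\<close>

lemma jshift_hook:
  assumes "b = Suc a" "a \<le> n" "i \<le> n"
  shows "jshift (Suc n) (hook (Suc t) b) 0 = Suc n + t"
    and "i < n \<Longrightarrow> jshift (Suc n) (hook (Suc t) b) (Suc i) = n - insert_index a i"
  using assms by (simp_all add: jshift_def part_hook insert_index_def)

text \<open>No row has the degree \<open>n - a\<close> of column \<open>a\<close>, so the
  determinant vanishes unless this is the altered column. In that case the first row, of degree
  above \<open>n\<close>, meets only column \<open>a\<close>, and the complementary minor is
  diagonal.\<close>

lemma detf_jmatrix_hook:
  assumes a: "a \<le> n"
  shows "detf (Suc n) (jmatrix r s (Suc n) p (hook (Suc t) (Suc a)) c) =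
     (if c = a then (-1) ^ a * wint r s (monom 1 p * jpoly r s (n - a) * jpoly r s (Suc n + t)) *
        (\<Prod>i<n. jnorm2 r s (n - insert_index a i)) else 0)"
proof -
  let ?\<tau> = "hook (Suc t) (Suc a)"
  let ?M = "jmatrix r s (Suc n) p ?\<tau> c"
  have k0: "jshift (Suc n) ?\<tau> 0 = Suc n + t" using jshift_hook(1)[OF refl a le0] .
  have k: "jshift (Suc n) ?\<tau> (Suc i) = n - insert_index a i" if "i < n" for i
    using jshift_hook(2)[OF refl a _ that] that by simp
  show ?thesis
  proof (cases "c = a")
    case True
    have row0: "?M 0 j = 0" if "j \<noteq> a" for j
      using that True k0 by (simp add: jmatrix_orthogonal)
    have sub: "?M (Suc i) (insert_index a j) = (if i = j then jnorm2 r s (n - insert_index a i) else 0)"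
      if "i < n" "j < n" for i j
    proof -
      have "insert_index a j \<noteq> c" using True by (simp add: insert_index_def)
      moreover have "n - insert_index a i = n - insert_index a j \<longleftrightarrow> i = j"
        using that by (auto simp: insert_index_def)
      ultimately show ?thesis using that by (simp add: jmatrix_orthogonal k)
    qed
    have "detf (Suc n) ?M = (-1) ^ a * ?M 0 a * detf n (\<lambda>i j. ?M (Suc i) (insert_index a j))"
      using a row0 by (intro detf_first_row) auto
    also have "detf n (\<lambda>i j. ?M (Suc i) (insert_index a j)) = (\<Prod>i<n. jnorm2 r s (n - insert_index a i))"
      by (subst detf_diagonal) (simp_all add: sub)
    also have "?M 0 a = wint r s (monom 1 p * jpoly r s (n - a) * jpoly r s (Suc n + t))"
      using True k0 by (simp add: jmatrix_def mult_ac)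
    finally show ?thesis using True by simp
  next
    case False
    have "jshift (Suc n) ?\<tau> i \<noteq> Suc n - Suc a" if "i < Suc n" for i
      using that k0 k a by (cases i) (auto simp: insert_index_def)
    then have "detf (Suc n) ?M = 0"
      using False a by (intro detf_jmatrix_eq_0[of a]) auto
    then show ?thesis using False by simp
  qed
qed

text \<open>The norms of the common degrees occur once in the denominator of the density term and
  once in the minor; only the norm of the new degree \<open>Suc n + t\<close> remains.\<close>

lemma jfactor_moment_hook:
  assumes a: "a \<le> n"
  shows "jfactor r s (Suc n) x (hook (Suc t) (Suc a)) * jmode_moment r s (Suc n) p (hook (Suc t) (Suc a)) =
     exp (- real (nu r s (Suc n) (hook (Suc t) (Suc a))) * x) *
     ((-1) ^ a * (jvalue r s (Suc n) (jshift (Suc n) (hook (Suc t) (Suc a))) / jlead r s (Suc n)) *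
      wint r s (monom 1 p * jpoly r s (n - a) * jpoly r s (Suc n + t)) / jnorm2 r s (Suc n + t))"
proof -
  let ?\<tau> = "hook (Suc t) (Suc a)"
  let ?N = "\<Prod>i<n. jnorm2 r s (n - insert_index a i)"
  let ?w = "wint r s (monom 1 p * jpoly r s (n - a) * jpoly r s (Suc n + t))"
  have k0: "jshift (Suc n) ?\<tau> 0 = Suc n + t" using jshift_hook(1)[OF refl a le0] .
  have k: "jshift (Suc n) ?\<tau> (Suc i) = n - insert_index a i" if "i < n" for i
    using jshift_hook(2)[OF refl a _ that] that by simp
  have N: "?N \<noteq> 0" using jnorm2_pos[of r s] by (simp add: less_imp_neq[symmetric])
  have f: "(\<Prod>i<Suc n. 1 / jnorm2 r s (jshift (Suc n) ?\<tau> i)) = 1 / jnorm2 r s (Suc n + t) * (1 / ?N)"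
    unfolding prod.lessThan_Suc_shift by (simp add: k0 k prod_dividef)
  have "jmode_moment r s (Suc n) p ?\<tau> = (\<Sum>c<Suc n. if c = a then (-1) ^ a * ?w * ?N else 0) / jlead r s (Suc n)"
    unfolding jmode_moment_eq detf_jmatrix_hook[OF a] ..
  also have "(\<Sum>c<Suc n. if c = a then (-1) ^ a * ?w * ?N else 0) = (-1) ^ a * ?w * ?N"
    using a by (simp add: sum.delta' del: sum.lessThan_Suc)
  finally have mm: "jmode_moment r s (Suc n) p ?\<tau> = (-1) ^ a * ?w * ?N / jlead r s (Suc n)" .
  show ?thesis
    unfolding jfactor_def f mm using N by (simp add: mult_ac)
qed

text \<open>Andreief's identity also evaluates the normalisation: the integral of the weight is the
  product of the norms divided by \<open>(jlead r s m)\<^sup>2\<close>, which matches the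
  coefficient of the empty partition.\<close>

lemma stationary_term:
  "jfactor r s m t [] * jmode_moment r s m n [] = stationary_moment r s m n"
proof -
  let ?K = "\<lambda>i. m - Suc i"
  let ?H = "\<Prod>i<m. jnorm2 r s (?K i)"
  have e: "jshift m [] = ?K" by (auto simp: jshift_def part_def)
  have H: "?H \<noteq> 0" using jnorm2_pos[of r s] by (simp add: less_imp_neq[symmetric])
  have nu0: "nu r s m [] = 0" by (simp add: nu_def part_def)
  have mode: "jmode r s m [] y = jlead r s m * jacobi_weight r s m y" for y
    unfolding jmode_def e detp_empty jacobi_weight_eq by (simp add: power2_eq_square)
  have "(jlead r s m)\<^sup>2 * (LINT y|lborel_m m. jacobi_weight r s m y) =
      (LINT y|lborel_m m. detp m (\<lambda>i. jpoly r s (?K i)) y * detp m (\<lambda>i. jpoly r s (?K i)) y *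
        (\<Prod>i<m. poly (wpoly r s) (y (Suc i))) * indicator (chamber m) y)"
    unfolding integral_mult_right_zero[symmetric] detp_empty jacobi_weight_eq
    by (simp add: power2_eq_square mult_ac)
  also have "\<dots> = detf m (\<lambda>i j. wint r s (jpoly r s (?K i) * jpoly r s (?K j)))"
    unfolding andreief wint_def ..
  also have "\<dots> = ?H"
    by (subst detf_diagonal) (auto simp: jnorm2_def intro!: wint_jpoly_orthogonal)
  finally have Z: "(LINT y|lborel_m m. jacobi_weight r s m y) = ?H / (jlead r s m)\<^sup>2"
    using jlead_nonzero[of r s m] by (simp add: field_simps)
  have "jfactor r s m t [] = 1 / ?H * jlead r s m"
    unfolding jfactor_def e jvalue_empty nu0 by (simp add: prod_dividef)
  moreover have "jmode_moment r s m n [] =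
      jlead r s m * (LINT y|lborel_m m. (\<Sum>i=1..m. y i ^ n) * jacobi_weight r s m y)"
    unfolding jmode_moment_def mode integral_mult_right_zero[symmetric] by (simp only: mult.left_commute)
  ultimately show ?thesis
    unfolding stationary_moment_def Z using H jlead_nonzero[of r s m]
    by (simp add: power2_eq_square)
qed


text \<open>The pair of \<open>\<alpha> = hook (n - k) (k + 1)\<close> and
  \<open>\<tau> = hook t b\<close> without its exponential; \<open>k\<close> is both
  \<open>n - \<alpha>\<^sub>1\<close> and \<open>l(\<alpha>) - 1\<close>.\<close>

definition hook_summand :: "nat \<Rightarrow> nat \<Rightarrow> nat \<Rightarrow> nat \<Rightarrow> nat \<Rightarrow> nat \<Rightarrow> nat \<Rightarrow> real" where
  "hook_summand r s m n t b k = (-1) ^ k * (V_coeff r s m (n - k) t * U_coeff r s m (k + 1) b /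
     ((real r + real s + real t + 2 * real m - real b) * (real t + real b - 1)))"

lemma hook_contribution:
  assumes t: "1 \<le> t" and b: "1 \<le> b" "b \<le> m"
  shows "jfactor r s m x (hook t b) * jmode_moment r s m n (hook t b) =
    exp (- real (nu r s m (hook t b)) * x) *
      (\<Sum>k | k < n \<and> k < m \<and> b \<le> k + 1 \<and> t \<le> n - k. hook_summand r s m n t b k)"
proof -
  obtain N where m: "m = Suc N" using b by (cases m) auto
  obtain a where a: "b = Suc a" "a \<le> N" using b m by (cases b) auto
  obtain t' where t': "t = Suc t'" using t by (cases t) auto
  define A where "A = N - a"
  define L where "L = Suc N + t'"
  define E where "E = jvalue r s (Suc N) (jshift (Suc N) (hook t b)) / jlead r s (Suc N)"
  have NA: "N = a + A" using a(2) by (simp add: A_def)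
  have lead: "jvalue r s (Suc N) (\<lambda>i. N - i) = jlead r s (Suc N)"
    using jvalue_empty[of r s "Suc N"] by simp
  have E_eq: "E * ((real L - real A) * (real L + real A + real r + real s + 1)) * poly (jpoly r s A) 1 *
      (fact a * (fact (2 * A + r + s + 1 + a) / fact (2 * A + r + s + 1))) *
      (fact A * (fact (2 * A + r + s) / fact (A + r + s))) =
    poly (jpoly r s L) 1 * (fact L / fact t' * (fact (L + Suc N + r + s) / fact (L + r + s)))"
  proof -
    have "jvalue r s (Suc N) (jshift (Suc N) (hook t b)) *
        ((real L - real A) * (real L + real A + real r + real s + 1)) * poly (jpoly r s A) 1 *
        (fact a * (fact (2 * A + r + s + 1 + a) / fact (2 * A + r + s + 1))) *
        (fact A * (fact (2 * A + r + s) / fact (A + r + s))) =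
      jvalue r s (Suc N) (\<lambda>i. N - i) * poly (jpoly r s L) 1 *
        (fact L / fact (L - Suc N) * (fact (L + Suc N + r + s) / fact (L + r + s)))"
    proof (rule jvalue_hook[OF NA])
      show "N < L" by (simp add: L_def)
      show "jshift (Suc N) (hook t b) 0 = L"
        unfolding L_def t' by (rule jshift_hook(1)[OF a le0])
      show "jshift (Suc N) (hook t b) (Suc i) = N - insert_index a i" if "i < N" for i
        unfolding t' using jshift_hook(2)[OF a _ that] that by simp
    qed
    moreover have "v / l * X * p * F * G = q * H"
      if "v * X * p * F * G = l * q * H" "l \<noteq> 0" for v l X p F G q H :: real
      using that by (simp add: field_simps)
    ultimately show ?thesis
      unfolding E_def lead by (simp only: L_def diff_add_inverse jlead_nonzero not_False_eq_True)
  qed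
  let ?K = "{k. k < n \<and> k < m \<and> b \<le> k + 1 \<and> t \<le> n - k}"
  let ?J = "{j \<in> {..A}. L \<le> n + j}"
  let ?g = "\<lambda>j. (-1) ^ a * E * (jcoef r s A j * wint r s (monom 1 (n + j) * jpoly r s L)) / jnorm2 r s L"
  have "jfactor r s m x (hook t b) * jmode_moment r s m n (hook t b) =
      exp (- real (nu r s m (hook t b)) * x) *
      ((-1) ^ a * E * wint r s (monom 1 n * jpoly r s A * jpoly r s L) / jnorm2 r s L)"
    unfolding E_def L_def A_def m a(1) t' by (rule jfactor_moment_hook[OF a(2)])
  also have "(-1) ^ a * E * wint r s (monom 1 n * jpoly r s A * jpoly r s L) / jnorm2 r s L = (\<Sum>j\<le>A. ?g j)"
    unfolding wint_shift_jpoly sum_distrib_left sum_divide_distrib ..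
  \<comment> \<open>Powers \<open>u^(n+j)\<close> of degree below \<open>L\<close> are orthogonal to
    \<open>jpoly r s L\<close>. For \<open>k = N - j\<close> the conditions \<open>j \<le> A\<close>
    and \<open>L \<le> n + j\<close> become \<open>b \<le> k + 1\<close> and
    \<open>t \<le> n - k\<close>.\<close>
  also have "\<dots> = (\<Sum>j\<in>?J. ?g j)"
  proof (rule sum.mono_neutral_right)
    show "\<forall>j\<in>{..A} - ?J. ?g j = 0"
    proof
      fix j assume "j \<in> {..A} - ?J"
      then have "n + j < L" by auto
      then show "?g j = 0" by (simp add: wint_monom_jpoly_less)
    qed
  qed auto
  also have "\<dots> = (\<Sum>k\<in>?K. hook_summand r s m n t b k)"
  proof (rule sum.reindex_bij_witness[of _ "\<lambda>k. N - k" "\<lambda>j. N - j"])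
    fix j assume j: "j \<in> ?J"
    then have jA: "j \<le> A" and Lj: "L \<le> n + j" by auto
    then show "N - (N - j) = j" using NA by simp
    show "N - j \<in> ?K" using jA Lj NA m a t' unfolding L_def by auto
    \<comment> \<open>These are \<open>l(\<alpha>) - l(\<tau>)\<close> and
      \<open>\<alpha>\<^sub>1 - \<tau>\<^sub>1\<close>.\<close>
    define e f where "e = A - j" and "f = n + j - L"
    have nf: "n + j = L + f" "t' + 1 + f = n - (N - j)" "a + 1 + e = N - j + 1" "a + e = N - j"
      using jA Lj NA unfolding e_def f_def L_def by auto
    have tb: "t' + 1 = t" "a + 1 = b" "Suc N = m" using t' a m by simp_all
    have "?g j = (-1) ^ (a + e) * (V_coeff r s (Suc N) (t' + 1 + f) (t' + 1) * U_coeff r s (Suc N) (a + 1 + e) (a + 1) /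
      ((real r + real s + real (t' + 1) + 2 * real (Suc N) - real (a + 1)) * (real (t' + 1) + real (a + 1) - 1)))"
      unfolding nf(1) by (rule hook_coefficient[OF _ _ _ E_eq]) (use jA NA in \<open>auto simp: e_def L_def\<close>)
    note g = this[unfolded nf(2,3,4), unfolded tb]
    show "hook_summand r s m n t b (N - j) = ?g j"
      unfolding hook_summand_def using g by simp
  next
    fix k assume k: "k \<in> ?K"
    then show "N - (N - k) = k" using m by auto
    show "N - k \<in> ?J" using k m a t' NA unfolding L_def by auto
  qed
  finally show ?thesis .
qed

section \<open>Summation over pairs of hooks\<close>

lemma hook_inj: "inj_on (\<lambda>(t, b). hook t b) (UNIV \<times> {1..})"
proof (rule inj_onI, clarify)
  fix t b t' b' :: nat assume "1 \<le> b" "1 \<le> b'" and e: "hook t b = hook t' b'"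
  moreover from e have "length (hook t b) = length (hook t' b')" by simp
  ultimately show "t = t' \<and> b = b'" by (cases b; cases b') (auto simp: hook_def)
qed

lemma hook_in_partitions: "1 \<le> t \<Longrightarrow> hook t b \<in> partitions"
  by (auto simp: hook_def partitions_def sorted_wrt_iff_nth_less nth_Cons split: nat.split)

lemma length_hook: "1 \<le> b \<Longrightarrow> length (hook t b) = b"
  by (simp add: hook_def)

lemma partition_is_hook:
  assumes \<tau>: "\<tau> \<in> partitions" "\<tau> \<noteq> []" and p: "part \<tau> 2 \<le> 1"
  shows "\<tau> = hook (part \<tau> 1) (length \<tau>)" and "1 \<le> part \<tau> 1"
proof -
  obtain x xs where x: "\<tau> = x # xs" using \<tau> by (cases \<tau>) auto
  have "y = 1" if y: "y \<in> set xs" for y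
  proof -
    have "xs ! 0 \<le> 1" using p y x by (cases xs) (auto simp: part_def)
    moreover have "y \<le> xs ! 0"
      using y \<tau>(1) x by (cases xs) (auto simp: partitions_def)
    moreover have "y \<noteq> 0"
    proof
      assume "y = 0"
      then have "0 \<in> set \<tau>" using x y by simp
      then show False using \<tau>(1) by (simp add: partitions_def)
    qed
    ultimately show ?thesis by simp
  qed
  then have "xs = replicate (length xs) 1" by (intro replicate_eqI) auto
  then show "\<tau> = hook (part \<tau> 1) (length \<tau>)" by (simp add: x hook_def part_def)
  show "1 \<le> part \<tau> 1" using \<tau>(1) x by (cases x) (auto simp: partitions_def part_def)
qed

text \<open>Three kinds of terms leave a finite sum: the empty partition gives the stationary
  moment, non-hooks vanish, and a hook with first part above \<open>n\<close> has an empty inner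
  sum.\<close>

lemma jacobi_moment_expansion:
  assumes m: "m \<ge> 1" and n: "n \<ge> 1" and x: "x > 0"
  shows "jacobi_moment r s m n x = stationary_moment r s m n +
    (\<Sum>(t, b)\<in>{1..n} \<times> {1..m}. exp (- real (nu r s m (hook t b)) * x) *
      (\<Sum>k | k < n \<and> k < m \<and> b \<le> k + 1 \<and> t \<le> n - k. hook_summand r s m n t b k))"
proof -
  let ?P = "{\<tau> \<in> partitions. length \<tau> \<le> m}"
  let ?T = "\<lambda>\<tau>. jfactor r s m x \<tau> * jmode_moment r s m n \<tau>"
  let ?H = "(\<lambda>(t, b). hook t b) ` ({1..n} \<times> {1..m})"
  have zero: "?T \<tau> = 0" if \<tau>: "\<tau> \<in> ?P" "\<tau> \<noteq> []" "\<tau> \<notin> ?H" for \<tau>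
  proof (cases "2 \<le> part \<tau> 2")
    case True
    then show ?thesis using jmode_moment_non_hook[OF True] \<tau> by simp
  next
    case False
    then have h: "\<tau> = hook (part \<tau> 1) (length \<tau>)" "1 \<le> part \<tau> 1"
      using partition_is_hook[of \<tau>] \<tau> by auto
    have b: "1 \<le> length \<tau>" "length \<tau> \<le> m" using \<tau> by (auto simp: Suc_le_eq)
    have "\<not> part \<tau> 1 \<le> n"
    proof
      assume "part \<tau> 1 \<le> n"
      then have "(part \<tau> 1, length \<tau>) \<in> {1..n} \<times> {1..m}" using h b by simp
      then have "hook (part \<tau> 1) (length \<tau>) \<in> ?H" by force
      then show False using \<tau>(3) h(1) by simp
    qed
    then have empty: "{k. k < n \<and> k < m \<and> length \<tau> \<le> k + 1 \<and> part \<tau> 1 \<le> n - k} = {}" by auto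
    have "?T (hook (part \<tau> 1) (length \<tau>)) = 0"
      unfolding hook_contribution[OF h(2) b] empty by simp
    then show ?thesis unfolding h(1)[symmetric] .
  qed
  have "jacobi_moment r s m n x = (\<Sum>\<^sub>\<infinity>\<tau>\<in>insert [] ?H. ?T \<tau>)"
    unfolding jacobi_moment_eq_infsum[OF m x]
  proof (rule infsum_cong_neutral)
    have "[] \<in> partitions" by (simp add: partitions_def)
    then have "insert [] ?H \<subseteq> ?P" by (auto simp: hook_in_partitions length_hook)
    then show "?T \<tau> = 0" if "\<tau> \<in> insert [] ?H - ?P" for \<tau> using that by blast
  qed (use zero in auto)
  also have "\<dots> = ?T [] + (\<Sum>\<tau>\<in>?H. ?T \<tau>)"
    by (subst infsum_finite, simp) (rule sum.insert, auto simp: hook_def)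
  also have "(\<Sum>\<tau>\<in>?H. ?T \<tau>) = (\<Sum>(t, b)\<in>{1..n} \<times> {1..m}. ?T (hook t b))"
    by (subst sum.reindex[OF inj_on_subset[OF hook_inj]]) (auto simp: case_prod_unfold)
  also have "\<dots> = (\<Sum>(t, b)\<in>{1..n} \<times> {1..m}. exp (- real (nu r s m (hook t b)) * x) *
      (\<Sum>k | k < n \<and> k < m \<and> b \<le> k + 1 \<and> t \<le> n - k. hook_summand r s m n t b k))"
    by (rule sum.cong) (auto simp: hook_contribution)
  finally show ?thesis by (simp only: stationary_term)
qed

lemma hooks_eq: "{\<alpha> \<in> hooks n. length \<alpha> \<le> m} = (\<lambda>k. hook (n - k) (Suc k)) ` {k. k < n \<and> k < m}"
  unfolding hooks_def hook_def by auto

text \<open>Containment in a hook bounds the second part by 1, so a nonempty \<tau> is a hook again,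
  with first part and length varying independently.\<close>

lemma part_le_hook:
  assumes "k < n"
  shows "{\<tau> \<in> partitions. part_le \<tau> (hook (n - k) (Suc k)) \<and> \<tau> \<noteq> []} =
    (\<lambda>(t, b). hook t b) ` ({1..n - k} \<times> {1..Suc k})"
proof (intro equalityI subsetI)
  fix \<tau> assume "\<tau> \<in> {\<tau> \<in> partitions. part_le \<tau> (hook (n - k) (Suc k)) \<and> \<tau> \<noteq> []}"
  then have \<tau>: "\<tau> \<in> partitions" "\<tau> \<noteq> []" and le: "\<And>i. 1 \<le> i \<Longrightarrow> part \<tau> i \<le> part (hook (n - k) (Suc k)) i"
    by (auto simp: part_le_def)
  have "part \<tau> 2 \<le> 1" using le[of 2] part_hook[of "Suc k" "n - k" 1] by (simp add: numeral_2_eq_2 split: if_splits)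
  note h = partition_is_hook[OF \<tau> this]
  have "part \<tau> 1 \<le> n - k" using le[of 1] part_hook[of "Suc k" "n - k" 0] by simp
  moreover have "length \<tau> \<le> Suc k"
  proof (rule ccontr)
    assume l: "\<not> length \<tau> \<le> Suc k"
    then obtain h where h: "length \<tau> = Suc h" "Suc k \<le> h" by (cases "length \<tau>") auto
    have "part \<tau> (Suc h) \<le> part (hook (n - k) (Suc k)) (Suc h)"
      by (rule le) simp
    also have "\<dots> = 0" using h(2) by (subst part_hook) auto
    finally have "\<tau> ! h = 0" using h(1) by (simp add: part_def)
    moreover have "\<tau> ! h \<in> set \<tau>" using h(1) by (intro nth_mem) simp
    ultimately show False using \<tau>(1) by (simp add: partitions_def)
  qed
  ultimately have "(part \<tau> 1, length \<tau>) \<in> {1..n - k} \<times> {1..Suc k}"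
    using h(2) \<tau>(2) by (auto simp: Suc_le_eq)
  then have "hook (part \<tau> 1) (length \<tau>) \<in> (\<lambda>(t, b). hook t b) ` ({1..n - k} \<times> {1..Suc k})" by force
  then show "\<tau> \<in> (\<lambda>(t, b). hook t b) ` ({1..n - k} \<times> {1..Suc k})" using h(1) by simp
next
  fix \<tau> assume "\<tau> \<in> (\<lambda>(t, b). hook t b) ` ({1..n - k} \<times> {1..Suc k})"
  then obtain t b where tb: "\<tau> = hook t b" "1 \<le> t" "t \<le> n - k" "1 \<le> b" "b \<le> Suc k" by auto
  have "part \<tau> i \<le> part (hook (n - k) (Suc k)) i" if "1 \<le> i" for i
    using tb that by (cases i) (auto simp: part_hook)
  then show "\<tau> \<in> {\<tau> \<in> partitions. part_le \<tau> (hook (n - k) (Suc k)) \<and> \<tau> \<noteq> []}"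
    using tb by (auto simp: part_le_def hook_in_partitions) (simp add: hook_def)
qed

text \<open>The partitions inside the hook of index \<open>k\<close> fill a rectangle depending on
  \<open>k\<close>. Extended by zero to the fixed rectangle \<open>{1..n} \<times> {1..m}\<close>,
  the sums can be interchanged.\<close>

lemma double_sum_eq:
  fixes x :: real
  shows "(\<Sum>\<alpha>\<in>{\<alpha> \<in> hooks n. length \<alpha> \<le> m}. (-1) ^ (n - part \<alpha> 1) *
        (\<Sum>\<tau>\<in>{\<tau> \<in> partitions. part_le \<tau> \<alpha> \<and> \<tau> \<noteq> []}.
          exp (- real (nu r s m \<tau>) * x) *
          V_coeff r s m (part \<alpha> 1) (part \<tau> 1) * U_coeff r s m (length \<alpha>) (length \<tau>) /
          ((real r + real s + real (part \<tau> 1) + 2 * real m - real (length \<tau>)) *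
           (real (part \<tau> 1) + real (length \<tau>) - 1)))) =
    (\<Sum>(t, b)\<in>{1..n} \<times> {1..m}. exp (- real (nu r s m (hook t b)) * x) *
      (\<Sum>k | k < n \<and> k < m \<and> b \<le> k + 1 \<and> t \<le> n - k. hook_summand r s m n t b k))"
proof -
  let ?e = "\<lambda>t b. exp (- real (nu r s m (hook t b)) * x)"
  let ?Q = "\<lambda>\<alpha> \<tau>. exp (- real (nu r s m \<tau>) * x) *
          V_coeff r s m (part \<alpha> 1) (part \<tau> 1) * U_coeff r s m (length \<alpha>) (length \<tau>) /
          ((real r + real s + real (part \<tau> 1) + 2 * real m - real (length \<tau>)) *
           (real (part \<tau> 1) + real (length \<tau>) - 1))"
  let ?I = "{k. k < n \<and> k < m}" and ?TB = "{1..n} \<times> {1..m}"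
  have part1: "part (hook t b) 1 = t" "part (hook t b) (Suc 0) = t" for t b by (simp_all add: part_def hook_def)
  have inj: "inj_on (\<lambda>k. hook (n - k) (Suc k)) ?I"
    by (rule inj_onI) (metis Suc_inject length_hook le_add1 plus_1_eq_Suc)
  have "(\<Sum>\<alpha>\<in>{\<alpha> \<in> hooks n. length \<alpha> \<le> m}. (-1) ^ (n - part \<alpha> 1) *
        (\<Sum>\<tau>\<in>{\<tau> \<in> partitions. part_le \<tau> \<alpha> \<and> \<tau> \<noteq> []}. ?Q \<alpha> \<tau>)) =
     (\<Sum>k\<in>?I. (-1) ^ k * (\<Sum>\<tau>\<in>(\<lambda>(t, b). hook t b) ` ({1..n - k} \<times> {1..Suc k}). ?Q (hook (n - k) (Suc k)) \<tau>))"
    unfolding hooks_eq sum.reindex[OF inj]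
    by (rule sum.cong) (auto simp: part_le_hook part1)
  also have "\<dots> = (\<Sum>k\<in>?I. \<Sum>(t, b)\<in>?TB. if b \<le> k + 1 \<and> t \<le> n - k then ?e t b * hook_summand r s m n t b k else 0)"
  proof (rule sum.cong[OF refl])
    fix k assume k: "k \<in> ?I"
    have "(-1) ^ k * (\<Sum>\<tau>\<in>(\<lambda>(t, b). hook t b) ` ({1..n - k} \<times> {1..Suc k}). ?Q (hook (n - k) (Suc k)) \<tau>) =
        (\<Sum>(t, b)\<in>{1..n - k} \<times> {1..Suc k}. (-1) ^ k * ?Q (hook (n - k) (Suc k)) (hook t b))"
      unfolding sum_distrib_left
      by (subst sum.reindex[OF inj_on_subset[OF hook_inj]]) (auto simp: case_prod_unfold)
    also have "\<dots> = (\<Sum>(t, b)\<in>{1..n - k} \<times> {1..Suc k}. ?e t b * hook_summand r s m n t b k)"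
      by (rule sum.cong) (auto simp: part1 length_hook hook_summand_def)
    also have "\<dots> = (\<Sum>(t, b)\<in>{1..n - k} \<times> {1..Suc k}.
        if b \<le> k + 1 \<and> t \<le> n - k then ?e t b * hook_summand r s m n t b k else 0)"
      by (rule sum.cong) auto
    also have "\<dots> = (\<Sum>(t, b)\<in>?TB. if b \<le> k + 1 \<and> t \<le> n - k then ?e t b * hook_summand r s m n t b k else 0)"
      by (rule sum.mono_neutral_left) (use k in \<open>auto split: if_splits\<close>)
    finally show "(-1) ^ k * (\<Sum>\<tau>\<in>(\<lambda>(t, b). hook t b) ` ({1..n - k} \<times> {1..Suc k}). ?Q (hook (n - k) (Suc k)) \<tau>) =
      (\<Sum>(t, b)\<in>?TB. if b \<le> k + 1 \<and> t \<le> n - k then ?e t b * hook_summand r s m n t b k else 0)" .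
  qed
  also have "\<dots> = (\<Sum>(t, b)\<in>?TB. \<Sum>k\<in>?I. if b \<le> k + 1 \<and> t \<le> n - k then ?e t b * hook_summand r s m n t b k else 0)"
    by (subst sum.swap) (simp add: case_prod_unfold)
  also have "\<dots> = (\<Sum>(t, b)\<in>?TB. ?e t b *
      (\<Sum>k | k < n \<and> k < m \<and> b \<le> k + 1 \<and> t \<le> n - k. hook_summand r s m n t b k))"
  proof (rule sum.cong[OF refl], clarify)
    fix t b
    have "{k. k < n \<and> k < m \<and> b \<le> k + 1 \<and> t \<le> n - k} = {k \<in> ?I. b \<le> k + 1 \<and> t \<le> n - k}" by auto
    then show "(\<Sum>k\<in>?I. if b \<le> k + 1 \<and> t \<le> n - k then ?e t b * hook_summand r s m n t b k else 0) =
      ?e t b * (\<Sum>k | k < n \<and> k < m \<and> b \<le> k + 1 \<and> t \<le> n - k. hook_summand r s m n t b k)"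
      by (simp only: sum_distrib_left) (rule sum.inter_filter[symmetric], simp)
  qed
  finally show ?thesis .
qed

lemma expectation_trace_pow:
  assumes m: "m \<ge> 1" and t: "t > 0" and Y: "hermitian_jacobi_process \<Omega> m p d Y"
    and rs: "r = p - m" "s = d - p - m"
  shows "(LINT \<omega>|\<Omega>. mat_trace (jacobi_matrix m p (Y t \<omega>) ^\<^sub>m n)) = complex_of_real (jacobi_moment r s m n t)"
proof -
  let ?D = "jacobi_density r s m t"
  let ?X = "\<lambda>\<omega>. ordered_eigenvalues m (jacobi_matrix m p (Y t \<omega>))"
  let ?p = "\<lambda>y :: nat \<Rightarrow> real. \<Sum>i=1..m. y i ^ n"
  have dist: "distributed \<Omega> (lborel_m m) ?X (\<lambda>y. ennreal (?D y))"
    and nonneg: "AE y in lborel_m m. 0 \<le> ?D y"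
    using Y t unfolding hermitian_jacobi_process_def rs by blast+
  have D: "?D \<in> borel_measurable (lborel_m m)" by (rule borel_measurable_jacobi_density[OF m t])
  have p: "?p \<in> borel_measurable (lborel_m m)"
    by (intro borel_measurable_sum borel_measurable_power) (auto intro: measurable_component_singleton)
  \<comment> \<open>The density is known to be nonnegative only almost everywhere. Its truncation at
    0 has the same \<open>ennreal\<close> value and is nonnegative at every point, as
    \<open>distributed_integral\<close> demands.\<close>
  have e: "ennreal (?D y) = ennreal (max 0 (?D y))" for y by (simp add: max_def ennreal_neg)
  have "(LINT y|lborel_m m. max 0 (?D y) * ?p y) = (LINT \<omega>|\<Omega>. ?p (?X \<omega>))"
    using dist unfolding e by (rule distributed_integral) (use p in auto)
  moreover have "(LINT y|lborel_m m. max 0 (?D y) * ?p y) = jacobi_moment r s m n t"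
    unfolding jacobi_moment_def
  proof (rule integral_cong_AE)
    show "AE y in lborel_m m. max 0 (?D y) * ?p y = ?p y * ?D y"
      using nonneg by eventually_elim (simp add: mult.commute)
  qed (intro borel_measurable_times borel_measurable_max borel_measurable_const D p)+
  ultimately have "(LINT \<omega>|\<Omega>. ?p (?X \<omega>)) = jacobi_moment r s m n t" by simp
  then show ?thesis
    unfolding mat_trace_jacobi_matrix_pow integral_complex_of_real by (rule arg_cong)
qed

theorem theorem1:
  fixes m p d r s n :: nat and t :: real
    and \<Omega> :: "'a measure" and Y :: "real \<Rightarrow> 'a \<Rightarrow> complex mat"
  assumes "m \<ge> 1" "p \<ge> 1" "d \<ge> 1"
    and "m \<le> p" "p + m \<le> d"
    and "r = p - m" "s = d - p - m"
    and "n \<ge> 1" "t > 0"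
  shows "jacobi_moment r s m n t =
      stationary_moment r s m n +
      (\<Sum>\<alpha>\<in>{\<alpha> \<in> hooks n. length \<alpha> \<le> m}. (-1) ^ (n - part \<alpha> 1) *
        (\<Sum>\<tau>\<in>{\<tau> \<in> partitions. part_le \<tau> \<alpha> \<and> \<tau> \<noteq> []}.
          exp (- real (nu r s m \<tau>) * t) *
          V_coeff r s m (part \<alpha> 1) (part \<tau> 1) * U_coeff r s m (length \<alpha>) (length \<tau>) /
          ((real r + real s + real (part \<tau> 1) + 2 * real m - real (length \<tau>)) *
           (real (part \<tau> 1) + real (length \<tau>) - 1))))
    \<and> (hermitian_jacobi_process \<Omega> m p d Y \<longrightarrow>
        (LINT \<omega>|\<Omega>. mat_trace (jacobi_matrix m p (Y t \<omega>) ^\<^sub>m n)) =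
        complex_of_real (jacobi_moment r s m n t))"
proof (intro conjI impI)
  have m: "m \<ge> 1" and n: "n \<ge> 1" and t: "t > 0" by fact+
  show "jacobi_moment r s m n t =
      stationary_moment r s m n +
      (\<Sum>\<alpha>\<in>{\<alpha> \<in> hooks n. length \<alpha> \<le> m}. (-1) ^ (n - part \<alpha> 1) *
        (\<Sum>\<tau>\<in>{\<tau> \<in> partitions. part_le \<tau> \<alpha> \<and> \<tau> \<noteq> []}.
          exp (- real (nu r s m \<tau>) * t) *
          V_coeff r s m (part \<alpha> 1) (part \<tau> 1) * U_coeff r s m (length \<alpha>) (length \<tau>) /
          ((real r + real s + real (part \<tau> 1) + 2 * real m - real (length \<tau>)) *
           (real (part \<tau> 1) + real (length \<tau>) - 1))))"
    unfolding double_sum_eq by (rule jacobi_moment_expansion[OF m n t])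
  assume "hermitian_jacobi_process \<Omega> m p d Y"
  then show "(LINT \<omega>|\<Omega>. mat_trace (jacobi_matrix m p (Y t \<omega>) ^\<^sub>m n)) =
      complex_of_real (jacobi_moment r s m n t)"
    using assms by (intro expectation_trace_pow) auto
qed

end
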